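(* Let $n\ge1$ and let $M\in C^1(\mathbb{R}^n\times(0,+\infty))$ be a real-valued function, not identically zero, such that $$M(x,t)=t^{-n/2}M\bigl(x/\sqrt t,1\bigr),\qquad x\in\mathbb{R}^n,\ t>0,$$ and, for some constants $C_0,C_1$ and all $x\neq0$, $t>0$, $$|\partial_x^mM(x,t)|\le C_m|x|^{-n-m},\qquad m=0,1.$$ (1) Let $f\in L^1(\mathbb{R}^n\times\mathbb{R}^+)$ be real-valued with $\|f(t)\|_1=\mathcal O(\frac1t)$ as $t\to+\infty$. Put $\lambda=\int_0^\infty\!\int f(y,s)\,dy\,ds$ and $$\Phi(x,t)=\int_0^t\!\!\int M(x-y,t-s)f(y,s)\,dy\,ds.$$ Then, as $t\to+\infty$, $$\bigl\|\Phi(t)-\lambda M(\cdot,t)\bigr\|_q=o\bigl(t^{-\frac n2(1-\frac1q)}\bigr)\qquad\text{for }\begin{cases}1<q\le\infty&\text{if }n=1,\\ 1<q<\frac n{n-2}&\text{if }n\ge2\end{cases}$$ (with $\frac n{n-2}=\infty$ if $n=2$). In particular, there exist two constants $c_q,c_q'>0$, independent of $f$, such that if $\lambda\ne0$ then, for all sufficiently large $t$, $$|\lambda|\,c_q\,t^{-\frac n2(1-\frac1q)}\le\|\Phi(t)\|_q\le|\lambda|\,c'_q\,t^{-\frac n2(1-\frac1q)}.$$ (2) The two conclusions of (1) (the asymptotic profile and the two-sided bound) extend to $q=1$ if in addition $M(\cdot,1)\in L^1(\mathbb{R}^n)$; and, for $n\ge2$, they extend to $\frac n{n-2}\le q\le\infty$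 provided that in addition $\|f(t)\|_\beta=\mathcal O\bigl(t^{-(1+\frac n2(1-\frac1\beta))}\bigr)$ as $t\to+\infty$ for some $\beta$ such that $\frac1q\le\frac1\beta<\frac1q+\frac2n$.
   Context: $\|\cdot\|_q$ is the $L^q(\mathbb{R}^n)$-norm in the space variable and $f(t)=f(\cdot,t)$, $\Phi(t)=\Phi(\cdot,t)$. The exponents satisfy $1\le\beta\le\infty$. $\partial_x^m$ denotes any partial derivative of order $m$ in $x$. *)

theory Defs
  imports "HOL-Analysis.Analysis" "HOL-Probability.Essential_Supremum"
begin

definition C1_on :: "('a::real_normed_vector) set \<Rightarrow> ('a \<Rightarrow> real) \<Rightarrow> bool" where
  "C1_on S g \<longleftrightarrow>
     (\<exists>g' :: 'a \<Rightarrow> 'a \<Rightarrow>\<^sub>L real.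
        (\<forall>z\<in>S. (g has_derivative blinfun_apply (g' z)) (at z)) \<and> continuous_on S g')"

definition partial_x :: "'n::finite \<Rightarrow> (real^'n \<Rightarrow> real \<Rightarrow> real) \<Rightarrow> real^'n \<Rightarrow> real \<Rightarrow> real" where
  "partial_x i M x t = deriv (\<lambda>h. M (x + h *\<^sub>R axis i 1) t) 0"

(* The L^q norm for 1 <= q <= \<infinity>, as an extended nonnegative number.  It is top for functions that
   are not Lebesgue measurable, so a finite value means that g represents an element of L^q. *)
definition Lp_norm :: "ennreal \<Rightarrow> ('a::euclidean_space \<Rightarrow> real) \<Rightarrow> ennreal" where
  "Lp_norm q g =
     (if g \<notin> borel_measurable lebesgue then top
      else if q = top then esssup lebesgue (\<lambda>x. ennreal \<bar>g x\<bar>)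
      else (let I = (\<integral>\<^sup>+x. ennreal (\<bar>g x\<bar> powr enn2real q) \<partial>lebesgue)
            in if I = top then top else ennreal (enn2real I powr (1 / enn2real q))))"

(* F(t) = O(g(t)) as t tends to infinity.  Only almost every t is constrained, since f(t) is
   determined only for almost every t when f is a class of functions on space-time. *)
definition norm_bigo_ae :: "(real \<Rightarrow> ennreal) \<Rightarrow> (real \<Rightarrow> real) \<Rightarrow> bool" where
  "norm_bigo_ae F g \<longleftrightarrow> (\<exists>C T. AE t in lebesgue. T \<le> t \<longrightarrow> F t \<le> ennreal (C * g t))"

definition norm_smallo :: "(real \<Rightarrow> ennreal) \<Rightarrow> (real \<Rightarrow> real) \<Rightarrow> bool" where
  "norm_smallo F g \<longleftrightarrow> (\<forall>\<epsilon>>0. \<forall>\<^sub>F t in at_top. F t \<le> ennreal (\<epsilon> * g t))"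

(* The number (n/2)(1 - 1/q); in ennreal 1/\<infinity> = 0. *)
definition decay_exp :: "nat \<Rightarrow> ennreal \<Rightarrow> real" where
  "decay_exp n q = real n / 2 * (1 - enn2real (1 / q))"

(* n/(n-2) for n >= 2; division in ennreal makes this \<infinity> when n = 2. *)
definition crit_exp :: "nat \<Rightarrow> ennreal" where
  "crit_exp n = of_nat n / of_nat (n - 2)"

definition source :: "(real^'n \<Rightarrow> real \<Rightarrow> real) \<Rightarrow> bool" where
  "source f \<longleftrightarrow>
     set_integrable lebesgue (UNIV \<times> {0<..}) (\<lambda>(y, s). f y s) \<and>
     norm_bigo_ae (\<lambda>t. Lp_norm 1 (\<lambda>x. f x t)) (\<lambda>t. 1 / t)"

definition mass :: "(real^'n \<Rightarrow> real \<Rightarrow> real) \<Rightarrow> real" where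
  "mass f = (LINT s:{0<..}|lebesgue. (LINT y|lebesgue. f y s))"

definition Phi :: "(real^'n \<Rightarrow> real \<Rightarrow> real) \<Rightarrow> (real^'n \<Rightarrow> real \<Rightarrow> real) \<Rightarrow> real^'n \<Rightarrow> real \<Rightarrow> real" where
  "Phi M f x t = (LINT s:{0<..<t}|lebesgue. (LINT y|lebesgue. M (x - y) (t - s) * f y s))"

(* Bochner integrals of non-integrable functions are 0 by convention; the first conjunct says that
   the integral defining Phi(x,t) really converges for almost every x once t is large. *)
definition asymptotic_profile ::
  "(real^'n \<Rightarrow> real \<Rightarrow> real) \<Rightarrow> (real^'n \<Rightarrow> real \<Rightarrow> real) \<Rightarrow> ennreal \<Rightarrow> bool" where
  "asymptotic_profile M f q \<longleftrightarrow>
     (\<forall>\<^sub>F t in at_top. AE x in lebesgue.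
        set_integrable lebesgue (UNIV \<times> {0<..<t}) (\<lambda>(y, s). M (x - y) (t - s) * f y s)) \<and>
     norm_smallo (\<lambda>t. Lp_norm q (\<lambda>x. Phi M f x t - mass f * M x t))
       (\<lambda>t. t powr (- decay_exp CARD('n) q))"

definition two_sided_bound ::
  "(real^'n \<Rightarrow> real \<Rightarrow> real) \<Rightarrow> (real^'n \<Rightarrow> real \<Rightarrow> real) \<Rightarrow> ennreal \<Rightarrow> real \<Rightarrow> real \<Rightarrow> bool" where
  "two_sided_bound M f q c c' \<longleftrightarrow>
     (\<forall>\<^sub>F t in at_top.
        ennreal (\<bar>mass f\<bar> * c * t powr (- decay_exp CARD('n) q)) \<le> Lp_norm q (\<lambda>x. Phi M f x t) \<and>
        Lp_norm q (\<lambda>x. Phi M f x t) \<le> ennreal (\<bar>mass f\<bar> * c' * t powr (- decay_exp CARD('n) q)))"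

(* The constants c, c' are chosen before f. *)
definition profile_and_bounds ::
  "(real^'n \<Rightarrow> real \<Rightarrow> real) \<Rightarrow> ennreal \<Rightarrow> (real^'n \<Rightarrow> real \<Rightarrow> real) set \<Rightarrow> bool" where
  "profile_and_bounds M q F \<longleftrightarrow>
     (\<forall>f\<in>F. asymptotic_profile M f q) \<and>
     (\<exists>c>0. \<exists>c'>0. \<forall>f\<in>F. mass f \<noteq> 0 \<longrightarrow> two_sided_bound M f q c c')"

end

theory Submission
  imports Defs
begin

text \<open>
  Split \<open>\<Phi>(t) - \<lambda> M(t)\<close> into the integral of \<open>(M(x - y, t - s) - M(x, t)) f(y, s)\<close> over small
  \<open>y / \<surd>t\<close> and \<open>s / t\<close>, where the norm of the bracket is a small multiple of the norm of \<open>M(t)\<close> by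
  continuity of translations and dilations in \<open>L\<^sup>q\<close>; over the remaining \<open>s \<le> (1 - \<delta>) t\<close>, where the
  bracket is merely bounded but the mass of \<open>f\<close> tends to zero; and over \<open>(1 - \<delta>) t < s < t\<close>, where
  Young's inequality and the decay of \<open>f\<close> give a bound that is small with \<open>\<delta>\<close>. Pairing everything
  with a test function in the dual unit ball turns Minkowski's integral inequality into Tonelli's
  theorem and Young's inequality into the weighted arithmetic-geometric mean inequality. If the extra
  decay is assumed for \<open>\<beta> = q\<close>, Young's inequality would require \<open>M(1) \<in> L\<^sup>1\<close>; interpolation with the \<open>L\<^sup>1\<close> decay of \<open>f\<close> replaces \<open>\<beta>\<close> by a smaller exponent.
\<close>

section \<open>Norm bounds and duality\<close>

text \<open>Without extra decay of \<open>f\<close>, the condition on \<open>q\<close> says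
  \<open>(n/2)(1 - 1/q) < 1\<close>: the norm of \<open>M(t - s)\<close> must be integrable up to
  \<open>s = t\<close> against a source controlled only in \<open>L^1\<close>. Beyond this range the
  kernel is measured with a larger reciprocal exponent \<open>\<mu>\<close>, for which the
  singularity is integrable, and Young's relation \<open>1 + \<theta> = \<mu> + \<beta>\<close>
  moves the missing part to the decay of \<open>f\<close>. The limit \<open>\<mu> = 1\<close> is out
  of reach because \<open>|x|^(-n)\<close> just fails to be integrable at infinity. Since
  \<open>\<lambda>\<close> integrates over all times, \<open>M\<close> is extended by zero to
  nonpositive times; sources at \<open>s \<ge> t\<close> then contribute only
  \<open>M(x, t)\<close>, weighted with the tail of \<open>f\<close>. The dual pairing is applied
  with absolute values inside the space-time integral. It therefore bounds the norm and at the same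
  time shows that the integral defining \<open>\<Phi>\<close> converges for almost every
  \<open>x\<close>, which has to precede any manipulation of \<open>\<Phi>\<close>.\<close>

text \<open>The parameter \<open>\<theta>\<close> is the reciprocal of the exponent, so that \<open>\<theta> = 0\<close> encodes \<open>L\<^sup>\<infinity>\<close> and the
  conjugate exponent is encoded by \<open>1 - \<theta>\<close>.\<close>
definition Lp_le :: "real \<Rightarrow> ('a::euclidean_space \<Rightarrow> real) \<Rightarrow> real \<Rightarrow> bool" where
  "Lp_le \<theta> u A \<longleftrightarrow>
     (if \<theta> = 0 then AE x in lborel. \<bar>u x\<bar> \<le> A
      else (\<integral>\<^sup>+x. ennreal (\<bar>u x\<bar> powr (1 / \<theta>)) \<partial>lborel) \<le> ennreal (A powr (1 / \<theta>)))"

definition dual_ball :: "real \<Rightarrow> ('a::euclidean_space \<Rightarrow> real) set" where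
  "dual_ball \<theta> = {g \<in> borel_measurable borel. (\<forall>x. 0 \<le> g x) \<and> Lp_le (1 - \<theta>) g 1}"

text \<open>The tangent line of the logarithm at the weighted mean \<open>S\<close>: averaging
  \<open>ln x \<le> ln S + x / S - 1\<close> over the three points gives \<open>ln S\<close>. Three
  weights serve Young's inequality; Holder's inequality takes the third weight zero.\<close>

lemma weighted_am_gm3:
  fixes a b c :: real
  assumes "0 \<le> a" "0 \<le> b" "0 \<le> c" "0 \<le> \<alpha>" "0 \<le> \<beta>" "0 \<le> \<gamma>" "\<alpha> + \<beta> + \<gamma> = 1"
  shows "a powr \<alpha> * b powr \<beta> * c powr \<gamma> \<le> \<alpha> * a + \<beta> * b + \<gamma> * c"
proof (cases "a = 0 \<or> b = 0 \<or> c = 0")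
  \<comment> \<open>\<open>0 powr 0\<close> is 0, so the left side vanishes as soon as one base is
    zero, whatever its exponent.\<close>
  case True
  then show ?thesis using assms by auto
next
  case False
  then have pos: "a > 0" "b > 0" "c > 0" using assms by auto
  define S where "S = \<alpha> * a + \<beta> * b + \<gamma> * c"
  have "\<alpha> > 0 \<or> \<beta> > 0 \<or> \<gamma> > 0" using assms by linarith
  then have S: "S > 0" unfolding S_def using assms pos
    by (smt (verit) mult_nonneg_nonneg mult_pos_pos)
  have le: "ln x \<le> ln S + x / S - 1" if "x > 0" for x
    using ln_le_minus_one[of "x / S"] that S by (simp add: ln_div)
  have "\<alpha> * ln a + \<beta> * ln b + \<gamma> * ln c
      \<le> \<alpha> * (ln S + a / S - 1) + \<beta> * (ln S + b / S - 1) + \<gamma> * (ln S + c / S - 1)"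
    using le pos assms by (intro add_mono mult_left_mono) auto
  also have "\<dots> = (\<alpha> + \<beta> + \<gamma>) * (ln S - 1) + (\<alpha> * a + \<beta> * b + \<gamma> * c) / S"
    by (simp add: algebra_simps add_divide_distrib)
  also have "\<dots> = (\<alpha> + \<beta> + \<gamma>) * (ln S - 1) + S / S" by (simp only: S_def)
  also have "\<dots> = ln S" using S assms by simp
  finally have "exp (\<alpha> * ln a + \<beta> * ln b + \<gamma> * ln c) \<le> S"
    using S by (metis exp_le_cancel_iff exp_ln)
  then show ?thesis using pos by (simp add: powr_def exp_add S_def)
qed

lemma Lp_le_cmult:
  fixes u :: "'a::euclidean_space \<Rightarrow> real"
  assumes "c > 0" "0 \<le> \<theta>" "0 \<le> A" and [measurable]: "u \<in> borel_measurable borel"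
  shows "Lp_le \<theta> (\<lambda>x. c * u x) (c * A) \<longleftrightarrow> Lp_le \<theta> u A"
proof (cases "\<theta> = 0")
  case True
  then show ?thesis using assms by (simp add: Lp_le_def abs_mult)
next
  case False
  have "(\<integral>\<^sup>+x. ennreal (\<bar>c * u x\<bar> powr (1 / \<theta>)) \<partial>lborel)
      = ennreal (c powr (1 / \<theta>)) * (\<integral>\<^sup>+x. ennreal (\<bar>u x\<bar> powr (1 / \<theta>)) \<partial>lborel)"
    using assms by (subst nn_integral_cmult[symmetric]) (auto simp: abs_mult powr_mult ennreal_mult)
  moreover have "ennreal ((c * A) powr (1 / \<theta>)) = ennreal (c powr (1 / \<theta>)) * ennreal (A powr (1 / \<theta>))"
    using assms by (simp add: powr_mult ennreal_mult)
  ultimately show ?thesis using assms False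
    by (simp add: Lp_le_def ennreal_mult_le_mult_iff)
qed

lemma Lp_le_mono:
  assumes "Lp_le \<theta> u A" "A \<le> B" "0 \<le> A" "0 \<le> \<theta>" "AE x in lborel. \<bar>v x\<bar> \<le> \<bar>u x\<bar>"
  shows "Lp_le \<theta> v B"
proof (cases "\<theta> = 0")
  case True
  have "AE x in lborel. \<bar>u x\<bar> \<le> A" using assms True by (simp add: Lp_le_def)
  with assms(5) have "AE x in lborel. \<bar>v x\<bar> \<le> B"
    by eventually_elim (use assms in linarith)
  then show ?thesis using True by (simp add: Lp_le_def)
next
  case False
  have "(\<integral>\<^sup>+x. ennreal (\<bar>v x\<bar> powr (1 / \<theta>)) \<partial>lborel) \<le> (\<integral>\<^sup>+x. ennreal (\<bar>u x\<bar> powr (1 / \<theta>)) \<partial>lborel)"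
    using assms by (intro nn_integral_mono_AE) (auto intro!: ennreal_leI powr_mono2 elim!: eventually_mono)
  also have "\<dots> \<le> ennreal (A powr (1 / \<theta>))" using assms False by (simp add: Lp_le_def)
  also have "\<dots> \<le> ennreal (B powr (1 / \<theta>))" using assms by (intro ennreal_leI powr_mono2) auto
  finally show ?thesis using False by (simp add: Lp_le_def)
qed

lemma dual_ballD:
  assumes "g \<in> dual_ball \<theta>"
  shows "g \<in> borel_measurable borel" "\<And>x. 0 \<le> g x" "Lp_le (1 - \<theta>) g 1"
  using assms by (auto simp: dual_ball_def)

lemma Lp_le_one_nn_integral:
  assumes "Lp_le \<theta> u 1" "\<theta> \<noteq> 0"
  shows "(\<integral>\<^sup>+x. ennreal (\<bar>u x\<bar> powr (1 / \<theta>)) \<partial>lborel) \<le> 1"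
  using assms by (simp add: Lp_le_def)

lemma Lp_le_1_iff:
  assumes "0 \<le> A"
  shows "Lp_le 1 u A \<longleftrightarrow> (\<integral>\<^sup>+x. ennreal \<bar>u x\<bar> \<partial>lborel) \<le> ennreal A"
  using assms by (simp add: Lp_le_def)

text \<open>Integrated pointwise inequality \<open>|u| g \<le> \<theta> |u|^(1/\<theta>) +
  (1-\<theta>) g^(1/(1-\<theta>))\<close>; the weights sum to one. The endpoints are separate
  because one reciprocal would divide by zero, the norm in question being an essential
  bound.\<close>

lemma Holder_unit:
  fixes u :: "'a::euclidean_space \<Rightarrow> real"
  assumes [measurable]: "u \<in> borel_measurable borel" and th: "0 \<le> \<theta>" "\<theta> \<le> 1"
    and u: "Lp_le \<theta> u 1" and g: "g \<in> dual_ball \<theta>"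
  shows "(\<integral>\<^sup>+x. ennreal (\<bar>u x\<bar> * g x) \<partial>lborel) \<le> 1"
proof -
  note [measurable] = dual_ballD(1)[OF g]
  consider "\<theta> = 0" | "\<theta> = 1" | "0 < \<theta>" "\<theta> < 1" using th by linarith
  then show ?thesis
  proof cases
    case 1
    have "AE x in lborel. \<bar>u x\<bar> \<le> 1" using u 1 by (simp add: Lp_le_def)
    then have "(\<integral>\<^sup>+x. ennreal (\<bar>u x\<bar> * g x) \<partial>lborel) \<le> (\<integral>\<^sup>+x. ennreal \<bar>g x\<bar> \<partial>lborel)"
      by (intro nn_integral_mono_AE)
         (auto elim!: eventually_mono intro!: ennreal_leI simp: dual_ballD(2)[OF g] mult_left_le_one_le)
    also have "\<dots> \<le> 1" using dual_ballD(3)[OF g] 1 by (simp add: Lp_le_1_iff)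
    finally show ?thesis .
  next
    case 2
    have "AE x in lborel. \<bar>g x\<bar> \<le> 1" using dual_ballD(3)[OF g] 2 by (simp add: Lp_le_def)
    then have "(\<integral>\<^sup>+x. ennreal (\<bar>u x\<bar> * g x) \<partial>lborel) \<le> (\<integral>\<^sup>+x. ennreal \<bar>u x\<bar> \<partial>lborel)"
      by (intro nn_integral_mono_AE)
         (auto elim!: eventually_mono intro!: ennreal_leI simp: dual_ballD(2)[OF g] mult_left_le)
    also have "\<dots> \<le> 1" using u 2 by (simp add: Lp_le_1_iff)
    finally show ?thesis .
  next
    case 3
    have pt: "\<bar>u x\<bar> * g x \<le> \<theta> * \<bar>u x\<bar> powr (1 / \<theta>) + (1 - \<theta>) * \<bar>g x\<bar> powr (1 / (1 - \<theta>))" for x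
      using weighted_am_gm3[of "\<bar>u x\<bar> powr (1 / \<theta>)" "\<bar>g x\<bar> powr (1 / (1 - \<theta>))" 1 \<theta> "1 - \<theta>" 0] 3
        dual_ballD(2)[OF g, of x]
      by (simp add: powr_powr)
    have "(\<integral>\<^sup>+x. ennreal (\<bar>u x\<bar> * g x) \<partial>lborel)
        \<le> (\<integral>\<^sup>+x. ennreal \<theta> * ennreal (\<bar>u x\<bar> powr (1 / \<theta>)) + ennreal (1 - \<theta>) * ennreal (\<bar>g x\<bar> powr (1 / (1 - \<theta>))) \<partial>lborel)"
      using 3 pt by (intro nn_integral_mono) (simp add: ennreal_mult[symmetric] ennreal_plus[symmetric] del: ennreal_plus)
    also have "\<dots> = ennreal \<theta> * (\<integral>\<^sup>+x. ennreal (\<bar>u x\<bar> powr (1 / \<theta>)) \<partial>lborel)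
        + ennreal (1 - \<theta>) * (\<integral>\<^sup>+x. ennreal (\<bar>g x\<bar> powr (1 / (1 - \<theta>))) \<partial>lborel)"
      by (simp add: nn_integral_add nn_integral_cmult)
    also have "\<dots> \<le> ennreal \<theta> * 1 + ennreal (1 - \<theta>) * 1"
      using Lp_le_one_nn_integral[OF u] Lp_le_one_nn_integral[OF dual_ballD(3)[OF g]] 3
      by (intro add_mono mult_left_mono) auto
    also have "\<dots> = 1" using 3 by (simp add: ennreal_plus[symmetric] del: ennreal_plus)
    finally show ?thesis .
  qed
qed

lemma Holder:
  fixes u :: "'a::euclidean_space \<Rightarrow> real"
  assumes [measurable]: "u \<in> borel_measurable borel" and th: "0 \<le> \<theta>" "\<theta> \<le> 1" and A: "0 \<le> A"
    and u: "Lp_le \<theta> u A" and g: "g \<in> dual_ball \<theta>"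
  shows "(\<integral>\<^sup>+x. ennreal (\<bar>u x\<bar> * g x) \<partial>lborel) \<le> ennreal A"
proof (rule ennreal_le_epsilon)
  fix e :: real assume e: "0 < e"
  note [measurable] = dual_ballD(1)[OF g]
  \<comment> \<open>\<open>A\<close> may be zero, so the normalization divides by
    \<open>A + e\<close>; letting \<open>e\<close> tend to zero recovers \<open>A\<close>.\<close>
  define B where "B = A + e"
  have B: "B > 0" using A e by (simp add: B_def)
  have uB: "Lp_le \<theta> u B" using Lp_le_mono[OF u, of B u] A th e by (simp add: B_def)
  have "Lp_le \<theta> (\<lambda>x. (1 / B) * u x) (1 / B * B)"
    using B th uB by (subst Lp_le_cmult) auto
  then have "(\<integral>\<^sup>+x. ennreal (\<bar>(1 / B) * u x\<bar> * g x) \<partial>lborel) \<le> 1"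
    using B by (intro Holder_unit[OF _ th _ g]) auto
  then have "ennreal B * (\<integral>\<^sup>+x. ennreal (\<bar>(1 / B) * u x\<bar> * g x) \<partial>lborel) \<le> ennreal B * 1"
    by (rule mult_left_mono) simp
  also have "ennreal B * (\<integral>\<^sup>+x. ennreal (\<bar>(1 / B) * u x\<bar> * g x) \<partial>lborel) = (\<integral>\<^sup>+x. ennreal (\<bar>u x\<bar> * g x) \<partial>lborel)"
    using B by (subst nn_integral_cmult[symmetric])
       (auto simp: ennreal_mult'[symmetric] abs_mult intro!: nn_integral_cong)
  finally show "(\<integral>\<^sup>+x. ennreal (\<bar>u x\<bar> * g x) \<partial>lborel) \<le> ennreal A + ennreal e"
    using A e by (simp add: B_def)
qed

lemma dual_ball_1: "(\<lambda>_. 1) \<in> dual_ball 1"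
  by (simp add: dual_ball_def Lp_le_def)

text \<open>If \<open>|u|\<close> were at least \<open>A + 1/(k+1)\<close> on a set of positive
  measure, the normalized indicator of this set would violate the bound. Cutting with balls keeps
  the measure finite, so that the indicator can be normalized in \<open>L^1\<close>, the dual side
  of \<open>\<theta> = 0\<close>.\<close>

lemma Lp_le_dualI_top:
  fixes u :: "'a::euclidean_space \<Rightarrow> real"
  assumes [measurable]: "u \<in> borel_measurable borel" and A: "0 \<le> A"
    and dual: "\<And>g. g \<in> dual_ball 0 \<Longrightarrow> (\<integral>\<^sup>+x. ennreal (\<bar>u x\<bar> * g x) \<partial>lborel) \<le> ennreal A"
  shows "Lp_le 0 u A"
proof -
  define E where "E k = {x \<in> cball 0 (real k). A + 1 / real (Suc k) \<le> \<bar>u x\<bar>}" for k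
  have [measurable]: "E k \<in> sets borel" for k by (simp add: E_def)
  have null: "E k \<in> null_sets lborel" for k
  proof (rule ccontr)
    assume "E k \<notin> null_sets lborel"
    then have pos: "emeasure lborel (E k) \<noteq> 0" by (simp add: null_sets_def)
    have fin: "emeasure lborel (E k) < \<infinity>"
      using emeasure_mono[of "E k" "cball 0 (real k)" lborel] emeasure_lborel_cball_finite[of "0::'a" "real k"]
      by (metis (no_types, lifting) E_def Collect_subset Int_iff Int_def borel_closed closed_cball infinity_ennreal_def mem_Collect_eq order_le_less_trans sets_lborel subsetI)
    define r where "r = measure lborel (E k)"
    have r: "emeasure lborel (E k) = ennreal r" "r > 0"
      using fin pos by (auto simp: r_def emeasure_eq_ennreal_measure zero_less_measure_iff)
    define g where "g x = indicator (E k) x / r" for x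
    have g: "g \<in> dual_ball 0"
      using r by (auto simp: dual_ball_def Lp_le_def g_def[abs_def] ennreal_indicator divide_ennreal[symmetric]
          nn_integral_divide ennreal_divide_self nn_integral_divide)
    have "ennreal (A + 1 / real (Suc k)) = (\<integral>\<^sup>+x. ennreal ((A + 1 / real (Suc k)) / r) * indicator (E k) x \<partial>lborel)"
      using r A by (simp add: nn_integral_cmult_indicator ennreal_mult[symmetric])
    also have "\<dots> \<le> (\<integral>\<^sup>+x. ennreal (\<bar>u x\<bar> * g x) \<partial>lborel)"
      using r by (intro nn_integral_mono) (auto simp: g_def E_def indicator_def intro!: ennreal_leI divide_right_mono)
    also have "\<dots> \<le> ennreal A" by (rule dual[OF g])
    finally have "A + 1 / real (Suc k) \<le> A" using A by (subst (asm) ennreal_le_iff) auto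
    then show False by simp
  qed
  have "AE x in lborel. \<forall>k. x \<notin> E k"
    unfolding AE_all_countable using null by (auto intro: AE_not_in)
  then show ?thesis
    unfolding Lp_le_def if_P[OF refl]
  proof eventually_elim
    fix x assume x: "\<forall>k. x \<notin> E k"
    show "\<bar>u x\<bar> \<le> A"
    proof (rule ccontr)
      assume "\<not> \<bar>u x\<bar> \<le> A"
      then obtain i where i: "1 / real (Suc i) < \<bar>u x\<bar> - A"
        using nat_approx_posE[of "\<bar>u x\<bar> - A"] by force
      obtain j where j: "norm x \<le> real j" using real_arch_simple by blast
      have "1 / real (Suc (max i j)) \<le> 1 / real (Suc i)" by (simp add: frac_le)
      with i j have "x \<in> E (max i j)" by (auto simp: E_def)
      then show False using x by blast
    qed
  qed
qed

text \<open>Converse of Holder's inequality. Finiteness of the norm is part of the conclusion, so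
  the bound is proved for truncations and passed on by monotone convergence.\<close>

lemma Lp_le_dualI:
  fixes u :: "'a::euclidean_space \<Rightarrow> real"
  assumes [measurable]: "u \<in> borel_measurable borel" and A: "0 \<le> A" and th: "0 \<le> \<theta>" "\<theta> \<le> 1"
    and dual: "\<And>g. g \<in> dual_ball \<theta> \<Longrightarrow> (\<integral>\<^sup>+x. ennreal (\<bar>u x\<bar> * g x) \<partial>lborel) \<le> ennreal A"
  shows "Lp_le \<theta> u A"
proof -
  consider "\<theta> = 0" | "\<theta> = 1" | "0 < \<theta>" "\<theta> < 1" using th by linarith
  then show ?thesis
  proof cases
    case 1
    then show ?thesis using Lp_le_dualI_top[of u A] dual A by simp
  next
    case 2
    then show ?thesis using dual[of "\<lambda>_. 1"] A dual_ball_1 by (simp add: Lp_le_1_iff)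
  next
    case 3
    define q where "q = 1 / \<theta>"
    have q: "q > 1" using 3 by (simp add: q_def)
    \<comment> \<open>Bounded with bounded support, so the integral \<open>N\<close> of its
      \<open>q\<close>-th power is finite and may be divided by.\<close>
    define v where "v k x = min \<bar>u x\<bar> (real k) * indicator (ball 0 (real k)) x" for k x
    have [measurable]: "ball (0::'a) (real k) \<in> sets borel" for k by simp
    have [measurable]: "v k \<in> borel_measurable borel" for k by (simp add: v_def[abs_def])
    have v0: "0 \<le> v k x" and vu: "v k x \<le> \<bar>u x\<bar>" for k x by (auto simp: v_def indicator_def)
    have bound: "(\<integral>\<^sup>+x. ennreal (v k x powr q) \<partial>lborel) \<le> ennreal (A powr q)" for k
    proof -
      have "(\<integral>\<^sup>+x. ennreal (v k x powr q) \<partial>lborel)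
          \<le> (\<integral>\<^sup>+x. ennreal (real k powr q) * indicator (ball (0::'a) (real k)) x \<partial>lborel)"
        using q by (intro nn_integral_mono) (auto simp: v_def indicator_def intro!: ennreal_leI powr_mono2)
      also have "\<dots> < \<infinity>"
        using emeasure_lborel_ball_finite[of "0::'a" "real k"]
        by (simp add: nn_integral_cmult_indicator ennreal_mult_less_top less_top)
      finally obtain N where N: "(\<integral>\<^sup>+x. ennreal (v k x powr q) \<partial>lborel) = ennreal N" "0 \<le> N"
        by (metis ennreal_cases less_irrefl infinity_ennreal_def)
      show ?thesis
      proof (cases "N = 0")
        case True
        then show ?thesis using N by simp
      next
        case False
        with N have Np: "N > 0" by simp
        \<comment> \<open>The extremal function for \<open>v k\<close>: its conjugate norm is one,
          and its pairing with \<open>v k\<close> is \<open>N / N powr (1 - \<theta>)\<close>, that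
          is, the norm \<open>N powr \<theta>\<close>.\<close>
        define g where "g x = v k x powr (q - 1) / N powr (1 - \<theta>)" for x
        have e: "(q - 1) / (1 - \<theta>) = q" using 3 by (simp add: q_def field_simps)
        have "(\<integral>\<^sup>+x. ennreal (\<bar>g x\<bar> powr (1 / (1 - \<theta>))) \<partial>lborel)
            = (\<integral>\<^sup>+x. ennreal (v k x powr q) / ennreal N \<partial>lborel)"
          using Np 3 e by (intro nn_integral_cong)
            (simp add: g_def powr_divide powr_powr divide_ennreal)
        also have "\<dots> = 1" using N Np by (simp add: nn_integral_divide)
        finally have g: "g \<in> dual_ball \<theta>" using 3 by (auto simp: dual_ball_def Lp_le_def g_def[abs_def])
        have "ennreal (N powr \<theta>) = ennreal N / ennreal (N powr (1 - \<theta>))"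
          using Np by (simp add: divide_ennreal powr_diff)
        also have "\<dots> = (\<integral>\<^sup>+x. ennreal (v k x powr q) / ennreal (N powr (1 - \<theta>)) \<partial>lborel)"
          using N by (simp add: nn_integral_divide)
        also have "\<dots> \<le> (\<integral>\<^sup>+x. ennreal (\<bar>u x\<bar> * g x) \<partial>lborel)"
        proof (intro nn_integral_mono)
          fix x
          have "v k x powr q = v k x * v k x powr (q - 1)"
            using v0[of k x] by (cases "v k x = 0") (auto simp: powr_diff)
          also have "\<dots> \<le> \<bar>u x\<bar> * v k x powr (q - 1)" using vu[of k x] by (intro mult_right_mono) auto
          finally have "v k x powr q / N powr (1 - \<theta>) \<le> \<bar>u x\<bar> * g x"
            using Np by (simp add: g_def divide_right_mono)
          then show "ennreal (v k x powr q) / ennreal (N powr (1 - \<theta>)) \<le> ennreal (\<bar>u x\<bar> * g x)"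
            using Np by (simp add: divide_ennreal ennreal_leI)
        qed
        also have "\<dots> \<le> ennreal A" by (rule dual[OF g])
        finally have "N powr \<theta> \<le> A" using A by simp
        then have "(N powr \<theta>) powr q \<le> A powr q" using q by (intro powr_mono2) auto
        then have "N \<le> A powr q" using Np 3 by (simp add: powr_powr q_def)
        then show ?thesis using N by (simp add: ennreal_leI)
      qed
    qed
    have "(\<integral>\<^sup>+x. ennreal (\<bar>u x\<bar> powr q) \<partial>lborel) = (\<integral>\<^sup>+x. (SUP k. ennreal (v k x powr q)) \<partial>lborel)"
    proof (intro nn_integral_cong antisym)
      fix x
      obtain k where k: "max (norm x) \<bar>u x\<bar> < real k" using reals_Archimedean2 by blast
      then have "v k x = \<bar>u x\<bar>" by (auto simp: v_def indicator_def)
      then show "ennreal (\<bar>u x\<bar> powr q) \<le> (SUP k. ennreal (v k x powr q))" by (metis SUP_upper UNIV_I)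
      show "(SUP k. ennreal (v k x powr q)) \<le> ennreal (\<bar>u x\<bar> powr q)"
        using q v0 vu by (intro SUP_least ennreal_leI powr_mono2) auto
    qed
    also have "\<dots> = (SUP k. (\<integral>\<^sup>+x. ennreal (v k x powr q) \<partial>lborel))"
    proof (intro nn_integral_monotone_convergence_SUP)
      show "incseq (\<lambda>k x. ennreal (v k x powr q))"
        using q by (intro incseq_SucI le_funI ennreal_leI powr_mono2) (auto simp: v_def indicator_def)
    qed auto
    also have "\<dots> \<le> ennreal (A powr q)" using bound by (intro SUP_least) auto
    finally show ?thesis using 3 by (simp add: Lp_le_def q_def)
  qed
qed

text \<open>Minkowski's inequality by duality: the pairing with a fixed \<open>g\<close> is
  subadditive.\<close>

lemma Lp_le_triangle:
  fixes u v :: "'a::euclidean_space \<Rightarrow> real"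
  assumes [measurable]: "u \<in> borel_measurable borel" "v \<in> borel_measurable borel"
    and A: "0 \<le> A" "0 \<le> B" and th: "0 \<le> \<theta>" "\<theta> \<le> 1"
    and u: "Lp_le \<theta> u A" and v: "Lp_le \<theta> v B"
  shows "Lp_le \<theta> (\<lambda>x. u x + v x) (A + B)"
proof (rule Lp_le_dualI)
  fix g :: "'a \<Rightarrow> real" assume g: "g \<in> dual_ball \<theta>"
  note [measurable] = dual_ballD(1)[OF g]
  have "(\<integral>\<^sup>+x. ennreal (\<bar>u x + v x\<bar> * g x) \<partial>lborel)
      \<le> (\<integral>\<^sup>+x. ennreal (\<bar>u x\<bar> * g x) + ennreal (\<bar>v x\<bar> * g x) \<partial>lborel)"
    using dual_ballD(2)[OF g] by (intro nn_integral_mono)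
      (simp add: ennreal_plus[symmetric] distrib_right[symmetric] mult_right_mono ennreal_leI abs_triangle_ineq del: ennreal_plus)
  also have "\<dots> = (\<integral>\<^sup>+x. ennreal (\<bar>u x\<bar> * g x) \<partial>lborel) + (\<integral>\<^sup>+x. ennreal (\<bar>v x\<bar> * g x) \<partial>lborel)"
    by (rule nn_integral_add) auto
  also have "\<dots> \<le> ennreal A + ennreal B"
    using Holder[OF assms(1) th A(1) u g] Holder[OF assms(2) th A(2) v g] by (rule add_mono)
  finally show "(\<integral>\<^sup>+x. ennreal (\<bar>u x + v x\<bar> * g x) \<partial>lborel) \<le> ennreal (A + B)" using A by simp
qed (use A th in auto)

section \<open>Norms under translations and dilations\<close>

lemma nn_integral_lborel_affine:
  fixes F :: "'a::euclidean_space \<Rightarrow> ennreal"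
  assumes [measurable]: "F \<in> borel_measurable borel" and c: "c \<noteq> 0"
  shows "(\<integral>\<^sup>+x. F x \<partial>lborel) = ennreal (\<bar>c\<bar> ^ DIM('a)) * (\<integral>\<^sup>+x. F (t + c *\<^sub>R x) \<partial>lborel)"
  by (subst lborel_affine[OF c, of t])
     (simp add: nn_integral_density nn_integral_distr nn_integral_cmult)

lemma AE_lborel_affine:
  fixes t :: "'a::euclidean_space"
  assumes c: "c \<noteq> 0" and [measurable]: "{x. P x} \<in> sets borel" and P: "AE x in lborel. P x"
  shows "AE x in lborel. P (t + c *\<^sub>R x)"
proof -
  have "AE x in density (distr lborel borel (\<lambda>x. t + c *\<^sub>R x)) (\<lambda>_. ennreal (\<bar>c\<bar> ^ DIM('a))). P x"
    using P by (simp only: lborel_affine[OF c, of t, symmetric])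
  then have "AE x in distr lborel borel (\<lambda>x. t + c *\<^sub>R x). P x"
    using c by (simp add: AE_density)
  then show ?thesis by (subst (asm) AE_distr_iff) auto
qed

text \<open>The Jacobian \<open>c^n\<close> enters the \<open>1/\<theta>\<close>-th power of the
  norm, hence the norm itself with exponent \<open>- n \<theta>\<close>. All rates in
  \<open>t\<close> originate here.\<close>

lemma Lp_le_affine:
  fixes u :: "'a::euclidean_space \<Rightarrow> real"
  assumes [measurable]: "u \<in> borel_measurable borel" and c: "c > 0" and th: "0 \<le> \<theta>" and A: "0 \<le> A"
    and u: "Lp_le \<theta> u A"
  shows "Lp_le \<theta> (\<lambda>x. u (t + c *\<^sub>R x)) (A * c powr (- (real DIM('a) * \<theta>)))"
proof (cases "\<theta> = 0")
  case True
  with u have "AE x in lborel. \<bar>u x\<bar> \<le> A" by (simp add: Lp_le_def)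
  then have "AE x in lborel. \<bar>u (t + c *\<^sub>R x)\<bar> \<le> A" using c by (intro AE_lborel_affine) auto
  then show ?thesis using True c by (simp add: Lp_le_def)
next
  case False
  let ?I = "\<integral>\<^sup>+x. ennreal (\<bar>u (t + c *\<^sub>R x)\<bar> powr (1 / \<theta>)) \<partial>lborel"
  have "ennreal (c ^ DIM('a)) * ?I \<le> ennreal (A powr (1 / \<theta>))"
    using u False c nn_integral_lborel_affine[of "\<lambda>x. ennreal (\<bar>u x\<bar> powr (1 / \<theta>))" c t]
    by (simp add: Lp_le_def)
  then have "ennreal (inverse (c ^ DIM('a))) * (ennreal (c ^ DIM('a)) * ?I)
      \<le> ennreal (inverse (c ^ DIM('a))) * ennreal (A powr (1 / \<theta>))"
    by (rule mult_left_mono) simp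
  then have "?I \<le> ennreal (inverse (c ^ DIM('a)) * A powr (1 / \<theta>))"
    using c by (simp add: mult.assoc[symmetric] ennreal_mult[symmetric])
  also have "inverse (c ^ DIM('a)) = (c powr (- (real DIM('a) * \<theta>))) powr (1 / \<theta>)"
    using c False by (simp add: powr_powr powr_minus[symmetric] powr_realpow[symmetric])
  then have "inverse (c ^ DIM('a)) * A powr (1 / \<theta>) = (A * c powr (- (real DIM('a) * \<theta>))) powr (1 / \<theta>)"
    using A by (simp add: powr_mult)
  finally show ?thesis using False by (simp add: Lp_le_def)
qed

lemma nn_integral_lborel_translate:
  fixes F :: "'a::euclidean_space \<Rightarrow> ennreal"
  assumes [measurable]: "F \<in> borel_measurable borel"
  shows "(\<integral>\<^sup>+x. F (x - y) \<partial>lborel) = (\<integral>\<^sup>+x. F x \<partial>lborel)"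
  using nn_integral_lborel_affine[of F 1 "- y"] by (simp add: add.commute)

lemma nn_integral_lborel_reflect:
  fixes F :: "'a::euclidean_space \<Rightarrow> ennreal"
  assumes [measurable]: "F \<in> borel_measurable borel"
  shows "(\<integral>\<^sup>+y. F (x - y) \<partial>lborel) = (\<integral>\<^sup>+y. F y \<partial>lborel)"
  using nn_integral_lborel_affine[of F "- 1" x] by simp

lemma Lp_le_translate:
  fixes u :: "'a::euclidean_space \<Rightarrow> real"
  assumes "u \<in> borel_measurable borel" "0 \<le> \<theta>" "0 \<le> A" "Lp_le \<theta> u A"
  shows "Lp_le \<theta> (\<lambda>x. u (x - y)) A"
  using Lp_le_affine[OF assms(1) _ assms(2-4), of 1 "- y"] by (simp add: add.commute)

section \<open>Young's convolution inequality\<close>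

text \<open>With \<open>X\<close>, \<open>Y\<close>, \<open>Z\<close> the powers of
  \<open>|m|\<close>, \<open>|f|\<close>, \<open>g\<close> whose integrals are at most one, the
  integrand is \<open>X^\<mu> Y^\<beta> Z^(1-\<theta>)\<close>. It factors as
  \<open>(XY)^\<theta> (XZ)^(1-\<beta>) (YZ)^(1-\<mu>)\<close>, with exponents summing to one, so
  the mean inequality leaves a convex combination of three double integrals. Each of them splits
  into a product because only two of the factors occur.\<close>

lemma Young_unit:
  fixes m f g :: "'a::euclidean_space \<Rightarrow> real"
  assumes [measurable]: "m \<in> borel_measurable borel" "f \<in> borel_measurable borel"
    and e: "0 < \<beta>" "\<beta> < 1" "0 < \<mu>" "\<mu> < 1" "0 \<le> \<theta>" "1 + \<theta> = \<mu> + \<beta>"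
    and m: "Lp_le \<mu> m 1" and f: "Lp_le \<beta> f 1" and g: "g \<in> dual_ball \<theta>"
  shows "(\<integral>\<^sup>+x. \<integral>\<^sup>+y. ennreal (\<bar>m (x - y)\<bar> * \<bar>f y\<bar> * g x) \<partial>lborel \<partial>lborel) \<le> 1"
proof -
  note [measurable] = dual_ballD(1)[OF g]
  define X Y Z where "X x = \<bar>m x\<bar> powr (1 / \<mu>)" and "Y x = \<bar>f x\<bar> powr (1 / \<beta>)"
    and "Z x = \<bar>g x\<bar> powr (1 / (1 - \<theta>))" for x
  have [measurable]: "X \<in> borel_measurable borel" "Y \<in> borel_measurable borel" "Z \<in> borel_measurable borel"
    by (simp_all add: X_def[abs_def] Y_def[abs_def] Z_def[abs_def])
  have nn: "0 \<le> X x" "0 \<le> Y x" "0 \<le> Z x" for x by (simp_all add: X_def Y_def Z_def)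
  have th: "\<theta> < 1" using e by linarith
  have IX: "(\<integral>\<^sup>+x. ennreal (X x) \<partial>lborel) \<le> 1" and IY: "(\<integral>\<^sup>+x. ennreal (Y x) \<partial>lborel) \<le> 1"
    and IZ: "(\<integral>\<^sup>+x. ennreal (Z x) \<partial>lborel) \<le> 1"
    using Lp_le_one_nn_integral[OF m] Lp_le_one_nn_integral[OF f] Lp_le_one_nn_integral[OF dual_ballD(3)[OF g]] e th
    by (simp_all add: X_def Y_def Z_def)
  have pt: "\<bar>m (x - y)\<bar> * \<bar>f y\<bar> * g x
      \<le> \<theta> * (X (x - y) * Y y) + (1 - \<beta>) * (X (x - y) * Z x) + (1 - \<mu>) * (Y y * Z x)" for x y
  proof -
    let ?X = "X (x - y)" and ?Y = "Y y" and ?Z = "Z x"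
    have "\<bar>m (x - y)\<bar> * \<bar>f y\<bar> * g x = ?X powr \<mu> * ?Y powr \<beta> * ?Z powr (1 - \<theta>)"
      using e th dual_ballD(2)[OF g, of x] by (simp add: X_def Y_def Z_def powr_powr)
    also have "\<dots> = ?X powr (\<theta> + (1 - \<beta>)) * ?Y powr (\<theta> + (1 - \<mu>)) * ?Z powr ((1 - \<beta>) + (1 - \<mu>))"
    proof -
      have "\<theta> + (1 - \<beta>) = \<mu>" "\<theta> + (1 - \<mu>) = \<beta>" "(1 - \<beta>) + (1 - \<mu>) = 1 - \<theta>" using e(6) by linarith+
      then show ?thesis by presburger
    qed
    also have "\<dots> = (?X * ?Y) powr \<theta> * (?X * ?Z) powr (1 - \<beta>) * (?Y * ?Z) powr (1 - \<mu>)"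
      unfolding powr_add using nn by (simp add: powr_mult)
    also have "\<dots> \<le> \<theta> * (?X * ?Y) + (1 - \<beta>) * (?X * ?Z) + (1 - \<mu>) * (?Y * ?Z)"
      using nn e by (intro weighted_am_gm3) auto
    finally show ?thesis .
  qed
  have "(\<integral>\<^sup>+x. \<integral>\<^sup>+y. ennreal (\<bar>m (x - y)\<bar> * \<bar>f y\<bar> * g x) \<partial>lborel \<partial>lborel)
      \<le> (\<integral>\<^sup>+x. \<integral>\<^sup>+y. ennreal \<theta> * (ennreal (X (x - y)) * ennreal (Y y))
          + ennreal (1 - \<beta>) * (ennreal (X (x - y)) * ennreal (Z x))
          + ennreal (1 - \<mu>) * (ennreal (Y y) * ennreal (Z x)) \<partial>lborel \<partial>lborel)"
    using e nn pt by (intro nn_integral_mono)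
      (simp add: ennreal_mult[symmetric] ennreal_plus[symmetric] del: ennreal_plus)
  also have "\<dots> = (\<integral>\<^sup>+x. ennreal \<theta> * (\<integral>\<^sup>+y. ennreal (X (x - y)) * ennreal (Y y) \<partial>lborel)
          + ennreal (1 - \<beta>) * ((\<integral>\<^sup>+y. ennreal (X (x - y)) \<partial>lborel) * ennreal (Z x))
          + ennreal (1 - \<mu>) * ((\<integral>\<^sup>+y. ennreal (Y y) \<partial>lborel) * ennreal (Z x)) \<partial>lborel)"
    by (simp add: nn_integral_add nn_integral_cmult nn_integral_multc)
  also have "\<dots> = ennreal \<theta> * (\<integral>\<^sup>+x. \<integral>\<^sup>+y. ennreal (X (x - y)) * ennreal (Y y) \<partial>lborel \<partial>lborel)
          + ennreal (1 - \<beta>) * ((\<integral>\<^sup>+y. ennreal (X y) \<partial>lborel) * (\<integral>\<^sup>+x. ennreal (Z x) \<partial>lborel))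
          + ennreal (1 - \<mu>) * ((\<integral>\<^sup>+y. ennreal (Y y) \<partial>lborel) * (\<integral>\<^sup>+x. ennreal (Z x) \<partial>lborel))"
    by (simp add: nn_integral_lborel_reflect[of "\<lambda>y. ennreal (X y)"] nn_integral_add nn_integral_cmult)
  \<comment> \<open>In the other two terms the inner integral over \<open>y\<close> does not depend
    on \<open>x\<close>; this one splits only after the order is exchanged.\<close>
  also have "(\<integral>\<^sup>+x. \<integral>\<^sup>+y. ennreal (X (x - y)) * ennreal (Y y) \<partial>lborel \<partial>lborel)
      = (\<integral>\<^sup>+y. \<integral>\<^sup>+x. ennreal (X (x - y)) * ennreal (Y y) \<partial>lborel \<partial>lborel)"
    by (rule lborel_pair.Fubini') simp
  also have "\<dots> = (\<integral>\<^sup>+x. ennreal (X x) \<partial>lborel) * (\<integral>\<^sup>+y. ennreal (Y y) \<partial>lborel)"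
    by (simp add: nn_integral_multc nn_integral_cmult nn_integral_lborel_translate[of "\<lambda>y. ennreal (X y)"])
  also have "ennreal \<theta> * ((\<integral>\<^sup>+x. ennreal (X x) \<partial>lborel) * (\<integral>\<^sup>+y. ennreal (Y y) \<partial>lborel))
          + ennreal (1 - \<beta>) * ((\<integral>\<^sup>+y. ennreal (X y) \<partial>lborel) * (\<integral>\<^sup>+x. ennreal (Z x) \<partial>lborel))
          + ennreal (1 - \<mu>) * ((\<integral>\<^sup>+y. ennreal (Y y) \<partial>lborel) * (\<integral>\<^sup>+x. ennreal (Z x) \<partial>lborel))
     \<le> ennreal \<theta> * (1 * 1) + ennreal (1 - \<beta>) * (1 * 1) + ennreal (1 - \<mu>) * (1 * 1)"
    using IX IY IZ by (intro add_mono mult_mono) auto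
  also have "\<dots> = ennreal 1" using e by (simp add: ennreal_plus[symmetric] del: ennreal_plus ennreal_1)
  finally show ?thesis by simp
qed

text \<open>Young's inequality in reciprocal exponents, without the case \<open>\<mu> = 1\<close>, \<open>\<beta> = \<theta> < 1\<close>, in which the
  kernel would have to be integrable.\<close>
definition Young_exponents :: "real \<Rightarrow> real \<Rightarrow> real \<Rightarrow> bool" where
  "Young_exponents \<mu> \<beta> \<theta> \<longleftrightarrow> 0 \<le> \<theta> \<and> \<theta> \<le> 1 \<and> 1 + \<theta> = \<mu> + \<beta> \<and>
     (\<beta> = 1 \<or> 0 < \<beta> \<and> \<beta> < 1 \<and> 0 < \<mu> \<and> \<mu> < 1)"

text \<open>For \<open>\<beta> = 1\<close> the kernel is paired with \<open>g\<close> at each fixed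
  \<open>y\<close> and \<open>f\<close> enters only through its \<open>L^1\<close> norm, so
  \<open>\<theta>\<close> may be 0 or 1. The other case is the normalized one, rescaled.\<close>

lemma Young:
  fixes m f g :: "'a::euclidean_space \<Rightarrow> real"
  assumes [measurable]: "m \<in> borel_measurable borel" "f \<in> borel_measurable borel"
    and e: "Young_exponents \<mu> \<beta> \<theta>" and A: "A > 0" and B: "B > 0"
    and m: "Lp_le \<mu> m A" and f: "Lp_le \<beta> f B" and g: "g \<in> dual_ball \<theta>"
  shows "(\<integral>\<^sup>+x. \<integral>\<^sup>+y. ennreal (\<bar>m (x - y)\<bar> * \<bar>f y\<bar> * g x) \<partial>lborel \<partial>lborel) \<le> ennreal (A * B)"
proof -
  note [measurable] = dual_ballD(1)[OF g]
  note g0 = dual_ballD(2)[OF g]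
  consider "\<beta> = 1" "\<mu> = \<theta>" "0 \<le> \<theta>" "\<theta> \<le> 1" | "0 < \<beta>" "\<beta> < 1" "0 < \<mu>" "\<mu> < 1" "0 \<le> \<theta>" "1 + \<theta> = \<mu> + \<beta>"
    using e by (auto simp: Young_exponents_def)
  then show ?thesis
  proof cases
    case 1
    have "(\<integral>\<^sup>+x. \<integral>\<^sup>+y. ennreal (\<bar>m (x - y)\<bar> * \<bar>f y\<bar> * g x) \<partial>lborel \<partial>lborel)
        = (\<integral>\<^sup>+y. \<integral>\<^sup>+x. ennreal (\<bar>m (x - y)\<bar> * \<bar>f y\<bar> * g x) \<partial>lborel \<partial>lborel)"
      by (rule lborel_pair.Fubini') simp
    also have "\<dots> = (\<integral>\<^sup>+y. ennreal \<bar>f y\<bar> * (\<integral>\<^sup>+x. ennreal (\<bar>m (x - y)\<bar> * g x) \<partial>lborel) \<partial>lborel)"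
      using g0 by (intro nn_integral_cong, subst nn_integral_cmult[symmetric])
        (auto simp: ennreal_mult[symmetric] mult_ac)
    also have "\<dots> \<le> (\<integral>\<^sup>+y. ennreal \<bar>f y\<bar> * ennreal A \<partial>lborel)"
      using 1 A m g Lp_le_translate[of m \<theta> A]
      by (intro nn_integral_mono mult_left_mono Holder[where \<theta>=\<theta>]) auto
    also have "\<dots> = (\<integral>\<^sup>+y. ennreal \<bar>f y\<bar> \<partial>lborel) * ennreal A" by (rule nn_integral_multc) simp
    also have "\<dots> \<le> ennreal B * ennreal A" using f 1 B by (intro mult_right_mono) (auto simp: Lp_le_1_iff)
    also have "\<dots> = ennreal (A * B)" using A B by (simp add: ennreal_mult[symmetric] mult.commute)
    finally show ?thesis .
  next
    case 2
    have mA: "Lp_le \<mu> (\<lambda>x. (1 / A) * m x) (1 / A * A)" using A m 2 by (subst Lp_le_cmult) auto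
    have fB: "Lp_le \<beta> (\<lambda>x. (1 / B) * f x) (1 / B * B)" using B f 2 by (subst Lp_le_cmult) auto
    have *: "(\<integral>\<^sup>+x. \<integral>\<^sup>+y. ennreal (\<bar>(1 / A) * m (x - y)\<bar> * \<bar>(1 / B) * f y\<bar> * g x) \<partial>lborel \<partial>lborel) \<le> 1"
      using mA fB A B by (intro Young_unit[OF _ _ 2 _ _ g]) auto
    have "(\<integral>\<^sup>+x. \<integral>\<^sup>+y. ennreal (\<bar>m (x - y)\<bar> * \<bar>f y\<bar> * g x) \<partial>lborel \<partial>lborel)
        = (\<integral>\<^sup>+x. \<integral>\<^sup>+y. ennreal (A * B) * ennreal (\<bar>(1 / A) * m (x - y)\<bar> * \<bar>(1 / B) * f y\<bar> * g x) \<partial>lborel \<partial>lborel)"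
      using A B g0 by (intro nn_integral_cong) (auto simp: ennreal_mult'[symmetric] abs_mult)
    also have "\<dots> = ennreal (A * B) *
        (\<integral>\<^sup>+x. \<integral>\<^sup>+y. ennreal (\<bar>(1 / A) * m (x - y)\<bar> * \<bar>(1 / B) * f y\<bar> * g x) \<partial>lborel \<partial>lborel)"
      by (simp add: nn_integral_cmult)
    also have "\<dots> \<le> ennreal (A * B) * 1" using * by (rule mult_left_mono) simp
    finally show ?thesis by simp
  qed
qed

section \<open>Self-similar kernels\<close>

text \<open>Dyadic decomposition: where \<open>2^k \<le> norm x < 2^(k+1)\<close> the integrand is
  at most \<open>C^q 2^(-nqk)\<close>, and the ball of radius \<open>2^(k+1)\<close> has volume of
  order \<open>2^(nk)\<close>. The geometric ratio \<open>2^(n-nq)\<close> is below one because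
  \<open>q > 1\<close>. Whole balls in place of annuli change only the constant.\<close>

lemma nn_integral_powr_decay_finite:
  fixes u :: "'a::euclidean_space \<Rightarrow> real"
  assumes [measurable]: "u \<in> borel_measurable borel" and q: "q > 1"
    and K: "\<And>x. \<bar>u x\<bar> \<le> K"
    and C: "\<And>x. x \<noteq> 0 \<Longrightarrow> \<bar>u x\<bar> \<le> C * norm x powr (- real DIM('a))"
  shows "(\<integral>\<^sup>+x. ennreal (\<bar>u x\<bar> powr q) \<partial>lborel) < \<infinity>"
proof -
  define n where "n = real DIM('a)"
  have n: "n \<ge> 1" by (simp add: n_def)
  have K0: "0 \<le> K" using K[of 0] by simp
  \<comment> \<open>The decay bound at a unit vector forces \<open>C\<close> to be
    nonnegative.\<close>
  obtain b :: 'a where b: "b \<in> Basis" using nonempty_Basis by blast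
  have C0: "0 \<le> C" using C[of b] b nonzero_Basis[of b] by (auto simp: norm_Basis)
  define c where "c k = C powr q * 2 powr (- (n * q * real k))" for k :: nat
  define B where "B k = cball (0::'a) (2 ^ k)" for k :: nat
  have [measurable]: "B k \<in> sets borel" for k by (simp add: B_def)
  have pt: "ennreal (\<bar>u x\<bar> powr q) \<le> ennreal (K powr q) * indicator (B 0) x
      + (\<Sum>k. ennreal (c k) * indicator (B (Suc k)) x)" for x
  proof (cases "norm x \<le> 1")
    case True
    then have "ennreal (\<bar>u x\<bar> powr q) \<le> ennreal (K powr q) * indicator (B 0) x"
      using K[of x] q by (auto simp: B_def intro!: ennreal_leI powr_mono2)
    then show ?thesis by (rule order_trans) simp
  next
    case False
    define j where "j = (LEAST j. norm x < 2 ^ j)"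
    obtain j0 where "norm x < 2 ^ j0" using real_arch_pow[of 2 "norm x"] by auto
    then have j: "norm x < 2 ^ j" unfolding j_def by (rule LeastI)
    then have "j \<noteq> 0" using False by (intro notI) simp
    then obtain k where k: "j = Suc k" using not0_implies_Suc by blast
    have "\<not> norm x < 2 ^ k" using not_less_Least[of k "\<lambda>j. norm x < 2 ^ j"] k by (simp add: j_def)
    then have kx: "2 powr real k \<le> norm x" by (simp add: powr_realpow)
    have x: "x \<noteq> 0" using False by auto
    define F where "F k = ennreal (c k) * indicator (B (Suc k)) x" for k
    have "\<bar>u x\<bar> \<le> C * norm x powr (- n)" using C[OF x] by (simp add: n_def)
    also have "\<dots> \<le> C * (2 powr real k) powr (- n)"
      using kx C0 n by (intro mult_left_mono powr_mono2') auto
    finally have "\<bar>u x\<bar> powr q \<le> (C * (2 powr real k) powr (- n)) powr q"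
      using q by (intro powr_mono2) auto
    also have "\<dots> = c k" using C0 by (simp add: powr_mult c_def powr_powr mult_ac)
    finally have "ennreal (\<bar>u x\<bar> powr q) \<le> F k"
      using j k by (auto simp: F_def B_def intro!: ennreal_leI)
    also have "F k \<le> suminf F" using sum_le_suminf[of F "{k}"] by simp
    also have "suminf F = (\<Sum>k. ennreal (c k) * indicator (B (Suc k)) x)" by (simp add: F_def[abs_def])
    finally show ?thesis by (rule order_trans) simp
  qed
  define V where "V = unit_ball_vol n"
  have V: "V \<ge> 0" by (simp add: V_def n_def)
  have B: "emeasure lborel (B k) = ennreal (V * 2 powr (n * real k))" for k
    by (simp add: B_def emeasure_cball V_def n_def powr_realpow[symmetric] powr_powr mult.commute)
  define r where "r = 2 powr (n - n * q)"
  have r: "0 < r" "r < 1" using n q by (auto simp: r_def powr_less_one)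
  have rk: "2 powr (real k * (n - n * q)) = r ^ k" for k
    by (simp add: r_def powr_realpow[symmetric] powr_powr mult.commute)
  have ck: "c k * (V * 2 powr (n * real (Suc k))) = C powr q * V * 2 powr n * r ^ k" for k
  proof -
    have "- (n * q * real k) + n * real (Suc k) = n + real k * (n - n * q)"
      by (simp add: algebra_simps)
    then have "2 powr (- (n * q * real k)) * 2 powr (n * real (Suc k)) = 2 powr n * r ^ k"
      by (metis powr_add rk)
    then show ?thesis by (simp add: c_def mult_ac)
  qed
  have "(\<integral>\<^sup>+x. ennreal (\<bar>u x\<bar> powr q) \<partial>lborel)
      \<le> (\<integral>\<^sup>+x. ennreal (K powr q) * indicator (B 0) x
          + (\<Sum>k. ennreal (c k) * indicator (B (Suc k)) x) \<partial>lborel)"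
    by (intro nn_integral_mono pt)
  also have "\<dots> = ennreal (K powr q) * emeasure lborel (B 0)
      + (\<Sum>k. ennreal (c k) * emeasure lborel (B (Suc k)))"
    by (simp add: nn_integral_add nn_integral_suminf nn_integral_cmult_indicator)
  also have "\<dots> = ennreal (K powr q) * ennreal V + (\<Sum>k. ennreal (C powr q * V * 2 powr n * r ^ k))"
    using C0 V by (simp only: B ck[symmetric]) (simp add: ennreal_mult[symmetric] c_def)
  also have "(\<Sum>k. ennreal (C powr q * V * 2 powr n * r ^ k)) = ennreal (\<Sum>k. C powr q * V * 2 powr n * r ^ k)"
    using r V by (intro suminf_ennreal2 summable_mult) auto
  also have "ennreal (K powr q) * ennreal V + \<dots> < \<infinity>" by (simp add: ennreal_mult_less_top)
  finally show ?thesis .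
qed

locale self_similar_kernel =
  fixes M :: "'a::euclidean_space \<Rightarrow> real \<Rightarrow> real" and C0 :: real
  assumes cont: "continuous_on (UNIV \<times> {0<..}) (\<lambda>(x, t). M x t)"
    and self_similar: "t > 0 \<Longrightarrow> M x t = t powr (- (real DIM('a) / 2)) * M ((1 / sqrt t) *\<^sub>R x) 1"
    and decay: "x \<noteq> 0 \<Longrightarrow> t > 0 \<Longrightarrow> \<bar>M x t\<bar> \<le> C0 * norm x powr (- real DIM('a))"
begin

text \<open>The norm of \<open>M(t)\<close> is \<open>t powr (- decay_rate \<theta>)\<close> times
  that of \<open>M(1)\<close>. The rate is affine in \<open>\<theta>\<close> and vanishes at 1, so
  under Young's relation the rates of kernel and source add up.\<close>

definition decay_rate :: "real \<Rightarrow> real" where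
  "decay_rate \<theta> = real DIM('a) / 2 * (1 - \<theta>)"

lemma C0_nonneg: "0 \<le> C0"
proof -
  obtain b :: 'a where b: "b \<in> Basis" using nonempty_Basis by blast
  show ?thesis using decay[of b 1] b nonzero_Basis[of b] by (auto simp: norm_Basis)
qed

lemma borel_kernel: "(\<lambda>(x, t). if 0 < t then M x t else 0) \<in> borel_measurable (borel :: ('a \<times> real) measure)"
proof -
  have S: "UNIV \<times> {0<..} \<in> sets (borel :: ('a \<times> real) measure)"
    by (intro borel_open open_Times) auto
  have "(\<lambda>p. indicator (UNIV \<times> {0<..}) p *\<^sub>R (\<lambda>(x, t). M x t) p) \<in> borel_measurable borel"
    by (rule borel_measurable_continuous_on_indicator[OF S cont])
  also have "(\<lambda>p. indicator (UNIV \<times> {0<..}) p *\<^sub>R (\<lambda>(x, t). M x t) p) = (\<lambda>(x, t). if 0 < t then M x t else 0)"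
    by (auto simp: fun_eq_iff)
  finally show ?thesis .
qed

lemma continuous_at_time: "t > 0 \<Longrightarrow> continuous_on UNIV (\<lambda>x. M x t)"
  using continuous_on_compose2[OF cont, of UNIV "\<lambda>x. (x, t)"]
  by (simp add: image_subset_iff continuous_on_Pair)

lemma borel_at_time [measurable]: "t > 0 \<Longrightarrow> (\<lambda>x. M x t) \<in> borel_measurable borel"
  by (intro borel_measurable_continuous_onI continuous_at_time)

lemma bounded_profile: "\<exists>K. \<forall>x. \<bar>M x 1\<bar> \<le> K"
proof -
  have "compact ((\<lambda>x. M x 1) ` cball 0 1)"
    by (intro compact_continuous_image continuous_on_subset[OF continuous_at_time]) auto
  then obtain K where K: "\<And>x. norm x \<le> 1 \<Longrightarrow> \<bar>M x 1\<bar> \<le> K"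
    by (force simp: bounded_iff dest!: compact_imp_bounded)
  have "\<bar>M x 1\<bar> \<le> max K C0" for x
  proof (cases "norm x \<le> 1")
    case False
    then have "\<bar>M x 1\<bar> \<le> C0 * norm x powr (- real DIM('a))" by (intro decay) auto
    also have "\<dots> \<le> C0 * norm x powr 0"
      using False C0_nonneg by (intro mult_left_mono powr_mono) auto
    also have "\<dots> = C0" using False by auto
    finally show ?thesis by simp
  qed (use K[of x] in auto)
  then show ?thesis by blast
qed

text \<open>\<open>\<theta> < 1\<close> means an exponent \<open>q > 1\<close>, for which
  \<open>|x|^(-nq)\<close> is integrable at infinity; near the origin \<open>M(1)\<close> is
  bounded.\<close>

lemma profile_Lp:
  assumes "0 \<le> \<theta>" "\<theta> < 1"
  shows "\<exists>m>0. Lp_le \<theta> (\<lambda>x. M x 1) m"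
proof -
  obtain K where K: "\<And>x. \<bar>M x 1\<bar> \<le> K" using bounded_profile by blast
  show ?thesis
  proof (cases "\<theta> = 0")
    case True
    show ?thesis using K by (intro exI[of _ "\<bar>K\<bar> + 1"]) (auto simp: Lp_le_def True intro!: AE_I2 order_trans[OF K])
  next
    case False
    let ?I = "\<integral>\<^sup>+x. ennreal (\<bar>M x 1\<bar> powr (1 / \<theta>)) \<partial>lborel"
    have "?I < \<infinity>"
      using assms False K decay by (intro nn_integral_powr_decay_finite[where K=K and C=C0]) auto
    then obtain N where N: "?I = ennreal N" "0 \<le> N"
      by (metis ennreal_cases less_irrefl infinity_ennreal_def)
    have "Lp_le \<theta> (\<lambda>x. M x 1) ((N + 1) powr \<theta>)"
      using N False by (simp add: Lp_le_def powr_powr)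
    moreover have "(N + 1) powr \<theta> > 0" using N by simp
    ultimately show ?thesis by blast
  qed
qed

text \<open>Stated for an arbitrary profile \<open>u\<close>, because it is applied both to
  \<open>M(1)\<close> and to a difference of two kernels.\<close>

lemma Lp_le_rescale:
  fixes u :: "'a \<Rightarrow> real"
  assumes [measurable]: "u \<in> borel_measurable borel" and "0 \<le> \<theta>" "0 \<le> m" "t > 0" and u: "Lp_le \<theta> u m"
  shows "Lp_le \<theta> (\<lambda>x. t powr (- (real DIM('a) / 2)) * u ((1 / sqrt t) *\<^sub>R x)) (m * t powr (- decay_rate \<theta>))"
proof -
  have "Lp_le \<theta> (\<lambda>x. u (0 + (1 / sqrt t) *\<^sub>R x)) (m * (1 / sqrt t) powr (- (real DIM('a) * \<theta>)))"
    using assms by (intro Lp_le_affine[where t=0]) auto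
  then have "Lp_le \<theta> (\<lambda>x. t powr (- (real DIM('a) / 2)) * u ((1 / sqrt t) *\<^sub>R x))
     (t powr (- (real DIM('a) / 2)) * (m * (1 / sqrt t) powr (- (real DIM('a) * \<theta>))))"
    using assms by (subst Lp_le_cmult) auto
  moreover have "(1 / sqrt t) powr (- (real DIM('a) * \<theta>)) = t powr (real DIM('a) * \<theta> / 2)"
    using assms by (simp add: powr_divide powr_half_sqrt[symmetric] powr_powr powr_minus field_simps)
  moreover have "t powr (- (real DIM('a) / 2)) * t powr (real DIM('a) * \<theta> / 2) = t powr (- decay_rate \<theta>)"
    by (simp add: powr_add[symmetric] decay_rate_def algebra_simps diff_divide_distrib)
  ultimately show ?thesis by (simp add: mult_ac)
qed

lemma kernel_Lp:
  assumes "Lp_le \<theta> (\<lambda>x. M x 1) m" "0 \<le> \<theta>" "0 \<le> m" "t > 0"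
  shows "Lp_le \<theta> (\<lambda>x. M x t) (m * t powr (- decay_rate \<theta>))"
proof -
  have "(\<lambda>x. M x t) = (\<lambda>x. t powr (- (real DIM('a) / 2)) * M ((1 / sqrt t) *\<^sub>R x) 1)"
    using self_similar[OF assms(4)] by blast
  then show ?thesis
    using Lp_le_rescale[OF borel_at_time[OF zero_less_one] assms(2-4,1)] by (simp only:)
qed

section \<open>Continuity of translations and dilations in norm\<close>

text \<open>The decay bound is uniform in time, so outside a large ball both values are at most
  \<open>\<eta> / 2\<close>; inside, uniform continuity on a compact set applies.\<close>

lemma translation_continuity_top:
  assumes "\<eta> > 0"
  shows "\<exists>\<rho>>0. \<forall>z r. norm z \<le> \<rho> \<longrightarrow> 0 \<le> r \<longrightarrow> r \<le> \<rho> \<longrightarrow> r < 1 \<longrightarrow>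
           (\<forall>x. \<bar>M (x - z) (1 - r) - M x 1\<bar> \<le> \<eta>)"
proof -
  \<comment> \<open>Chosen so that \<open>C0 / (R - 1) \<le> \<eta> / 2\<close>; the margin of one
    absorbs the shift by \<open>z\<close>.\<close>
  define R where "R = 2 + 2 * C0 / \<eta>"
  have R: "R \<ge> 2" using C0_nonneg assms by (simp add: R_def)
  have far: "\<bar>M x t\<bar> \<le> \<eta> / 2" if "norm x \<ge> R - 1" "t > 0" for x t
  proof -
    have x1: "norm x \<ge> 1" using that R by linarith
    then have x0: "x \<noteq> 0" by auto
    have "\<bar>M x t\<bar> \<le> C0 * norm x powr (- real DIM('a))"
      using that x0 by (intro decay)
    also have "\<dots> \<le> C0 * norm x powr (- 1)"
      using x1 C0_nonneg DIM_positive[where 'a='a] by (intro mult_left_mono powr_mono) auto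
    also have "\<dots> = C0 / norm x" using x1 by (simp add: powr_minus field_simps)
    also have "\<dots> \<le> C0 / (2 * C0 / \<eta> + 1)"
    proof (intro divide_left_mono mult_pos_pos C0_nonneg)
      show "0 < 2 * C0 / \<eta> + 1" using C0_nonneg assms by (intro add_nonneg_pos) auto
    qed (use that x1 in \<open>auto simp: R_def\<close>)
    also have "\<dots> \<le> \<eta> / 2" using C0_nonneg assms by (simp add: field_simps)
    finally show ?thesis .
  qed
  let ?K = "cball (0::'a) (R + 1) \<times> {1/2..1::real}"
  have "uniformly_continuous_on ?K (\<lambda>(x, t). M x t)"
    by (intro compact_uniformly_continuous continuous_on_subset[OF cont] compact_Times) auto
  then obtain d where d: "d > 0" and dd: "\<And>p p'. p \<in> ?K \<Longrightarrow> p' \<in> ?K \<Longrightarrow> dist p' p < d \<Longrightarrow>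
      dist ((\<lambda>(x, t). M x t) p') ((\<lambda>(x, t). M x t) p) < \<eta>"
    unfolding uniformly_continuous_on_def using assms by metis
  \<comment> \<open>The bound 1/2 keeps \<open>1 - r\<close> in the time interval of the compact
    set, and \<open>d / 3\<close> makes \<open>norm z + r\<close> less than
    \<open>d\<close>.\<close>
  define \<rho> where "\<rho> = min (1 / 2) (d / 3)"
  have \<rho>: "\<rho> > 0" "\<rho> \<le> 1 / 2" "\<rho> \<le> d / 3" using d by (auto simp: \<rho>_def)
  show ?thesis
  proof (intro exI conjI allI impI)
    fix z x :: 'a and r :: real assume z: "norm z \<le> \<rho>" and r: "0 \<le> r" "r \<le> \<rho>" "r < 1"
    have t: "1 - r > 0" using r by simp
    show "\<bar>M (x - z) (1 - r) - M x 1\<bar> \<le> \<eta>"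
    proof (cases "norm x \<ge> R")
      case True
      have "norm (x - z) \<ge> R - 1" using norm_triangle_ineq2[of x z] True z \<rho> by linarith
      then show ?thesis using far[of "x - z" "1 - r"] far[of x 1] t True by (simp add: abs_if split: if_splits)
    next
      case False
      have "norm (x - z) \<le> R + 1" using norm_triangle_ineq4[of x z] False z \<rho> by linarith
      then have in1: "(x - z, 1 - r) \<in> ?K" and in2: "(x, 1) \<in> ?K" using r \<rho> False by auto
      have "dist (x - z, 1 - r) (x, 1) \<le> norm z + \<bar>r\<bar>"
        using norm_Pair_le[of "- z" "- r"] by (simp add: dist_norm)
      also have "\<dots> < d" using z r \<rho> d by auto
      finally show ?thesis using dd[OF in2 in1] by (simp add: dist_real_def)
    qed
  qed (fact \<rho>)
qed

end

lemma Lp_le_finite_integral: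
  assumes "Lp_le \<theta> u m" "0 < \<theta>"
  obtains N where "0 \<le> N" "(\<integral>\<^sup>+x. ennreal (\<bar>u x\<bar> powr (1 / \<theta>)) \<partial>lborel) = ennreal N"
proof -
  have "(\<integral>\<^sup>+x. ennreal (\<bar>u x\<bar> powr (1 / \<theta>)) \<partial>lborel) \<le> ennreal (m powr (1 / \<theta>))"
    using assms by (simp add: Lp_le_def)
  then have "(\<integral>\<^sup>+x. ennreal (\<bar>u x\<bar> powr (1 / \<theta>)) \<partial>lborel) < \<infinity>"
    using ennreal_less_top le_less_trans by (metis infinity_ennreal_def)
  then show ?thesis using that by (metis ennreal_cases less_irrefl infinity_ennreal_def)
qed

text \<open>Pointwise convergence together with convergence of the norms gives convergence in norm:
  Fatou's lemma is applied to \<open>2\<^sup>q (\<bar>u\<^sub>k\<bar>\<^sup>q + \<bar>u\<bar>\<^sup>q) - \<bar>u\<^sub>k - u\<bar>\<^sup>q \<ge> 0\<close>.\<close>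
lemma Lp_convergence_from_norms:
  fixes u :: "'a::euclidean_space \<Rightarrow> real" and v :: "nat \<Rightarrow> 'a \<Rightarrow> real"
  assumes [measurable]: "u \<in> borel_measurable borel" "\<And>k. v k \<in> borel_measurable borel"
    and q: "q > 0" and lim: "\<And>x. (\<lambda>k. v k x) \<longlonglongrightarrow> u x"
    and N: "(\<integral>\<^sup>+x. ennreal (\<bar>u x\<bar> powr q) \<partial>lborel) = ennreal N" "0 \<le> N"
    and vN: "\<And>k. (\<integral>\<^sup>+x. ennreal (\<bar>v k x\<bar> powr q) \<partial>lborel) \<le> ennreal (N * c k)" "\<And>k. 0 \<le> c k" "c \<longlonglongrightarrow> 1"
    and e: "e > 0"
  shows "\<exists>k. (\<integral>\<^sup>+x. ennreal (\<bar>v k x - u x\<bar> powr q) \<partial>lborel) \<le> ennreal e"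
proof (rule ccontr)
  assume contra: "\<not> ?thesis"
  define F where "F k x = 2 powr q * (\<bar>v k x\<bar> powr q + \<bar>u x\<bar> powr q) - \<bar>v k x - u x\<bar> powr q" for k x
  have [measurable]: "F k \<in> borel_measurable borel" for k by (simp add: F_def[abs_def])
  have F0: "0 \<le> F k x" for k x
  proof -
    have "\<bar>v k x - u x\<bar> powr q \<le> (2 * max \<bar>v k x\<bar> \<bar>u x\<bar>) powr q" using q by (intro powr_mono2) auto
    also have "\<dots> = 2 powr q * max \<bar>v k x\<bar> \<bar>u x\<bar> powr q" by (simp add: powr_mult)
    also have "\<dots> \<le> 2 powr q * (\<bar>v k x\<bar> powr q + \<bar>u x\<bar> powr q)"
      by (intro mult_left_mono) (auto simp: max_def)
    finally show ?thesis by (simp add: F_def)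
  qed
  have Fatou: "ennreal (2 * 2 powr q * N) \<le> liminf (\<lambda>k. \<integral>\<^sup>+x. ennreal (F k x) \<partial>lborel)"
  proof -
    have "liminf (\<lambda>k. ennreal (F k x)) = ennreal (2 * 2 powr q) * ennreal (\<bar>u x\<bar> powr q)" for x
    proof -
      have "(\<lambda>k. F k x) \<longlonglongrightarrow> 2 powr q * (\<bar>u x\<bar> powr q + \<bar>u x\<bar> powr q) - \<bar>u x - u x\<bar> powr q"
        unfolding F_def using q lim by (intro tendsto_intros) auto
      also have "2 powr q * (\<bar>u x\<bar> powr q + \<bar>u x\<bar> powr q) - \<bar>u x - u x\<bar> powr q = 2 * 2 powr q * \<bar>u x\<bar> powr q"
        using q by (simp add: algebra_simps)
      finally have "(\<lambda>k. ennreal (F k x)) \<longlonglongrightarrow> ennreal (2 * 2 powr q * \<bar>u x\<bar> powr q)"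
        by (intro tendsto_ennrealI)
      then show ?thesis by (simp add: lim_imp_Liminf ennreal_mult')
    qed
    then have "(\<integral>\<^sup>+x. liminf (\<lambda>k. ennreal (F k x)) \<partial>lborel) = ennreal (2 * 2 powr q * N)"
      using N by (simp add: nn_integral_cmult ennreal_mult')
    then show ?thesis using nn_integral_liminf[of "\<lambda>k x. ennreal (F k x)" lborel] by simp
  qed
  \<comment> \<open>Under the negated claim every integral of \<open>|v k - u|^q\<close> exceeds
    \<open>e\<close>, which leaves at most \<open>w k\<close> for the integral of
    \<open>F k\<close>.\<close>
  define w where "w k = 2 powr q * (N * c k + N) - e" for k
  have Fw: "(\<integral>\<^sup>+x. ennreal (F k x) \<partial>lborel) \<le> ennreal (w k) \<and> 0 \<le> w k" for k
  proof -
    have "(\<integral>\<^sup>+x. ennreal (F k x) \<partial>lborel) + ennreal e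
        \<le> (\<integral>\<^sup>+x. ennreal (F k x) \<partial>lborel) + (\<integral>\<^sup>+x. ennreal (\<bar>v k x - u x\<bar> powr q) \<partial>lborel)"
      using contra by (intro add_left_mono) (simp add: not_le less_imp_le)
    also have "\<dots> = (\<integral>\<^sup>+x. ennreal (F k x) + ennreal (\<bar>v k x - u x\<bar> powr q) \<partial>lborel)"
      by (rule nn_integral_add[symmetric]) auto
    also have "\<dots> = (\<integral>\<^sup>+x. ennreal (2 powr q) * (ennreal (\<bar>v k x\<bar> powr q) + ennreal (\<bar>u x\<bar> powr q)) \<partial>lborel)"
      using F0 by (intro nn_integral_cong)
        (simp add: ennreal_plus[symmetric] ennreal_mult[symmetric] F_def del: ennreal_plus)
    also have "\<dots> = ennreal (2 powr q) *
        ((\<integral>\<^sup>+x. ennreal (\<bar>v k x\<bar> powr q) \<partial>lborel) + (\<integral>\<^sup>+x. ennreal (\<bar>u x\<bar> powr q) \<partial>lborel))"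
      by (simp add: nn_integral_cmult nn_integral_add)
    also have "\<dots> \<le> ennreal (2 powr q) * (ennreal (N * c k) + ennreal N)"
      using vN N by (intro mult_left_mono add_mono) auto
    also have "\<dots> = ennreal (w k + e)"
      using N vN(2) by (simp add: ennreal_mult'[symmetric] ennreal_plus[symmetric] w_def del: ennreal_plus)
    finally have *: "(\<integral>\<^sup>+x. ennreal (F k x) \<partial>lborel) + ennreal e \<le> ennreal (w k + e)" .
    have "(\<integral>\<^sup>+x. ennreal (F k x) \<partial>lborel) \<le> (\<integral>\<^sup>+x. ennreal (F k x) \<partial>lborel) + ennreal e" by simp
    also note *
    also have "ennreal (w k + e) < \<infinity>" by simp
    finally have "(\<integral>\<^sup>+x. ennreal (F k x) \<partial>lborel) < \<infinity>" .
    then obtain V where V: "(\<integral>\<^sup>+x. ennreal (F k x) \<partial>lborel) = ennreal V" "0 \<le> V"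
      by (metis ennreal_cases less_irrefl infinity_ennreal_def)
    have "ennreal (V + e) \<le> ennreal (w k + e)" using * V e by simp
    then have "V \<le> w k" using V e by (subst (asm) ennreal_le_iff2) auto
    then show ?thesis using V by (simp add: ennreal_leI)
  qed
  have wlim: "w \<longlonglongrightarrow> 2 powr q * (N * 1 + N) - e"
    unfolding w_def by (intro tendsto_intros vN)
  \<comment> \<open>\<open>ennreal\<close> maps negative numbers to zero, so the limit must be known
    to be nonnegative before the comparison can be read in the reals.\<close>
  have w0: "0 \<le> 2 powr q * (N * 1 + N) - e"
    by (rule LIMSEQ_le_const[OF wlim]) (use Fw in auto)
  have "ennreal (2 * 2 powr q * N) \<le> liminf (\<lambda>k. ennreal (w k))"
    using Fatou by (rule order_trans) (intro Liminf_mono always_eventually allI, use Fw in blast)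
  also have "\<dots> = ennreal (2 powr q * (N * 1 + N) - e)"
    by (intro lim_imp_Liminf tendsto_ennrealI wlim) simp
  finally have "2 * 2 powr q * N \<le> 2 powr q * (N * 1 + N) - e"
    using w0 by simp
  then show False using e by (simp add: algebra_simps)
qed

context self_similar_kernel
begin

text \<open>For \<open>\<theta> > 0\<close>, by contradiction along shifts \<open>z k\<close> and
  \<open>r k\<close> tending to zero. Continuity gives pointwise convergence; translation invariance
  and self-similarity bound the norms by that of \<open>M(1)\<close> times a factor tending to one.
  A single good index, as supplied by \<open>Lp_convergence_from_norms\<close>, already contradicts
  the choice of the shifts. The case \<open>\<theta> = 1\<close> is included when
  \<open>M(1)\<close> is integrable.\<close>

lemma translation_continuity:
  assumes th: "0 \<le> \<theta>" "\<theta> \<le> 1" and m: "Lp_le \<theta> (\<lambda>x. M x 1) m" and e: "\<eta> > 0"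
  shows "\<exists>\<rho>>0. \<rho> < 1 \<and> (\<forall>z r. norm z \<le> \<rho> \<longrightarrow> 0 \<le> r \<longrightarrow> r \<le> \<rho> \<longrightarrow> Lp_le \<theta> (\<lambda>x. M (x - z) (1 - r) - M x 1) \<eta>)"
proof (cases "\<theta> = 0")
  case True
  obtain \<rho> where \<rho>: "\<rho> > 0" and *: "\<And>z r x. norm z \<le> \<rho> \<Longrightarrow> 0 \<le> r \<Longrightarrow> r \<le> \<rho> \<Longrightarrow> r < 1 \<Longrightarrow>
      \<bar>M (x - z) (1 - r) - M x 1\<bar> \<le> \<eta>"
    using translation_continuity_top[OF e] by blast
  show ?thesis using \<rho> * by (intro exI[of _ "min \<rho> (1 / 2)"]) (auto simp: Lp_le_def True intro!: AE_I2)
next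
  case False
  then have thp: "\<theta> > 0" using th by simp
  show ?thesis
  proof (rule ccontr)
    assume contra: "\<not> ?thesis"
    \<comment> \<open>\<open>k + 2\<close> keeps the radius below one, so that \<open>1 - r\<close>
      stays positive.\<close>
    have ex: "\<forall>k::nat. \<exists>p. norm (fst p) \<le> 1 / real (k + 2) \<and> 0 \<le> snd p \<and> snd p \<le> 1 / real (k + 2) \<and>
        \<not> Lp_le \<theta> (\<lambda>x. M (x - fst p) (1 - snd p) - M x 1) \<eta>"
    proof
      fix k :: nat
      have "1 / real (k + 2) > 0" "1 / real (k + 2) < 1" by auto
      then obtain z r where "norm z \<le> 1 / real (k + 2)" "0 \<le> r" "r \<le> 1 / real (k + 2)"
          "\<not> Lp_le \<theta> (\<lambda>x. M (x - z) (1 - r) - M x 1) \<eta>"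
        using contra by blast
      then show "\<exists>p. norm (fst p) \<le> 1 / real (k + 2) \<and> 0 \<le> snd p \<and> snd p \<le> 1 / real (k + 2) \<and>
          \<not> Lp_le \<theta> (\<lambda>x. M (x - fst p) (1 - snd p) - M x 1) \<eta>"
        by (intro exI[of _ "(z, r)"]) simp
    qed
    obtain p where p: "\<forall>k. norm (fst (p k)) \<le> 1 / real (k + 2) \<and> 0 \<le> snd (p k) \<and> snd (p k) \<le> 1 / real (k + 2) \<and>
        \<not> Lp_le \<theta> (\<lambda>x. M (x - fst (p k)) (1 - snd (p k)) - M x 1) \<eta>"
      using choice[OF ex] by blast
    define z r where "z k = fst (p k)" and "r k = snd (p k)" for k
    have z: "\<And>k. norm (z k) \<le> 1 / real (k + 2)"
      and r: "\<And>k. 0 \<le> r k" "\<And>k. r k \<le> 1 / real (k + 2)"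
      and not: "\<And>k. \<not> Lp_le \<theta> (\<lambda>x. M (x - z k) (1 - r k) - M x 1) \<eta>"
      unfolding z_def r_def using p by blast+
    have inv0: "(\<lambda>k. 1 / real (k + 2)) \<longlonglongrightarrow> 0"
      using LIMSEQ_ignore_initial_segment[OF lim_1_over_n, of 2] by simp
    have z0: "z \<longlonglongrightarrow> 0" by (rule Lim_null_comparison[OF _ inv0]) (use z in auto)
    have r0: "r \<longlonglongrightarrow> 0" by (rule Lim_null_comparison[OF _ inv0]) (use r in auto)
    have t0: "1 - r k > 0" for k
    proof -
      have "1 / real (k + 2) < 1" by simp
      then show ?thesis using r(2)[of k] by linarith
    qed
    obtain N where N: "0 \<le> N" "(\<integral>\<^sup>+x. ennreal (\<bar>M x 1\<bar> powr (1 / \<theta>)) \<partial>lborel) = ennreal N"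
      using Lp_le_finite_integral[OF m thp] by blast
    have mN: "Lp_le \<theta> (\<lambda>x. M x 1) (N powr \<theta>)" using N thp by (simp add: Lp_le_def powr_powr)
    \<comment> \<open>The \<open>1/\<theta>\<close>-th power of the factor by which the norm of
      \<open>M(1 - r k)\<close> is rescaled.\<close>
    define c where "c k = (1 - r k) powr (- decay_rate \<theta> / \<theta>)" for k
    have "\<exists>k. (\<integral>\<^sup>+x. ennreal (\<bar>M (x - z k) (1 - r k) - M x 1\<bar> powr (1 / \<theta>)) \<partial>lborel) \<le> ennreal (\<eta> powr (1 / \<theta>))"
    proof (rule Lp_convergence_from_norms[where c=c and N=N])
      show "(\<lambda>x. M x 1) \<in> borel_measurable borel" by simp
      fix k
      have [measurable]: "(\<lambda>x. M x (1 - r k)) \<in> borel_measurable borel" using t0 by (rule borel_at_time)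
      show "(\<lambda>x. M (x - z k) (1 - r k)) \<in> borel_measurable borel"
        using measurable_compose[of "\<lambda>x. x - z k" borel borel "\<lambda>x. M x (1 - r k)"] by simp
      have "Lp_le \<theta> (\<lambda>x. M (x - z k) (1 - r k)) (N powr \<theta> * (1 - r k) powr (- decay_rate \<theta>))"
        using t0 th mN by (intro Lp_le_translate[of "\<lambda>x. M x (1 - r k)"] kernel_Lp) auto
      then show "(\<integral>\<^sup>+x. ennreal (\<bar>M (x - z k) (1 - r k)\<bar> powr (1 / \<theta>)) \<partial>lborel) \<le> ennreal (N * c k)"
        using N thp by (simp add: Lp_le_def powr_mult powr_powr c_def)
      show "0 \<le> c k" by (simp add: c_def)
    next
      fix x
      have "(\<lambda>k. x - z k) \<longlonglongrightarrow> x - 0" "(\<lambda>k. 1 - r k) \<longlonglongrightarrow> 1 - 0"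
        by (intro tendsto_intros z0 r0)+
      then have "(\<lambda>k. (x - z k, 1 - r k)) \<longlonglongrightarrow> (x - 0, 1 - 0)" by (rule tendsto_Pair)
      then have "(\<lambda>k. (\<lambda>(x, t). M x t) (x - z k, 1 - r k)) \<longlonglongrightarrow> (\<lambda>(x, t). M x t) (x - 0, 1 - 0)"
        by (rule continuous_on_tendsto_compose[OF cont _ _ always_eventually]) (use t0 in auto)
      then show "(\<lambda>k. M (x - z k) (1 - r k)) \<longlonglongrightarrow> M x 1" by simp
    next
      have "c \<longlonglongrightarrow> (1 - 0) powr (- decay_rate \<theta> / \<theta>)"
        unfolding c_def by (intro tendsto_intros r0) auto
      then show "c \<longlonglongrightarrow> 1" by simp
    qed (use N thp e in auto)
    then show False using not thp by (auto simp: Lp_le_def)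
  qed
qed

lemma kernel_near:
  assumes th: "0 \<le> \<theta>" "\<theta> \<le> 1" and m: "Lp_le \<theta> (\<lambda>x. M x 1) m" and e: "\<eta> > 0"
  shows "\<exists>\<rho>>0. \<rho> < 1 \<and> (\<forall>t y s. t > 0 \<longrightarrow> norm y \<le> \<rho> * sqrt t \<longrightarrow> 0 \<le> s \<longrightarrow> s \<le> \<rho> * t \<longrightarrow>
           Lp_le \<theta> (\<lambda>x. M (x - y) (t - s) - M x t) (\<eta> * t powr (- decay_rate \<theta>)))"
proof -
  obtain \<rho> where \<rho>: "\<rho> > 0" "\<rho> < 1" and *: "\<And>z r. norm z \<le> \<rho> \<Longrightarrow> 0 \<le> r \<Longrightarrow> r \<le> \<rho> \<Longrightarrow>
      Lp_le \<theta> (\<lambda>x. M (x - z) (1 - r) - M x 1) \<eta>"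
    using translation_continuity[OF assms] by blast
  show ?thesis
  proof (intro exI[of _ \<rho>] conjI allI impI \<rho>)
    fix t s :: real and y :: 'a
    assume t: "t > 0" and y: "norm y \<le> \<rho> * sqrt t" and s: "0 \<le> s" "s \<le> \<rho> * t"
    \<comment> \<open>Parabolic rescaling reduces the claim to unit time, where
      \<open>\<rho>\<close> was chosen; this makes \<open>\<rho>\<close> independent of
      \<open>t\<close>.\<close>
    define z where "z = (1 / sqrt t) *\<^sub>R y"
    define r where "r = s / t"
    have z: "norm z \<le> \<rho>" using y t by (simp add: z_def field_simps)
    have r: "0 \<le> r" "r \<le> \<rho>" using s t by (auto simp: r_def field_simps)
    then have "r < 1" using \<rho> by linarith
    note r = r this
    have [measurable]: "(\<lambda>x. M x (1 - r)) \<in> borel_measurable borel" using r by (intro borel_at_time) simp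
    have [measurable]: "(\<lambda>x. M (x - z) (1 - r)) \<in> borel_measurable borel"
      using measurable_compose[of "\<lambda>x. x - z" borel borel "\<lambda>x. M x (1 - r)"] by simp
    have "Lp_le \<theta> (\<lambda>x. t powr (- (real DIM('a) / 2)) *
        (M ((1 / sqrt t) *\<^sub>R x - z) (1 - r) - M ((1 / sqrt t) *\<^sub>R x) 1)) (\<eta> * t powr (- decay_rate \<theta>))"
      by (rule Lp_le_rescale[of "\<lambda>x. M (x - z) (1 - r) - M x 1"]) (use th e t * z r in auto)
    moreover have "t powr (- (real DIM('a) / 2)) *
        (M ((1 / sqrt t) *\<^sub>R x - z) (1 - r) - M ((1 / sqrt t) *\<^sub>R x) 1) = M (x - y) (t - s) - M x t" for x
    proof -
      have ts: "t - s = t * (1 - r)" using t by (simp add: r_def field_simps)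
      have "t powr (- (real DIM('a) / 2)) * M ((1 / sqrt t) *\<^sub>R x - z) (1 - r)
          = t powr (- (real DIM('a) / 2)) * ((1 - r) powr (- (real DIM('a) / 2)) *
             M ((1 / sqrt (1 - r)) *\<^sub>R ((1 / sqrt t) *\<^sub>R (x - y))) 1)"
        using r by (subst self_similar) (auto simp: z_def scaleR_diff_right)
      also have "\<dots> = (t * (1 - r)) powr (- (real DIM('a) / 2)) * M ((1 / sqrt (t * (1 - r))) *\<^sub>R (x - y)) 1"
        using r t by (simp add: powr_mult real_sqrt_mult mult.commute)
      also have "\<dots> = M (x - y) (t - s)" unfolding ts using r t by (intro self_similar[symmetric]) simp
      finally show ?thesis using self_similar[OF t, of x] by (simp add: right_diff_distrib)
    qed
    ultimately show "Lp_le \<theta> (\<lambda>x. M (x - y) (t - s) - M x t) (\<eta> * t powr (- decay_rate \<theta>))" by simp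
  qed
qed

end

section \<open>Decay of the source\<close>

lemma nn_integral_powr_singular:
  fixes a b :: real
  assumes "0 \<le> a" "a < 1" "0 \<le> h"
  shows "(\<integral>\<^sup>+s. ennreal ((t - s) powr (- a) * indicator {t - h..t} s) \<partial>lborel) = ennreal (h powr (1 - a) / (1 - a))"
proof -
  have "(\<integral>\<^sup>+s. ennreal ((t - s) powr (- a) * indicator {t - h..t} s) \<partial>lborel)
      = (\<integral>\<^sup>+s. (\<lambda>r. ennreal (r powr (- a) * indicator {0..h} r)) (t - s) \<partial>lborel)"
    by (intro nn_integral_cong) (auto simp: indicator_def)
  also have "\<dots> = (\<integral>\<^sup>+r. ennreal (r powr (- a) * indicator {0..h} r) \<partial>lborel)"
    by (rule nn_integral_lborel_reflect) simp
  also have "\<dots> = ennreal (h powr (- a + 1) / (- a + 1))"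
  proof (rule nn_integral_has_integral_lborel)
    have "((\<lambda>r. r powr (- a)) has_integral (h powr (- a + 1) / (- a + 1))) {0..h}"
      using assms by (intro has_integral_powr_from_0) auto
    moreover have "(\<lambda>r. r powr (- a) * indicator {0..h} r) = (\<lambda>r. if r \<in> {0..h} then r powr (- a) else 0)"
      by (auto simp: fun_eq_iff)
    ultimately show "((\<lambda>r. r powr (- a) * indicator {0..h} r) has_integral (h powr (- a + 1) / (- a + 1))) UNIV"
      by (simp only: has_integral_restrict_UNIV)
  qed auto
  finally show ?thesis by simp
qed

text \<open>For \<open>\<delta> \<le> 1/2\<close> the times satisfy \<open>s \<ge> t / 2\<close>, so
  \<open>s powr (- c)\<close> costs only the constant \<open>2 powr c\<close>. The singular factor
  contributes \<open>\<delta> powr (1 - a)\<close>, which is small with \<open>\<delta>\<close>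
  because \<open>a < 1\<close>.\<close>

lemma near_diagonal_integral:
  fixes a c t \<delta> :: real
  assumes "0 \<le> a" "a < 1" "0 \<le> c" "0 < \<delta>" "\<delta> \<le> 1 / 2" "0 < t"
  shows "(\<integral>\<^sup>+s. ennreal ((t - s) powr (- a) * s powr (- c) * indicator {(1 - \<delta>) * t..t} s) \<partial>lborel)
      \<le> ennreal (2 powr c / (1 - a) * \<delta> powr (1 - a) * t powr (1 - a - c))"
proof -
  have eq: "(1 - \<delta>) * t = t - \<delta> * t" by (simp add: algebra_simps)
  have le: "(t - s) powr (- a) * s powr (- c) * indicator {(1 - \<delta>) * t..t} s
      \<le> (t / 2) powr (- c) * ((t - s) powr (- a) * indicator {t - \<delta> * t..t} s)" for s
  proof (cases "s \<in> {t - \<delta> * t..t}")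
    case True
    have "\<delta> * t \<le> 1 / 2 * t" using assms by (intro mult_right_mono) auto
    then have "t / 2 \<le> s" using True by auto
    then have "s powr (- c) \<le> (t / 2) powr (- c)" using assms by (intro powr_mono2') auto
    then have "(t - s) powr (- a) * s powr (- c) \<le> (t - s) powr (- a) * (t / 2) powr (- c)"
      by (intro mult_left_mono) auto
    then show ?thesis using True unfolding eq by (simp add: mult.commute)
  next
    case False
    then have "indicator {t - \<delta> * t..t} s = (0::real)" by (rule indicator_simps)
    then show ?thesis unfolding eq by simp
  qed
  have "(\<integral>\<^sup>+s. ennreal ((t - s) powr (- a) * s powr (- c) * indicator {(1 - \<delta>) * t..t} s) \<partial>lborel)
      \<le> (\<integral>\<^sup>+s. ennreal ((t / 2) powr (- c)) * ennreal ((t - s) powr (- a) * indicator {t - \<delta> * t..t} s) \<partial>lborel)"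
    by (intro nn_integral_mono) (simp only: ennreal_mult'[symmetric] powr_ge_zero ennreal_leI[OF le])
  also have "\<dots> = ennreal ((t / 2) powr (- c)) * ennreal ((\<delta> * t) powr (1 - a) / (1 - a))"
    using assms by (simp add: nn_integral_cmult nn_integral_powr_singular)
  also have "\<dots> = ennreal (2 powr c / (1 - a) * \<delta> powr (1 - a) * t powr (1 - a - c))"
  proof -
    have "(t / 2) powr (- c) * ((\<delta> * t) powr (1 - a) / (1 - a)) = 2 powr c / (1 - a) * \<delta> powr (1 - a) * (t powr (- c) * t powr (1 - a))"
      using assms by (simp add: powr_mult powr_divide powr_minus field_simps)
    also have "t powr (- c) * t powr (1 - a) = t powr (1 - a - c)"
      by (simp add: powr_add[symmetric] algebra_simps)
    finally show ?thesis by (metis ennreal_mult' powr_ge_zero)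
  qed
  finally show ?thesis .
qed

lemma parabolic_exterior_borel:
  "{(y :: 'a::euclidean_space, s :: real). \<rho> * sqrt t < norm y \<or> \<rho> * t < s} \<in> sets borel" (is "?E \<in> _")
proof -
  have "?E = {z. \<rho> * sqrt t < norm (fst z)} \<union> {z. \<rho> * t < snd z}" by auto
  moreover have "open \<dots>" by (intro open_Un open_Collect_less continuous_intros)
  ultimately show ?thesis by simp
qed

text \<open>Dominated convergence: a fixed point \<open>(y, s)\<close> eventually satisfies both
  \<open>norm y < \<rho> * sqrt t\<close> and \<open>s < \<rho> * t\<close>.\<close>

lemma parabolic_tail:
  fixes f :: "'a::euclidean_space \<times> real \<Rightarrow> real"
  assumes f: "integrable lborel f" and "\<rho> > 0" "e > 0"
  shows "\<forall>\<^sub>F t in at_top. (\<integral>\<^sup>+z. ennreal (\<bar>f z\<bar> * indicator {(y, s). \<rho> * sqrt t < norm y \<or> \<rho> * t < s} z) \<partial>lborel) \<le> ennreal e"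
proof -
  define E where "E t = {(y :: 'a, s). \<rho> * sqrt t < norm y \<or> \<rho> * t < s}" for t
  have [measurable]: "E t \<in> sets borel" for t unfolding E_def by (rule parabolic_exterior_borel)
  have [measurable]: "f \<in> borel_measurable borel" using borel_measurable_integrable[OF f] by simp
  have "((\<lambda>t. LINT z|lborel. \<bar>f z\<bar> * indicator (E t) z) \<longlongrightarrow> (LINT z|(lborel :: ('a \<times> real) measure). 0)) at_top"
  proof (rule integral_dominated_convergence_at_top[where w="\<lambda>z. \<bar>f z\<bar>"])
    have "((\<lambda>t. \<bar>f z\<bar> * indicator (E t) z) \<longlongrightarrow> 0) at_top" for z
    proof -
      obtain y s where z: "z = (y, s)" by (cases z)
      have "\<forall>\<^sub>F t in at_top. norm y < \<rho> * sqrt t" "\<forall>\<^sub>F t in at_top. s < \<rho> * t"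
        using \<open>\<rho> > 0\<close> by (intro filterlim_at_top_dense[THEN iffD1, rule_format]
          filterlim_tendsto_pos_mult_at_top[OF tendsto_const] sqrt_at_top filterlim_ident; simp)+
      then have "\<forall>\<^sub>F t in at_top. \<bar>f z\<bar> * indicator (E t) z = 0"
        by eventually_elim (auto simp: E_def z)
      then show ?thesis by (rule tendsto_eventually)
    qed
    then show "AE z in lborel. ((\<lambda>t. \<bar>f z\<bar> * indicator (E t) z) \<longlongrightarrow> 0) at_top" by simp
  qed (use f in \<open>auto simp: indicator_def\<close>)
  then have "\<forall>\<^sub>F t in at_top. (LINT z|lborel. \<bar>f z\<bar> * indicator (E t) z) < e"
    using \<open>e > 0\<close> by (auto dest: order_tendstoD(2))
  then show ?thesis
  proof eventually_elim
    fix t assume t: "(LINT z|lborel. \<bar>f z\<bar> * indicator (E t) z) < e"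
    have "integrable lborel (\<lambda>z. \<bar>f z\<bar> * indicator (E t) z)"
      using f by (rule Bochner_Integration.integrable_bound) (auto simp: indicator_def)
    then have "(\<integral>\<^sup>+z. ennreal (\<bar>f z\<bar> * indicator (E t) z) \<partial>lborel) = ennreal (LINT z|lborel. \<bar>f z\<bar> * indicator (E t) z)"
      by (rule nn_integral_eq_integral) simp
    then show "(\<integral>\<^sup>+z. ennreal (\<bar>f z\<bar> * indicator {(y, s). \<rho> * sqrt t < norm y \<or> \<rho> * t < s} z) \<partial>lborel) \<le> ennreal e"
      using t by (simp add: E_def ennreal_leI)
  qed
qed

text \<open>The factor \<open>s powr (1 + d)\<close> normalizes \<open>f\<close> so that the powers with exponents \<open>1\<close> and
  \<open>1 / \<beta>\<close> have integrals of the same order \<open>s powr d\<close>; the intermediate power is at most their sum.\<close>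
lemma Lp_interpolation:
  fixes f :: "'a::euclidean_space \<Rightarrow> real"
  assumes [measurable]: "f \<in> borel_measurable borel" and b: "0 \<le> \<beta>" "\<beta> < \<beta>'" "\<beta>' < 1" and s: "s > 0" and C: "C > 0"
    and f1: "Lp_le 1 f (C * s powr (- 1))" and f2: "Lp_le \<beta> f (C * s powr (- (1 + d * (1 - \<beta>))))"
  shows "Lp_le \<beta>' f ((C + C powr (if \<beta> = 0 then 1 / \<beta>' else 1 / \<beta>)) powr \<beta>' * s powr (- (1 + d * (1 - \<beta>'))))"
proof -
  define W where "W = s powr (1 + d)"
  have W: "W > 0" using s by (simp add: W_def)
  define h where "h x = W * f x" for x
  have [measurable]: "h \<in> borel_measurable borel" by (simp add: h_def[abs_def])
  \<comment> \<open>Multiplication by \<open>W\<close> turns a bound of the assumed form at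
    \<open>\<gamma>\<close> into \<open>K * s powr (d * \<gamma>)\<close>, whose
    \<open>1/\<gamma>\<close>-th power is proportional to \<open>s powr d\<close> whatever
    \<open>\<gamma> > 0\<close> is.\<close>
  have Ws: "W * (K * s powr (- (1 + d * (1 - \<gamma>)))) = K * s powr (d * \<gamma>)" for K \<gamma>
    by (simp add: W_def powr_add[symmetric] algebra_simps)
  have h1: "(\<integral>\<^sup>+x. ennreal \<bar>h x\<bar> \<partial>lborel) \<le> ennreal (C * s powr d)"
  proof -
    have "Lp_le 1 (\<lambda>x. W * f x) (W * (C * s powr (- 1)))" using f1 W C by (subst Lp_le_cmult) auto
    then have "Lp_le 1 h (C * s powr d)" using Ws[of C 1] by (simp add: h_def[abs_def])
    then show ?thesis using C by (simp add: Lp_le_1_iff)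
  qed
  have h2: "Lp_le \<beta> h (C * s powr (d * \<beta>))"
  proof -
    have "Lp_le \<beta> (\<lambda>x. W * f x) (W * (C * s powr (- (1 + d * (1 - \<beta>)))))"
      using f2 W C b by (subst Lp_le_cmult) auto
    then show ?thesis by (simp only: Ws) (simp add: h_def[abs_def])
  qed
  \<comment> \<open>For \<open>\<beta> = 0\<close> there is no power \<open>1/\<beta>\<close>;
    boundedness of \<open>h\<close> puts the constant \<open>C powr (1/\<beta>' - 1)\<close> in
    front of the \<open>L^1\<close> bound, and \<open>C\<close> times this constant is
    \<open>C powr p\<close>.\<close>
  define p where "p = (if \<beta> = 0 then 1 / \<beta>' else 1 / \<beta>)"
  have p': "1 / \<beta>' > 1" using b by simp
  have "(\<integral>\<^sup>+x. ennreal (\<bar>h x\<bar> powr (1 / \<beta>')) \<partial>lborel) \<le> ennreal ((C + C powr p) * s powr d)"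
  proof (cases "\<beta> = 0")
    case True
    have "AE x in lborel. \<bar>h x\<bar> \<le> C" using h2 True s by (simp add: Lp_le_def)
    then have "(\<integral>\<^sup>+x. ennreal (\<bar>h x\<bar> powr (1 / \<beta>')) \<partial>lborel) \<le> (\<integral>\<^sup>+x. ennreal (C powr (1 / \<beta>' - 1)) * ennreal \<bar>h x\<bar> \<partial>lborel)"
    proof (intro nn_integral_mono_AE, eventually_elim)
      fix x assume x: "\<bar>h x\<bar> \<le> C"
      have "\<bar>h x\<bar> powr (1 / \<beta>') = \<bar>h x\<bar> powr (1 / \<beta>' - 1) * \<bar>h x\<bar>"
        by (cases "h x = 0") (auto simp: powr_diff)
      also have "\<dots> \<le> C powr (1 / \<beta>' - 1) * \<bar>h x\<bar>" using x p' by (intro mult_right_mono powr_mono2) auto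
      finally show "ennreal (\<bar>h x\<bar> powr (1 / \<beta>')) \<le> ennreal (C powr (1 / \<beta>' - 1)) * ennreal \<bar>h x\<bar>"
        by (simp add: ennreal_mult'[symmetric] ennreal_leI)
    qed
    also have "\<dots> = ennreal (C powr (1 / \<beta>' - 1)) * (\<integral>\<^sup>+x. ennreal \<bar>h x\<bar> \<partial>lborel)" by (rule nn_integral_cmult) simp
    also have "\<dots> \<le> ennreal (C powr (1 / \<beta>' - 1)) * ennreal (C * s powr d)" using h1 by (rule mult_left_mono) simp
    also have "\<dots> = ennreal (C powr p * s powr d)"
      using C True by (simp add: ennreal_mult'[symmetric] p_def powr_diff)
    also have "\<dots> \<le> ennreal ((C + C powr p) * s powr d)" using C by (intro ennreal_leI mult_right_mono) auto
    finally show ?thesis .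
  next
    case False
    have pt: "\<bar>h x\<bar> powr (1 / \<beta>') \<le> \<bar>h x\<bar> + \<bar>h x\<bar> powr p" for x
    proof (cases "\<bar>h x\<bar> \<le> 1")
      case True
      then have "\<bar>h x\<bar> powr (1 / \<beta>') \<le> \<bar>h x\<bar> powr 1" using p' by (intro powr_mono') auto
      then show ?thesis by (simp add: add_increasing2)
    next
      case h: False
      then have "\<bar>h x\<bar> powr (1 / \<beta>') \<le> \<bar>h x\<bar> powr p"
        using b False by (intro powr_mono) (auto simp: p_def frac_le)
      then show ?thesis by linarith
    qed
    have "(\<integral>\<^sup>+x. ennreal (\<bar>h x\<bar> powr (1 / \<beta>')) \<partial>lborel) \<le> (\<integral>\<^sup>+x. ennreal \<bar>h x\<bar> + ennreal (\<bar>h x\<bar> powr p) \<partial>lborel)"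
      by (intro nn_integral_mono) (simp add: ennreal_plus[symmetric] pt del: ennreal_plus)
    also have "\<dots> = (\<integral>\<^sup>+x. ennreal \<bar>h x\<bar> \<partial>lborel) + (\<integral>\<^sup>+x. ennreal (\<bar>h x\<bar> powr p) \<partial>lborel)"
      by (rule nn_integral_add) auto
    also have "\<dots> \<le> ennreal (C * s powr d) + ennreal (C powr p * s powr d)"
    proof (intro add_mono h1)
      have "(C * s powr (d * \<beta>)) powr p = C powr p * s powr d"
        using C s False by (simp add: powr_mult powr_powr p_def)
      then show "(\<integral>\<^sup>+x. ennreal (\<bar>h x\<bar> powr p) \<partial>lborel) \<le> ennreal (C powr p * s powr d)"
        using h2 False by (simp add: Lp_le_def p_def)
    qed
    also have "\<dots> = ennreal ((C + C powr p) * s powr d)"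
      using C by (simp add: ennreal_plus[symmetric] distrib_right del: ennreal_plus)
    finally show ?thesis .
  qed
  moreover have "((C + C powr p) powr \<beta>' * s powr (d * \<beta>')) powr (1 / \<beta>') = (C + C powr p) * s powr d"
    using b C by (simp add: powr_mult powr_powr add_nonneg_nonneg)
  ultimately have "Lp_le \<beta>' (\<lambda>x. W * f x) ((C + C powr p) powr \<beta>' * s powr (d * \<beta>'))"
    using b by (simp add: Lp_le_def h_def)
  then have "Lp_le \<beta>' (\<lambda>x. W * f x) (W * ((C + C powr p) powr \<beta>' * s powr (- (1 + d * (1 - \<beta>')))))"
    by (simp only: Ws)
  then show ?thesis using W b by (subst (asm) Lp_le_cmult) (auto simp: p_def)
qed

section \<open>The asymptotic profile\<close>

lemma borel_measurable_projections [measurable]: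
  "fst \<in> borel_measurable (borel :: ('a::euclidean_space \<times> real) measure)"
  "snd \<in> borel_measurable (borel :: ('a::euclidean_space \<times> real) measure)"
  by (auto intro!: borel_measurable_continuous_onI continuous_intros)

context self_similar_kernel
begin

text \<open>Extension by zero turns the integral over \<open>s < t\<close> into one over all of
  space-time, so that \<open>\<lambda> M(x, t)\<close> can be subtracted under the same integral
  sign.\<close>

definition kernel :: "'a \<Rightarrow> real \<Rightarrow> real" where
  "kernel x t = (if 0 < t then M x t else 0)"

lemma borel_measurable_kernel [measurable (raw)]:
  assumes "u \<in> borel_measurable N" "v \<in> borel_measurable N"
  shows "(\<lambda>p. kernel (u p) (v p)) \<in> borel_measurable N"
proof -
  have "(\<lambda>p. (u p, v p)) \<in> N \<rightarrow>\<^sub>M borel"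
    using measurable_Pair[OF assms] by (simp add: borel_prod)
  from measurable_compose[OF this borel_kernel] show ?thesis by (simp add: kernel_def[abs_def])
qed

lemma decay_rate_Young:
  assumes "Young_exponents \<mu> \<beta> \<theta>"
  shows "decay_rate \<theta> = decay_rate \<mu> + decay_rate \<beta>" "0 \<le> decay_rate \<mu>" "0 \<le> decay_rate \<beta>"
proof -
  have "1 + \<theta> = \<mu> + \<beta>" "\<mu> \<le> 1" "\<beta> \<le> 1" using assms by (auto simp: Young_exponents_def)
  then have e: "1 - \<theta> = (1 - \<mu>) + (1 - \<beta>)" and "\<mu> \<le> 1" "\<beta> \<le> 1" by auto
  then show "0 \<le> decay_rate \<mu>" "0 \<le> decay_rate \<beta>" by (simp_all add: decay_rate_def)
  show "decay_rate \<theta> = decay_rate \<mu> + decay_rate \<beta>"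
    unfolding decay_rate_def e by (rule distrib_left)
qed

text \<open>Crude bounds for sources that are not small in the parabolic scale. The second is
  uniform as long as \<open>t - s\<close> stays comparable to \<open>t\<close>. Near
  \<open>s = t\<close> the norm of the kernel may blow up, so the first leaves that term to
  \<open>near_diagonal_bound\<close>.\<close>

lemma kernel_difference_bound:
  fixes y :: 'a
  assumes th: "0 \<le> \<theta>" "\<theta> \<le> 1" and m: "Lp_le \<theta> (\<lambda>x. M x 1) m" "0 < m" and g: "g \<in> dual_ball \<theta>" and t: "0 < t"
  shows "(\<integral>\<^sup>+x. ennreal (\<bar>kernel (x - y) (t - s) - M x t\<bar> * g x) \<partial>lborel)
          \<le> (\<integral>\<^sup>+x. ennreal (\<bar>kernel (x - y) (t - s)\<bar> * g x) \<partial>lborel) + ennreal (m * t powr (- decay_rate \<theta>))"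
      (is "?L \<le> _")
    and "\<delta> * t \<le> t - s \<Longrightarrow> 0 < \<delta> \<Longrightarrow> (\<integral>\<^sup>+x. ennreal (\<bar>kernel (x - y) (t - s) - M x t\<bar> * g x) \<partial>lborel)
          \<le> ennreal (m * (\<delta> powr (- decay_rate \<theta>) + 1) * t powr (- decay_rate \<theta>))"
proof -
  note [measurable] = dual_ballD(1)[OF g] borel_at_time[OF t]
  have "?L \<le> (\<integral>\<^sup>+x. ennreal (\<bar>kernel (x - y) (t - s)\<bar> * g x) + ennreal (\<bar>M x t\<bar> * g x) \<partial>lborel)"
    using dual_ballD(2)[OF g] by (intro nn_integral_mono)
      (simp add: ennreal_plus[symmetric] distrib_right[symmetric] mult_right_mono ennreal_leI abs_triangle_ineq4 del: ennreal_plus)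
  also have "\<dots> = (\<integral>\<^sup>+x. ennreal (\<bar>kernel (x - y) (t - s)\<bar> * g x) \<partial>lborel) + (\<integral>\<^sup>+x. ennreal (\<bar>M x t\<bar> * g x) \<partial>lborel)"
    by (rule nn_integral_add) auto
  also have "\<dots> \<le> (\<integral>\<^sup>+x. ennreal (\<bar>kernel (x - y) (t - s)\<bar> * g x) \<partial>lborel) + ennreal (m * t powr (- decay_rate \<theta>))"
    using m th t by (intro add_left_mono Holder[OF _ th _ _ g] kernel_Lp) auto
  finally show *: "?L \<le> (\<integral>\<^sup>+x. ennreal (\<bar>kernel (x - y) (t - s)\<bar> * g x) \<partial>lborel) + ennreal (m * t powr (- decay_rate \<theta>))" .
  assume d: "\<delta> * t \<le> t - s" "0 < \<delta>"
  have ts: "0 < t - s" using d t by (smt (verit) mult_pos_pos)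
  have d0: "0 \<le> decay_rate \<theta>" using th by (simp add: decay_rate_def)
  have "Lp_le \<theta> (\<lambda>x. kernel (x - y) (t - s)) (m * (t - s) powr (- decay_rate \<theta>))"
    using kernel_Lp[OF m(1) th(1) _ ts] m ts borel_at_time[OF ts] th Lp_le_translate[of "\<lambda>x. M x (t - s)" \<theta> _ y]
    by (simp add: kernel_def)
  then have "(\<integral>\<^sup>+x. ennreal (\<bar>kernel (x - y) (t - s)\<bar> * g x) \<partial>lborel) \<le> ennreal (m * (t - s) powr (- decay_rate \<theta>))"
    using m by (intro Holder[OF _ th _ _ g]) auto
  also have "\<dots> \<le> ennreal (m * (\<delta> * t) powr (- decay_rate \<theta>))"
    using d t d0 m by (intro ennreal_leI mult_left_mono powr_mono2') auto
  also have "\<dots> = ennreal (m * \<delta> powr (- decay_rate \<theta>) * t powr (- decay_rate \<theta>))"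
    using d t by (simp add: powr_mult mult_ac)
  finally have "?L \<le> ennreal (m * \<delta> powr (- decay_rate \<theta>) * t powr (- decay_rate \<theta>)) + ennreal (m * t powr (- decay_rate \<theta>))"
    using * by (meson add_right_mono order_trans)
  also have "\<dots> = ennreal (m * (\<delta> powr (- decay_rate \<theta>) + 1) * t powr (- decay_rate \<theta>))"
    using m by (simp add: ennreal_plus[symmetric] algebra_simps del: ennreal_plus)
  finally show "?L \<le> ennreal (m * (\<delta> powr (- decay_rate \<theta>) + 1) * t powr (- decay_rate \<theta>))" .
qed

text \<open>At a fixed time \<open>s\<close>, Young's inequality gives a multiple of \<open>(t - s)
  powr (- decay_rate \<mu>) * s powr (- (1 + decay_rate \<beta>))\<close>. Integration in
  \<open>s\<close> gains one power of \<open>t\<close>, which cancels the 1 in the exponent, and the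
  two rates add up to \<open>decay_rate \<theta>\<close>.\<close>

lemma near_diagonal_bound:
  fixes f :: "'a \<times> real \<Rightarrow> real"
  assumes Y: "Young_exponents \<mu> \<beta> \<theta>" and m': "Lp_le \<mu> (\<lambda>x. M x 1) m'" "0 < m'"
    and a: "decay_rate \<mu> < 1" and [measurable]: "f \<in> borel_measurable borel" and C: "C > 0"
    and fb: "AE s in lborel. T \<le> s \<longrightarrow> Lp_le \<beta> (\<lambda>y. f (y, s)) (C * s powr (- (1 + decay_rate \<beta>)))"
    and \<delta>: "0 < \<delta>" "\<delta> \<le> 1 / 2" and t: "0 < t" "T \<le> (1 - \<delta>) * t" and g: "g \<in> dual_ball \<theta>"
  shows "(\<integral>\<^sup>+z. ennreal (\<bar>f z\<bar> * indicator {(1 - \<delta>) * t..<t} (snd z)) *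
            (\<integral>\<^sup>+x. ennreal (\<bar>kernel (x - fst z) (t - snd z)\<bar> * g x) \<partial>lborel) \<partial>lborel)
       \<le> ennreal (m' * C * (2 powr (1 + decay_rate \<beta>) / (1 - decay_rate \<mu>)) * \<delta> powr (1 - decay_rate \<mu>) * t powr (- decay_rate \<theta>))"
    (is "?L \<le> _")
proof -
  note [measurable] = dual_ballD(1)[OF g]
  note g0 = dual_ballD(2)[OF g]
  note dr = decay_rate_Young[OF Y]
  have fm: "f \<in> borel_measurable (borel \<Otimes>\<^sub>M borel)" by (simp add: borel_prod)
  note [measurable] = fm
  let ?N = "\<lambda>y s. ennreal (\<bar>f (y, s)\<bar> * indicator {(1 - \<delta>) * t..<t} s) *
            (\<integral>\<^sup>+x. ennreal (\<bar>kernel (x - y) (t - s)\<bar> * g x) \<partial>lborel)"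
  have "?L = (\<integral>\<^sup>+z. (\<lambda>(y, s). ?N y s) z \<partial>(lborel \<Otimes>\<^sub>M lborel))"
    by (simp add: lborel_prod case_prod_beta)
  also have "\<dots> = (\<integral>\<^sup>+s. \<integral>\<^sup>+y. ?N y s \<partial>lborel \<partial>lborel)"
    by (subst lborel_pair.nn_integral_snd[symmetric]) auto
  also have "\<dots> \<le> (\<integral>\<^sup>+s. ennreal (m' * C) * ennreal ((t - s) powr (- decay_rate \<mu>) * s powr (- (1 + decay_rate \<beta>)) *
      indicator {(1 - \<delta>) * t..t} s) \<partial>lborel)"
  proof (intro nn_integral_mono_AE)
    show "AE s in lborel. (\<integral>\<^sup>+y. ?N y s \<partial>lborel) \<le> ennreal (m' * C) * ennreal ((t - s) powr (- decay_rate \<mu>) * s powr (- (1 + decay_rate \<beta>)) *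
      indicator {(1 - \<delta>) * t..t} s)"
      using fb
    proof eventually_elim
      fix s assume fs: "T \<le> s \<longrightarrow> Lp_le \<beta> (\<lambda>y. f (y, s)) (C * s powr (- (1 + decay_rate \<beta>)))"
      have fsm [measurable]: "(\<lambda>y. f (y, s)) \<in> borel_measurable borel" by measurable
      show "(\<integral>\<^sup>+y. ?N y s \<partial>lborel) \<le> ennreal (m' * C) * ennreal ((t - s) powr (- decay_rate \<mu>) * s powr (- (1 + decay_rate \<beta>)) *
        indicator {(1 - \<delta>) * t..t} s)"
      proof (cases "s \<in> {(1 - \<delta>) * t..<t}")
        case False
        then have "indicator {(1 - \<delta>) * t..<t} s = (0::real)" by (rule indicator_simps)
        then show ?thesis by simp
      next
        case True
        have s: "0 < s" "T \<le> s" using True t \<delta> by (auto intro: less_le_trans[of 0 "(1 - \<delta>) * t"])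
        have ts: "0 < t - s" using True by auto
        have mt [measurable]: "(\<lambda>x. M x (t - s)) \<in> borel_measurable borel" by (rule borel_at_time[OF ts])
        have mu: "0 \<le> \<mu>" using Y by (auto simp: Young_exponents_def)
        have "(\<integral>\<^sup>+y. ?N y s \<partial>lborel) = (\<integral>\<^sup>+y. \<integral>\<^sup>+x. ennreal (\<bar>M (x - y) (t - s)\<bar> * \<bar>f (y, s)\<bar> * g x) \<partial>lborel \<partial>lborel)"
        proof (intro nn_integral_cong)
          fix y
          have [measurable]: "(\<lambda>x. M (x - y) (t - s)) \<in> borel_measurable borel"
            using measurable_compose[of "\<lambda>x. x - y" borel borel, OF _ mt] by simp
          have "?N y s = (\<integral>\<^sup>+x. ennreal \<bar>f (y, s)\<bar> * ennreal (\<bar>M (x - y) (t - s)\<bar> * g x) \<partial>lborel)"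
            using True ts by (subst nn_integral_cmult) (auto simp: kernel_def)
          also have "\<dots> = (\<integral>\<^sup>+x. ennreal (\<bar>M (x - y) (t - s)\<bar> * \<bar>f (y, s)\<bar> * g x) \<partial>lborel)"
            by (simp add: ennreal_mult'[symmetric] mult_ac)
          finally show "?N y s = (\<integral>\<^sup>+x. ennreal (\<bar>M (x - y) (t - s)\<bar> * \<bar>f (y, s)\<bar> * g x) \<partial>lborel)" .
        qed
        also have "\<dots> = (\<integral>\<^sup>+x. \<integral>\<^sup>+y. ennreal (\<bar>M (x - y) (t - s)\<bar> * \<bar>f (y, s)\<bar> * g x) \<partial>lborel \<partial>lborel)"
        proof (rule lborel_pair.Fubini')
          have "(\<lambda>p. M (fst p - snd p) (t - s)) \<in> borel_measurable (borel \<Otimes>\<^sub>M borel)"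
            by (rule measurable_compose[OF _ mt]) simp
          then show "(\<lambda>(x, y). ennreal (\<bar>M (x - y) (t - s)\<bar> * \<bar>f (y, s)\<bar> * g x)) \<in> borel_measurable (lborel \<Otimes>\<^sub>M lborel)"
            by (simp add: case_prod_beta)
        qed
        also have "\<dots> \<le> ennreal ((m' * (t - s) powr (- decay_rate \<mu>)) * (C * s powr (- (1 + decay_rate \<beta>))))"
          using m' mu ts s C fs kernel_Lp[OF m'(1) mu _ ts]
          by (intro Young[OF mt fsm Y _ _ _ _ g]) auto
        also have "\<dots> = ennreal (m' * C) * ennreal ((t - s) powr (- decay_rate \<mu>) * s powr (- (1 + decay_rate \<beta>)) *
            indicator {(1 - \<delta>) * t..t} s)"
          using m' C True by (simp add: ennreal_mult'[symmetric] mult_ac)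
        finally show ?thesis .
      qed
    qed
  qed
  also have "\<dots> = ennreal (m' * C) * (\<integral>\<^sup>+s. ennreal ((t - s) powr (- decay_rate \<mu>) * s powr (- (1 + decay_rate \<beta>)) *
      indicator {(1 - \<delta>) * t..t} s) \<partial>lborel)"
    by (rule nn_integral_cmult) auto
  also have "\<dots> \<le> ennreal (m' * C) * ennreal (2 powr (1 + decay_rate \<beta>) / (1 - decay_rate \<mu>) * \<delta> powr (1 - decay_rate \<mu>) *
      t powr (1 - decay_rate \<mu> - (1 + decay_rate \<beta>)))"
    using dr a \<delta> t by (intro mult_left_mono near_diagonal_integral) auto
  also have "\<dots> = ennreal (m' * C * (2 powr (1 + decay_rate \<beta>) / (1 - decay_rate \<mu>)) * \<delta> powr (1 - decay_rate \<mu>) * t powr (- decay_rate \<theta>))"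
    using m' C dr by (simp add: ennreal_mult'[symmetric] mult_ac algebra_simps)
  finally show ?thesis .
qed

text \<open>The quantifier over \<open>g\<close> stands inside the eventuality because the converse
  of Holder's inequality is applied at each fixed \<open>t\<close>, so the threshold must not depend
  on \<open>g\<close>. The parameters are fixed in the order \<open>\<delta>\<close>,
  \<open>\<eta>\<close>, \<open>\<rho>\<close>, \<open>e\<close>, then \<open>t\<close>; each of the
  three contributions is at most \<open>\<epsilon> / 4\<close>.\<close>

lemma profile_estimate:
  fixes f :: "'a \<times> real \<Rightarrow> real"
  assumes Y: "Young_exponents \<mu> \<beta> \<theta>" and m: "Lp_le \<theta> (\<lambda>x. M x 1) m" "0 < m"
    and m': "Lp_le \<mu> (\<lambda>x. M x 1) m'" "0 < m'" and a: "decay_rate \<mu> < 1"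
    and f: "integrable lborel f" and f0: "\<And>y s. s \<le> 0 \<Longrightarrow> f (y, s) = 0" and C: "C > 0"
    and fb: "AE s in lborel. T \<le> s \<longrightarrow> Lp_le \<beta> (\<lambda>y. f (y, s)) (C * s powr (- (1 + decay_rate \<beta>)))"
    and \<epsilon>: "0 < \<epsilon>"
  shows "\<forall>\<^sub>F t in at_top. \<forall>g\<in>dual_ball \<theta>.
     (\<integral>\<^sup>+x. (\<integral>\<^sup>+z. ennreal (\<bar>kernel (x - fst z) (t - snd z) - M x t\<bar> * \<bar>f z\<bar>) \<partial>lborel) * ennreal (g x) \<partial>lborel)
      \<le> ennreal (\<epsilon> * t powr (- decay_rate \<theta>))"
proof -
  have th: "0 \<le> \<theta>" "\<theta> \<le> 1" using Y by (auto simp: Young_exponents_def)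
  have fm [measurable]: "f \<in> borel_measurable borel" using borel_measurable_integrable[OF f] by simp
  define F where "F = (LINT z|lborel. \<bar>f z\<bar>)"
  have F: "(\<integral>\<^sup>+z. ennreal \<bar>f z\<bar> \<partial>lborel) = ennreal F" "0 \<le> F"
    using f by (auto simp: F_def nn_integral_eq_integral)
  define d where "d = decay_rate \<theta>"
  define B where "B = m' * C * (2 powr (1 + decay_rate \<beta>) / (1 - decay_rate \<mu>))"
  have B: "B > 0" using m' C a by (simp add: B_def)
  \<comment> \<open>Solves \<open>B * \<delta> powr (1 - decay_rate \<mu>) = \<epsilon> / 4\<close>,
    capped at 1/2.\<close>
  define \<delta> where "\<delta> = min (1 / 2) ((\<epsilon> / (4 * B)) powr (1 / (1 - decay_rate \<mu>)))"
  have \<delta>: "0 < \<delta>" "\<delta> \<le> 1 / 2" using \<epsilon> B by (auto simp: \<delta>_def)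
  have B\<delta>: "B * \<delta> powr (1 - decay_rate \<mu>) \<le> \<epsilon> / 4"
  proof -
    have "\<delta> powr (1 - decay_rate \<mu>) \<le> ((\<epsilon> / (4 * B)) powr (1 / (1 - decay_rate \<mu>))) powr (1 - decay_rate \<mu>)"
      using \<delta> a by (intro powr_mono2) (auto simp: \<delta>_def)
    also have "\<dots> = \<epsilon> / (4 * B)" using a \<epsilon> B by (simp add: powr_powr)
    finally show ?thesis using B by (simp add: field_simps)
  qed
  define \<eta> where "\<eta> = \<epsilon> / (4 * (F + 1))"
  have \<eta>: "\<eta> > 0" and \<eta>F: "\<eta> * F \<le> \<epsilon> / 4" using \<epsilon> F by (auto simp: \<eta>_def field_simps)
  obtain \<rho>0 where \<rho>0: "\<rho>0 > 0" and near: "\<And>t y s. t > 0 \<Longrightarrow> norm y \<le> \<rho>0 * sqrt t \<Longrightarrow> 0 \<le> s \<Longrightarrow> s \<le> \<rho>0 * t \<Longrightarrow>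
           Lp_le \<theta> (\<lambda>x. M (x - y) (t - s) - M x t) (\<eta> * t powr (- decay_rate \<theta>))"
    using kernel_near[OF th m(1) \<eta>] by blast
  \<comment> \<open>\<open>\<rho> \<le> 1/3\<close> and \<open>\<delta> \<le> 1/2\<close> put all
    times \<open>s \<ge> (1 - \<delta>) * t\<close> into the exterior set
    \<open>E t\<close>.\<close>
  define \<rho> where "\<rho> = min \<rho>0 (1 / 3)"
  have \<rho>: "\<rho> > 0" "\<rho> \<le> \<rho>0" "\<rho> \<le> 1 / 3" using \<rho>0 by (auto simp: \<rho>_def)
  \<comment> \<open>Bounds the bracket away from the diagonal and also dominates \<open>m\<close>,
    the share of \<open>M(x, t)\<close> alone.\<close>
  define D where "D = m * (\<delta> powr (- d) + 1)"
  have D: "D > 0" "m \<le> D" using m by (auto simp: D_def add_nonneg_pos)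
  define e where "e = \<epsilon> / (4 * D)"
  have e: "e > 0" "D * e = \<epsilon> / 4" using \<epsilon> D by (auto simp: e_def)
  define E where "E t = {(y :: 'a, s). \<rho> * sqrt t < norm y \<or> \<rho> * t < s}" for t
  have [measurable]: "E t \<in> sets borel" for t unfolding E_def by (rule parabolic_exterior_borel)
  have "\<forall>\<^sub>F t in at_top. (\<integral>\<^sup>+z. ennreal (\<bar>f z\<bar> * indicator (E t) z) \<partial>lborel) \<le> ennreal e"
    unfolding E_def by (rule parabolic_tail[OF f \<rho>(1) e(1)])
  moreover have "\<forall>\<^sub>F t in at_top. max 1 (2 * T) \<le> t" by (rule eventually_ge_at_top)
  ultimately show ?thesis
  proof eventually_elim
    case (elim t)
    then have t: "0 < t" and tT: "2 * T \<le> t" by auto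
    have "T \<le> (1 - \<delta>) * t"
    proof -
      have "T \<le> (1 / 2) * t" using tT by simp
      also have "\<dots> \<le> (1 - \<delta>) * t" using \<delta> t by (intro mult_right_mono) auto
      finally show ?thesis .
    qed
    note tt = t this
    have [measurable]: "(\<lambda>x. M x t) \<in> borel_measurable borel" by (rule borel_at_time[OF t])
    show ?case
    proof
      fix g :: "'a \<Rightarrow> real" assume g: "g \<in> dual_ball \<theta>"
      note [measurable] = dual_ballD(1)[OF g]
      note g0 = dual_ballD(2)[OF g]
      let ?k = "\<lambda>x z. \<bar>kernel (x - fst z) (t - snd z) - M x t\<bar>"
      let ?P = "\<lambda>z. (\<integral>\<^sup>+x. ennreal (\<bar>kernel (x - fst z) (t - snd z)\<bar> * g x) \<partial>lborel)"
      let ?tp = "t powr (- d)"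
      have pt: "ennreal \<bar>f z\<bar> * (\<integral>\<^sup>+x. ennreal (?k x z * g x) \<partial>lborel) \<le>
          ennreal (\<eta> * ?tp) * ennreal \<bar>f z\<bar> + (ennreal (D * ?tp) * ennreal (\<bar>f z\<bar> * indicator (E t) z) +
           ennreal (\<bar>f z\<bar> * indicator {(1 - \<delta>) * t..<t} (snd z)) * ?P z)" (is "_ \<le> ?a + (?b + ?c)") for z
      proof -
        obtain y s where z: "z = (y, s)" by (cases z)
        \<comment> \<open>In the fourth region the kernel is charged to \<open>?c\<close> and the
          subtracted \<open>M(x, t)\<close> to \<open>?b\<close>. In the fifth the kernel is zero
          and only \<open>M(x, t)\<close> remains.\<close>
        consider "s \<le> 0" | "0 < s" "z \<notin> E t" | "0 < s" "z \<in> E t" "s < (1 - \<delta>) * t" | "(1 - \<delta>) * t \<le> s" "s < t" | "t \<le> s"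
          by linarith
        then show ?thesis
        proof cases
          case 1
          then show ?thesis using f0[of s y] z by simp
        next
          case 2
          then have ys: "norm y \<le> \<rho> * sqrt t" "s \<le> \<rho> * t" by (auto simp: E_def z)
          have "\<rho> * sqrt t \<le> \<rho>0 * sqrt t" "\<rho> * t \<le> \<rho>0 * t" "\<rho> * t \<le> 1 / 3 * t"
            using \<rho> t by (auto intro!: mult_right_mono)
          with ys t have ys': "norm y \<le> \<rho>0 * sqrt t" "s \<le> \<rho>0 * t" "s < t" by linarith+
          have "(\<integral>\<^sup>+x. ennreal (?k x z * g x) \<partial>lborel) = (\<integral>\<^sup>+x. ennreal (\<bar>M (x - y) (t - s) - M x t\<bar> * g x) \<partial>lborel)"
            using ys' by (simp add: kernel_def z)
          also have "\<dots> \<le> ennreal (\<eta> * ?tp)"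
          proof (rule Holder[OF _ th _ _ g])
            show "(\<lambda>x. M (x - y) (t - s) - M x t) \<in> borel_measurable borel"
              using measurable_compose[OF _ borel_at_time[of "t - s"], of "\<lambda>x. x - y" borel] ys' by simp
          qed (use near[OF t ys'(1) _ ys'(2)] 2 \<eta> in \<open>auto simp: d_def\<close>)
          finally have "ennreal \<bar>f z\<bar> * (\<integral>\<^sup>+x. ennreal (?k x z * g x) \<partial>lborel) \<le> ennreal \<bar>f z\<bar> * ennreal (\<eta> * ?tp)"
            by (rule mult_left_mono) simp
          also have "\<dots> = ?a" by (rule mult.commute)
          also have "\<dots> \<le> ?a + (?b + ?c)" by simp
          finally show ?thesis .
        next
          case 3
          have "(\<integral>\<^sup>+x. ennreal (?k x z * g x) \<partial>lborel) \<le> ennreal (D * ?tp)"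
            using kernel_difference_bound(2)[OF th m g t, of \<delta> s y] 3 \<delta> by (simp add: z D_def d_def algebra_simps)
          then have "ennreal \<bar>f z\<bar> * (\<integral>\<^sup>+x. ennreal (?k x z * g x) \<partial>lborel) \<le> ennreal \<bar>f z\<bar> * ennreal (D * ?tp)"
            by (rule mult_left_mono) simp
          also have "\<dots> = ?b" using 3 by (simp add: mult.commute)
          also have "\<dots> \<le> ?a + (?b + ?c)" by (simp add: add_increasing add_increasing2)
          finally show ?thesis .
        next
          case 4
          have "\<rho> * t < s"
          proof -
            have "\<rho> * t \<le> 1 / 3 * t" using \<rho> t by (intro mult_right_mono) auto
            also have "\<dots> < 1 / 2 * t" using t by simp
            also have "\<dots> \<le> (1 - \<delta>) * t" using \<delta> t by (intro mult_right_mono) auto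
            finally show ?thesis using 4 by simp
          qed
          then have zE: "z \<in> E t" by (simp add: E_def z)
          have "(\<integral>\<^sup>+x. ennreal (?k x z * g x) \<partial>lborel) \<le> ?P z + ennreal (m * ?tp)"
            using kernel_difference_bound(1)[OF th m g t, of y s] by (simp add: z d_def)
          also have "\<dots> \<le> ?P z + ennreal (D * ?tp)"
            using D by (intro add_left_mono ennreal_leI mult_right_mono) auto
          finally have "ennreal \<bar>f z\<bar> * (\<integral>\<^sup>+x. ennreal (?k x z * g x) \<partial>lborel) \<le> ennreal \<bar>f z\<bar> * (?P z + ennreal (D * ?tp))"
            by (rule mult_left_mono) simp
          also have "\<dots> = ?b + ?c" using zE 4 by (simp add: distrib_left mult.commute add.commute z)
          also have "\<dots> \<le> ?a + (?b + ?c)" by simp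
          finally show ?thesis .
        next
          case 5
          have "\<rho> * t \<le> 1 / 3 * t" using \<rho> t by (intro mult_right_mono) auto
          then have "\<rho> * t < s" using 5 t by linarith
          then have zE: "z \<in> E t" by (simp add: E_def z)
          have "(\<integral>\<^sup>+x. ennreal (?k x z * g x) \<partial>lborel) \<le> ?P z + ennreal (m * ?tp)"
            using kernel_difference_bound(1)[OF th m g t, of y s] by (simp add: z d_def)
          also have "?P z = 0" using 5 by (simp add: z kernel_def)
          also have "0 + ennreal (m * ?tp) \<le> ennreal (D * ?tp)"
            using D by (simp add: ennreal_leI mult_right_mono)
          finally have "ennreal \<bar>f z\<bar> * (\<integral>\<^sup>+x. ennreal (?k x z * g x) \<partial>lborel) \<le> ennreal \<bar>f z\<bar> * ennreal (D * ?tp)"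
            by (rule mult_left_mono) simp
          also have "\<dots> = ?b" using zE by (simp add: mult.commute)
          also have "\<dots> \<le> ?a + (?b + ?c)" by (simp add: add_increasing add_increasing2)
          finally show ?thesis .
        qed
      qed
      have "(\<integral>\<^sup>+x. (\<integral>\<^sup>+z. ennreal (?k x z * \<bar>f z\<bar>) \<partial>lborel) * ennreal (g x) \<partial>lborel)
          = (\<integral>\<^sup>+x. \<integral>\<^sup>+z. ennreal \<bar>f z\<bar> * ennreal (?k x z * g x) \<partial>lborel \<partial>lborel)"
        by (subst nn_integral_multc[symmetric]) (auto simp: ennreal_mult'[symmetric] g0 mult_ac intro!: nn_integral_cong)
      also have "\<dots> = (\<integral>\<^sup>+z. \<integral>\<^sup>+x. ennreal \<bar>f z\<bar> * ennreal (?k x z * g x) \<partial>lborel \<partial>lborel)"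
        by (rule lborel_pair.Fubini') simp
      also have "\<dots> = (\<integral>\<^sup>+z. ennreal \<bar>f z\<bar> * (\<integral>\<^sup>+x. ennreal (?k x z * g x) \<partial>lborel) \<partial>lborel)"
        by (simp add: nn_integral_cmult)
      also have "\<dots> \<le> (\<integral>\<^sup>+z. ennreal (\<eta> * ?tp) * ennreal \<bar>f z\<bar> + (ennreal (D * ?tp) * ennreal (\<bar>f z\<bar> * indicator (E t) z) +
           ennreal (\<bar>f z\<bar> * indicator {(1 - \<delta>) * t..<t} (snd z)) * ?P z) \<partial>lborel)"
        by (intro nn_integral_mono pt)
      also have "\<dots> = ennreal (\<eta> * ?tp) * ennreal F + (ennreal (D * ?tp) * (\<integral>\<^sup>+z. ennreal (\<bar>f z\<bar> * indicator (E t) z) \<partial>lborel) +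
           (\<integral>\<^sup>+z. ennreal (\<bar>f z\<bar> * indicator {(1 - \<delta>) * t..<t} (snd z)) * ?P z \<partial>lborel))"
        by (simp add: nn_integral_add nn_integral_cmult F(1))
      also have "\<dots> \<le> ennreal (\<eta> * ?tp) * ennreal F + (ennreal (D * ?tp) * ennreal e + ennreal (B * \<delta> powr (1 - decay_rate \<mu>) * ?tp))"
        using elim near_diagonal_bound[OF Y m' a fm C fb \<delta> tt g]
        by (intro add_left_mono add_mono mult_left_mono) (auto simp: B_def d_def)
      also have "\<dots> = ennreal ((\<eta> * F + D * e + B * \<delta> powr (1 - decay_rate \<mu>)) * ?tp)"
        using \<eta> F D e B by (simp add: ennreal_mult'[symmetric] ennreal_plus[symmetric] algebra_simps del: ennreal_plus)
      also have "\<dots> \<le> ennreal (\<epsilon> * ?tp)"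
        using \<eta>F e B\<delta> \<epsilon> by (intro ennreal_leI mult_right_mono) auto
      finally show "(\<integral>\<^sup>+x. (\<integral>\<^sup>+z. ennreal (?k x z * \<bar>f z\<bar>) \<partial>lborel) * ennreal (g x) \<partial>lborel) \<le> ennreal (\<epsilon> * t powr (- decay_rate \<theta>))"
        by (simp add: d_def)
    qed
  qed
qed

end

section \<open>From Lebesgue to Borel measurable sources\<close>

lemma lebesgue_borel_version:
  fixes u v :: "'a::euclidean_space \<Rightarrow> real"
  assumes u: "u \<in> borel_measurable borel" and eq: "AE x in lborel. v x = u x"
  shows "v \<in> borel_measurable lebesgue"
    and "(LINT x|lebesgue. v x) = (LINT x|lborel. u x)"
    and "integrable lebesgue v \<longleftrightarrow> integrable lborel u"
proof -
  have ul: "u \<in> borel_measurable lborel" "u \<in> borel_measurable lebesgue"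
    using u by (auto intro: measurable_completion)
  have eq': "AE x in lebesgue. u x = v x" using eq by (auto simp: AE_completion_iff elim: eventually_mono)
  show v: "v \<in> borel_measurable lebesgue" by (rule borel_measurable_AE[OF ul(2) eq'])
  have "(LINT x|lebesgue. v x) = (LINT x|lebesgue. u x)"
    using eq' v ul by (intro integral_cong_AE) (auto elim: eventually_mono)
  then show "(LINT x|lebesgue. v x) = (LINT x|lborel. u x)" by (simp add: integral_completion[OF ul(1)])
  have "integrable lebesgue v \<longleftrightarrow> integrable lebesgue u"
    using eq' v ul by (intro integrable_cong_AE) (auto elim: eventually_mono)
  then show "integrable lebesgue v \<longleftrightarrow> integrable lborel u" by (simp add: integrable_completion[OF ul(1)])
qed

text \<open>Passage between extended norms and \<open>Lp_le\<close>; for \<open>q = top\<close> the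
  reciprocal is zero, which selects the essential bound on both sides.\<close>

lemma Lp_norm_le_iff:
  fixes g :: "'a::euclidean_space \<Rightarrow> real"
  assumes g: "g \<in> borel_measurable lebesgue" and q: "1 \<le> q" and A: "0 \<le> A"
  shows "Lp_norm q g \<le> ennreal A \<longleftrightarrow> Lp_le (enn2real (1 / q)) g A"
proof (cases q)
  case top
  have m: "(\<lambda>x. ennreal \<bar>g x\<bar>) \<in> borel_measurable lebesgue" using g by measurable
  have "esssup lebesgue (\<lambda>x. ennreal \<bar>g x\<bar>) \<le> ennreal A \<longleftrightarrow> (AE x in lebesgue. ennreal \<bar>g x\<bar> \<le> ennreal A)"
  proof
    assume le: "esssup lebesgue (\<lambda>x. ennreal \<bar>g x\<bar>) \<le> ennreal A"
    show "AE x in lebesgue. ennreal \<bar>g x\<bar> \<le> ennreal A"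
      using esssup_AE[of "\<lambda>x. ennreal \<bar>g x\<bar>" lebesgue] by eventually_elim (use le in auto)
  next
    assume "AE x in lebesgue. ennreal \<bar>g x\<bar> \<le> ennreal A"
    then show "esssup lebesgue (\<lambda>x. ennreal \<bar>g x\<bar>) \<le> ennreal A" by (rule esssup_I[OF m])
  qed
  then show ?thesis using g A top by (simp add: Lp_norm_def Lp_le_def AE_completion_iff)
next
  case (real r)
  then have r: "1 \<le> r" using q by simp
  have th: "enn2real (1 / q) = 1 / r"
    using real r divide_ennreal[of 1 r] by simp
  define I where "I = (\<integral>\<^sup>+x. ennreal (\<bar>g x\<bar> powr r) \<partial>lebesgue)"
  have I: "I = (\<integral>\<^sup>+x. ennreal (\<bar>g x\<bar> powr r) \<partial>lborel)" by (simp add: I_def nn_integral_completion)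
  have N: "Lp_norm q g = (if I = top then top else ennreal (enn2real I powr (1 / r)))"
    using g real r by (simp add: Lp_norm_def I_def Let_def)
  have "Lp_norm q g \<le> ennreal A \<longleftrightarrow> I \<le> ennreal (A powr r)"
  proof (cases I)
    case top
    then show ?thesis by (simp add: N top_unique)
  next
    case (real i)
    have "i powr (1 / r) \<le> A \<longleftrightarrow> i \<le> A powr r"
    proof
      assume "i powr (1 / r) \<le> A"
      then have "(i powr (1 / r)) powr r \<le> A powr r" using r by (intro powr_mono2) auto
      then show "i \<le> A powr r" using r real by (simp add: powr_powr)
    next
      assume "i \<le> A powr r"
      then have "i powr (1 / r) \<le> (A powr r) powr (1 / r)" using r real by (intro powr_mono2) auto
      then show "i powr (1 / r) \<le> A" using r A by (simp add: powr_powr)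
    qed
    then show ?thesis using real A by (simp add: N)
  qed
  then show ?thesis using r by (simp add: Lp_le_def th I)
qed

lemma Lp_norm_finite_measurable: "Lp_norm q g \<le> ennreal A \<Longrightarrow> g \<in> borel_measurable lebesgue"
  by (auto simp: Lp_norm_def top_unique split: if_splits)

text \<open>Both forms of almost-everywhere agreement are kept: on space-time for the integrability
  of the integrand of \<open>Phi\<close>, and on almost every time slice for the norms of
  \<open>f\<close> and the iterated integrals in \<open>mass\<close> and \<open>Phi\<close>.
  Vanishing at nonpositive times removes the restriction on \<open>s\<close> from all later
  integrals.\<close>

definition representative :: "('a::euclidean_space \<Rightarrow> real \<Rightarrow> real) \<Rightarrow> ('a \<times> real \<Rightarrow> real) \<Rightarrow> bool" where
  "representative f F \<longleftrightarrow> integrable lborel F \<and> (\<forall>y s. s \<le> 0 \<longrightarrow> F (y, s) = 0) \<and>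
     (AE z in lborel. 0 < snd z \<longrightarrow> f (fst z) (snd z) = F z) \<and>
     (AE s in lborel. 0 < s \<longrightarrow> (AE y in lborel. f y s = F (y, s)))"

lemma borel_representative:
  fixes f :: "'a::euclidean_space \<Rightarrow> real \<Rightarrow> real"
  assumes "set_integrable lebesgue (UNIV \<times> {0<..}) (\<lambda>(y, s). f y s)"
  shows "\<exists>F. representative f F"
proof -
  define S where "S = (UNIV :: 'a set) \<times> {0::real<..}"
  have S: "S \<in> sets borel" unfolding S_def by (intro borel_open open_Times) auto
  define h where "h z = indicator S z * f (fst z) (snd z)" for z :: "'a \<times> real"
  have h: "integrable lebesgue h"
    using assms by (simp add: set_integrable_def h_def[abs_def] S_def case_prod_beta)
  obtain G where G: "G \<in> borel_measurable lborel" "AE z in lborel. h z = G z"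
    using completion_ex_borel_measurable_real[of h lborel] borel_measurable_integrable[OF h] by auto
  define F where "F z = indicator S z * G z" for z
  have Fm: "F \<in> borel_measurable borel" using G S by (simp add: F_def[abs_def])
  have ae: "AE z in lborel. h z = F z"
    using G(2) by eventually_elim (auto simp: F_def h_def indicator_def)
  have "representative f F"
    unfolding representative_def
  proof (intro conjI allI impI)
    show "integrable lborel F" using lebesgue_borel_version(3)[OF Fm ae] h by simp
    show "F (y, s) = 0" if "s \<le> 0" for y s using that by (simp add: F_def S_def)
    show ae': "AE z in lborel. 0 < snd z \<longrightarrow> f (fst z) (snd z) = F z"
      using ae by eventually_elim (auto simp: h_def S_def indicator_def)
    \<comment> \<open>The exceptional set is enclosed in a Borel null set \<open>N\<close>, for
      whose slices the almost-everywhere quantifiers in \<open>y\<close> and \<open>s\<close> can be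
      exchanged.\<close>
    obtain N where N: "{z \<in> space lborel. \<not> (0 < snd z \<longrightarrow> f (fst z) (snd z) = F z)} \<subseteq> N" "emeasure lborel N = 0"
        "N \<in> sets lborel"
      by (rule AE_E[OF ae'])
    have "N \<in> null_sets (lborel :: ('a \<times> real) measure)" using N(2,3) by (rule null_setsI)
    then have "AE z in lborel. z \<notin> N" by (rule AE_not_in)
    then have "AE z in ((lborel :: 'a measure) \<Otimes>\<^sub>M (lborel :: real measure)). z \<notin> N"
      unfolding lborel_prod .
    then have "AE y in lborel. AE s in lborel. (y, s) \<notin> N" by (rule lborel_pair.AE_pair)
    moreover have "{z \<in> space ((lborel :: 'a measure) \<Otimes>\<^sub>M (lborel :: real measure)). (fst z, snd z) \<notin> N}
        \<in> sets ((lborel :: 'a measure) \<Otimes>\<^sub>M (lborel :: real measure))"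
    proof -
      have "{z \<in> space ((lborel :: 'a measure) \<Otimes>\<^sub>M (lborel :: real measure)). (fst z, snd z) \<notin> N} = - N" by (auto simp: space_pair_measure)
      moreover have "- N \<in> sets lborel" using N(3) by simp
      ultimately show ?thesis by (simp only: lborel_prod)
    qed
    ultimately have "AE s in lborel. AE y in lborel. (y, s) \<notin> N"
      using lborel_pair.AE_commute[of "\<lambda>y s. (y, s) \<notin> N"] by blast
    then show "AE s in lborel. 0 < s \<longrightarrow> (AE y in lborel. f y s = F (y, s))"
    proof eventually_elim
      case (elim s)
      show ?case
      proof
        assume "0 < s"
        show "AE y in lborel. f y s = F (y, s)"
          using elim by eventually_elim (use N(1) \<open>0 < s\<close> in force)
      qed
    qed
  qed
  then show ?thesis by blast
qed

lemma iterated_lebesgue_integral: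
  fixes \<phi> :: "'a::euclidean_space \<times> real \<Rightarrow> real"
  assumes [measurable]: "\<phi> \<in> borel_measurable borel"
    and eq: "AE s in lborel. s \<in> S \<longrightarrow> (AE y in lborel. \<psi> y s = \<phi> (y, s))"
    and zero: "\<And>y s. s \<notin> S \<Longrightarrow> \<phi> (y, s) = 0"
  shows "(LINT s:S|lebesgue. (LINT y|lebesgue. \<psi> y s)) = (LINT s|lborel. (LINT y|lborel. \<phi> (y, s)))"
proof -
  have phi: "\<phi> \<in> borel_measurable (borel \<Otimes>\<^sub>M borel)" by (simp add: borel_prod)
  note [measurable] = phi
  show ?thesis
    unfolding set_lebesgue_integral_def
  proof (rule lebesgue_borel_version(2))
    show "(\<lambda>s. LINT y|lborel. \<phi> (y, s)) \<in> borel_measurable borel"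
      by (rule lborel.borel_measurable_lebesgue_integral[of "\<lambda>s y. \<phi> (y, s)", simplified]) simp
    show "AE s in lborel. indicator S s *\<^sub>R (LINT y|lebesgue. \<psi> y s) = (LINT y|lborel. \<phi> (y, s))"
      using eq
    proof eventually_elim
      case (elim s)
      have [measurable]: "(\<lambda>y. \<phi> (y, s)) \<in> borel_measurable borel" by measurable
      show ?case
      proof (cases "s \<in> S")
        case True
        then show ?thesis using elim lebesgue_borel_version(2)[of "\<lambda>y. \<phi> (y, s)" "\<lambda>y. \<psi> y s"] by simp
      qed (simp add: zero)
    qed
  qed
qed

section \<open>Test functions supported in balls\<close>

lemma dual_ball_indicator:
  fixes B :: "'a::euclidean_space set"
  assumes B: "B \<in> sets borel" "emeasure lborel B < \<infinity>" and th: "0 \<le> \<theta>" "\<theta> \<le> 1"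
  obtains c where "c > 0" "(\<lambda>x. c * indicator B x) \<in> dual_ball \<theta>"
proof -
  define V where "V = measure lborel B"
  have V: "emeasure lborel B = ennreal V" "0 \<le> V"
    using B by (auto simp: V_def emeasure_eq_ennreal_measure)
  \<comment> \<open>\<open>c \<le> 1\<close> gives \<open>c powr p \<le> c\<close> for every
    conjugate exponent \<open>p \<ge> 1\<close>, so \<open>c * V \<le> 1\<close> suffices for all
    finite \<open>p\<close>; the summand 1 also covers \<open>V = 0\<close>.\<close>
  define c where "c = 1 / (V + 1)"
  have c: "0 < c" "c \<le> 1" "c * V \<le> 1" using V by (auto simp: c_def field_simps)
  have "Lp_le (1 - \<theta>) (\<lambda>x. c * indicator B x) 1"
  proof (cases "1 - \<theta> = 0")
    case True
    then show ?thesis using c by (auto simp: Lp_le_def indicator_def)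
  next
    case False
    then have p: "1 \<le> 1 / (1 - \<theta>)" using th by simp
    have "(\<integral>\<^sup>+x. ennreal (\<bar>c * indicator B x\<bar> powr (1 / (1 - \<theta>))) \<partial>lborel) \<le> (\<integral>\<^sup>+x. ennreal c * indicator B x \<partial>lborel)"
    proof (intro nn_integral_mono)
      fix x
      have "c powr (1 / (1 - \<theta>)) \<le> c powr 1" using c p by (intro powr_mono') auto
      then show "ennreal (\<bar>c * indicator B x\<bar> powr (1 / (1 - \<theta>))) \<le> ennreal c * indicator B x"
        using c by (auto simp: indicator_def intro!: ennreal_leI)
    qed
    also have "\<dots> = ennreal (c * V)" using B V c by (simp add: nn_integral_cmult_indicator ennreal_mult)
    also have "\<dots> \<le> 1" using c by simp
    finally show ?thesis using False by (simp add: Lp_le_def)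
  qed
  then have "(\<lambda>x. c * indicator B x) \<in> dual_ball \<theta>"
    using B c by (auto simp: dual_ball_def)
  then show ?thesis using that c by blast
qed

text \<open>Pairing with multiples of ball indicators makes \<open>U\<close> integrable on every
  ball, hence finite almost everywhere. This is the source of the convergence of the integral
  defining \<open>Phi\<close>.\<close>

lemma finite_AE_of_dual:
  fixes U :: "'a::euclidean_space \<Rightarrow> ennreal"
  assumes [measurable]: "U \<in> borel_measurable borel" and th: "0 \<le> \<theta>" "\<theta> \<le> 1"
    and dual: "\<And>g. g \<in> dual_ball \<theta> \<Longrightarrow> (\<integral>\<^sup>+x. U x * ennreal (g x) \<partial>lborel) \<le> ennreal A"
  shows "AE x in lborel. U x < \<infinity>"
proof -
  have "AE x in lborel. x \<in> ball 0 (real k) \<longrightarrow> U x \<noteq> \<infinity>" for k :: nat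
  proof -
    have B: "ball (0::'a) (real k) \<in> sets borel" by simp
    note [measurable] = B
    obtain c where c: "c > 0" "(\<lambda>x. c * indicator (ball (0::'a) (real k)) x) \<in> dual_ball \<theta>"
      using dual_ball_indicator[OF B emeasure_lborel_ball_finite th] by blast
    have "(\<integral>\<^sup>+x. U x * ennreal (c * indicator (ball (0::'a) (real k)) x) \<partial>lborel) \<noteq> \<infinity>"
      using dual[OF c(2)] by (auto simp: top_unique)
    then have "AE x in lborel. U x * ennreal (c * indicator (ball (0::'a) (real k)) x) \<noteq> \<infinity>"
      by (intro nn_integral_PInf_AE) auto
    then show ?thesis
      by eventually_elim (use c in \<open>auto simp: ennreal_mult_eq_top_iff\<close>)
  qed
  then have "AE x in lborel. \<forall>k::nat. x \<in> ball 0 (real k) \<longrightarrow> U x \<noteq> \<infinity>"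
    unfolding AE_all_countable by blast
  then show ?thesis
  proof eventually_elim
    case (elim x)
    obtain k :: nat where "norm x < real k" using reals_Archimedean2 by blast
    then show ?case using elim by (auto simp: less_top)
  qed
qed

context self_similar_kernel
begin

text \<open>Continuity keeps \<open>|M(1)|\<close> above a positive constant on a ball, the
  indicator of the ball detects this in the norm, and self-similarity carries the bound to every
  \<open>t\<close> with the same \<open>c\<close>. The negated form remains meaningful when the norm
  is infinite.\<close>

lemma profile_norm_lower_bound:
  assumes nz: "M x0 t0 \<noteq> 0" "t0 > 0" and th: "0 \<le> \<theta>" "\<theta> \<le> 1"
  shows "\<exists>c>0. \<forall>t>0. \<not> Lp_le \<theta> (\<lambda>x. M x t) (c * t powr (- decay_rate \<theta>))"
proof -
  define x1 where "x1 = (1 / sqrt t0) *\<^sub>R x0"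
  have M1: "M x1 1 \<noteq> 0" using nz self_similar[of t0 x0] by (auto simp: x1_def)
  define \<kappa> where "\<kappa> = \<bar>M x1 1\<bar> / 2"
  have \<kappa>: "\<kappa> > 0" using M1 by (simp add: \<kappa>_def)
  have "open {x. \<kappa> < \<bar>M x 1\<bar>}"
    using continuous_at_time[of 1] by (intro open_Collect_less continuous_intros) auto
  moreover have "x1 \<in> {x. \<kappa> < \<bar>M x 1\<bar>}" using M1 by (simp add: \<kappa>_def)
  ultimately obtain r where r: "r > 0" "ball x1 r \<subseteq> {x. \<kappa> < \<bar>M x 1\<bar>}"
    by (meson openE)
  have B: "ball x1 r \<in> sets borel" by simp
  obtain e where e: "e > 0" "(\<lambda>x. e * indicator (ball x1 r) x) \<in> dual_ball \<theta>"
    using dual_ball_indicator[OF B emeasure_lborel_ball_finite th] by blast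
  define V where "V = measure lborel (ball x1 r)"
  have V: "emeasure lborel (ball x1 r) = ennreal V" "V > 0"
    using r content_ball_pos[OF r(1), of x1] emeasure_lborel_ball_finite[of x1 r]
    by (auto simp: V_def emeasure_eq_ennreal_measure less_top)
  \<comment> \<open>Half of what the pairing yields, so that a norm bound by \<open>c\<close> is
    contradicted strictly.\<close>
  define c where "c = \<kappa> * e * V / 2"
  have c: "c > 0" using \<kappa> e V by (simp add: c_def)
  have not1: "\<not> Lp_le \<theta> (\<lambda>x. M x 1) c"
  proof
    assume "Lp_le \<theta> (\<lambda>x. M x 1) c"
    then have "(\<integral>\<^sup>+x. ennreal (\<bar>M x 1\<bar> * (e * indicator (ball x1 r) x)) \<partial>lborel) \<le> ennreal c"
      using c by (intro Holder[OF _ th _ _ e(2)]) auto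
    moreover have "(\<integral>\<^sup>+x. ennreal (\<kappa> * e) * indicator (ball x1 r) x \<partial>lborel)
        \<le> (\<integral>\<^sup>+x. ennreal (\<bar>M x 1\<bar> * (e * indicator (ball x1 r) x)) \<partial>lborel)"
      using r e by (intro nn_integral_mono) (auto simp: indicator_def subset_iff intro!: ennreal_leI mult_right_mono less_imp_le)
    moreover have "(\<integral>\<^sup>+x. ennreal (\<kappa> * e) * indicator (ball x1 r) x \<partial>lborel) = ennreal (2 * c)"
      using \<kappa> e V by (simp add: nn_integral_cmult_indicator c_def ennreal_mult'[symmetric])
    ultimately have "ennreal (2 * c) \<le> ennreal c" by simp
    then show False using c by simp
  qed
  show ?thesis
  proof (intro exI[of _ c] conjI allI impI c notI)
    fix t :: real assume t: "0 < t" and L: "Lp_le \<theta> (\<lambda>x. M x t) (c * t powr (- decay_rate \<theta>))"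
    have "Lp_le \<theta> (\<lambda>x. M (0 + sqrt t *\<^sub>R x) t) (c * t powr (- decay_rate \<theta>) * sqrt t powr (- (real DIM('a) * \<theta>)))"
      using L t th c by (intro Lp_le_affine[where t=0 and u="\<lambda>x. M x t"]) auto
    then have "Lp_le \<theta> (\<lambda>x. t powr (real DIM('a) / 2) * M (sqrt t *\<^sub>R x) t)
        (t powr (real DIM('a) / 2) * (c * t powr (- decay_rate \<theta>) * sqrt t powr (- (real DIM('a) * \<theta>))))"
    proof (subst Lp_le_cmult)
      show "(\<lambda>x. M (sqrt t *\<^sub>R x) t) \<in> borel_measurable borel"
        using measurable_compose[OF _ borel_at_time[OF t], of "\<lambda>x. sqrt t *\<^sub>R x" borel] by simp
    qed (use t th c in auto)
    moreover have "t powr (real DIM('a) / 2) * M (sqrt t *\<^sub>R x) t = M x 1" for x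
      using t self_similar[OF t, of "sqrt t *\<^sub>R x"] by (simp add: powr_minus)
    moreover have "t powr (real DIM('a) / 2) * (c * t powr (- decay_rate \<theta>) * sqrt t powr (- (real DIM('a) * \<theta>))) = c"
    proof -
      have "t powr (real DIM('a) / 2) * t powr (- decay_rate \<theta>) * sqrt t powr (- (real DIM('a) * \<theta>))
          = t powr (real DIM('a) / 2 + - decay_rate \<theta> + - (real DIM('a) * \<theta>) / 2)"
        unfolding powr_add using t by (simp add: powr_half_sqrt[symmetric] powr_powr)
      also have "real DIM('a) / 2 + - decay_rate \<theta> + - (real DIM('a) * \<theta>) / 2 = 0"
        by (simp add: decay_rate_def field_simps)
      finally show ?thesis using t by (simp add: mult_ac)
    qed
    ultimately show False using not1 by simp
  qed
qed

end

section \<open>Transfer of the estimates to \<open>mass\<close> and \<open>Phi\<close>\<close>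

lemma representativeD:
  assumes "representative f F"
  shows "integrable lborel F" "\<And>y s. s \<le> 0 \<Longrightarrow> F (y, s) = 0"
    "AE z in lborel. 0 < snd z \<longrightarrow> f (fst z) (snd z) = F z"
    "AE s in lborel. 0 < s \<longrightarrow> (AE y in lborel. f y s = F (y, s))"
    "F \<in> borel_measurable borel" "F \<in> borel_measurable (borel \<Otimes>\<^sub>M borel)"
  using assms borel_measurable_integrable[of lborel F] by (auto simp: representative_def borel_prod)

lemma mass_representative:
  fixes f :: "real^'n \<Rightarrow> real \<Rightarrow> real"
  assumes "representative f F"
  shows "mass f = (LINT z|lborel. F z)"
proof -
  note F = representativeD[OF assms]
  have "mass f = (LINT s|lborel. (LINT y|lborel. F (y, s)))"
    unfolding mass_def using F by (intro iterated_lebesgue_integral) auto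
  also have "\<dots> = integral\<^sup>L (lborel \<Otimes>\<^sub>M lborel) (case_prod (\<lambda>y s. F (y, s)))"
    using F(1) by (intro lborel_pair.integral_snd) (simp add: lborel_prod)
  finally show ?thesis by (simp add: lborel_prod)
qed

text \<open>\<open>h\<close> needs to be a power only at positive times, so that the rates
  \<open>1 / t\<close> and \<open>t powr e\<close> are both covered.\<close>

lemma Lp_norm_representative:
  fixes f :: "real^'n \<Rightarrow> real \<Rightarrow> real"
  assumes rep: "representative f F" and q: "1 \<le> q"
    and bigo: "norm_bigo_ae (\<lambda>t. Lp_norm q (\<lambda>x. f x t)) h" and h: "\<And>t. 0 < t \<Longrightarrow> h t = t powr e"
  shows "\<exists>C>0. \<exists>T. AE s in lborel. T \<le> s \<longrightarrow> 0 < s \<and> Lp_le (enn2real (1 / q)) (\<lambda>y. F (y, s)) (C * s powr e)"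
proof -
  note F = representativeD[OF rep]
  obtain C T where CT: "AE t in lebesgue. T \<le> t \<longrightarrow> Lp_norm q (\<lambda>x. f x t) \<le> ennreal (C * h t)"
    using bigo by (auto simp: norm_bigo_ae_def)
  have "AE s in lborel. max T 1 \<le> s \<longrightarrow> 0 < s \<and> Lp_le (enn2real (1 / q)) (\<lambda>y. F (y, s)) ((\<bar>C\<bar> + 1) * s powr e)"
    using CT[unfolded AE_completion_iff] F(4)
  proof eventually_elim
    case (elim s)
    show ?case
    proof
      assume s: "max T 1 \<le> s"
      then have s0: "0 < s" by simp
      have "Lp_norm q (\<lambda>x. f x s) \<le> ennreal (C * s powr e)" using elim s h[OF s0] by simp
      also have "\<dots> \<le> ennreal ((\<bar>C\<bar> + 1) * s powr e)" by (intro ennreal_leI mult_right_mono) auto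
      finally have N: "Lp_norm q (\<lambda>x. f x s) \<le> ennreal ((\<bar>C\<bar> + 1) * s powr e)" .
      then have L: "Lp_le (enn2real (1 / q)) (\<lambda>x. f x s) ((\<bar>C\<bar> + 1) * s powr e)"
        using Lp_norm_le_iff[OF Lp_norm_finite_measurable[OF N] q, of "(\<bar>C\<bar> + 1) * s powr e"] by simp
      have "AE y in lborel. f y s = F (y, s)" using elim s0 by blast
      then have "AE y in lborel. \<bar>F (y, s)\<bar> \<le> \<bar>f y s\<bar>" by eventually_elim simp
      then have "Lp_le (enn2real (1 / q)) (\<lambda>y. F (y, s)) ((\<bar>C\<bar> + 1) * s powr e)"
        by (rule Lp_le_mono[OF L order_refl, rotated 2]) auto
      then show "0 < s \<and> Lp_le (enn2real (1 / q)) (\<lambda>y. F (y, s)) ((\<bar>C\<bar> + 1) * s powr e)"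
        using s0 by simp
    qed
  qed
  moreover have "\<bar>C\<bar> + 1 > 0" by simp
  ultimately show ?thesis by blast
qed

lemma enn2real_reciprocal:
  assumes "1 \<le> q"
  shows "enn2real (1 / q) = (if q = top then 0 else 1 / enn2real q)" "enn2real (1 / q) \<le> 1"
proof -
  show "enn2real (1 / q) = (if q = top then 0 else 1 / enn2real q)"
    using assms divide_ennreal[of 1 "enn2real q"] by (cases q) (auto simp: ennreal_ge_1)
  then show "enn2real (1 / q) \<le> 1" using assms by (cases q) (auto simp: ennreal_ge_1)
qed

lemma Lp_le_mult_mono:
  assumes "Lp_le \<theta> u (A * w)" "A \<le> B" "0 \<le> A" "0 \<le> w" "0 \<le> \<theta>"
  shows "Lp_le \<theta> u (B * w)"
proof (rule Lp_le_mono[OF assms(1)])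
  show "A * w \<le> B * w" "0 \<le> A * w" using assms by (auto intro: mult_right_mono)
qed (use assms in auto)

locale vector_kernel = self_similar_kernel M C0 for M :: "real^'n \<Rightarrow> real \<Rightarrow> real" and C0
begin

lemma decay_exp_eq: "decay_exp CARD('n) q = decay_rate (enn2real (1 / q))"
  by (simp add: decay_exp_def decay_rate_def)

lemma Phi_representative:
  assumes rep: "representative f F"
  shows "Phi M f x t = (LINT s|lborel. (LINT y|lborel. kernel (x - y) (t - s) * F (y, s)))"
proof -
  note F = representativeD[OF rep]
  note [measurable] = F(5)
  have "(LINT s:{0<..<t}|lebesgue. (LINT y|lebesgue. M (x - y) (t - s) * f y s))
      = (LINT s|lborel. (LINT y|lborel. (\<lambda>z. kernel (x - fst z) (t - snd z) * F z) (y, s)))"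
  proof (rule iterated_lebesgue_integral)
    show "AE s in lborel. s \<in> {0<..<t} \<longrightarrow> (AE y in lborel. M (x - y) (t - s) * f y s
        = (\<lambda>z. kernel (x - fst z) (t - snd z) * F z) (y, s))"
      using F(4) by eventually_elim (auto simp: kernel_def elim!: eventually_mono)
    show "(\<lambda>z. kernel (x - fst z) (t - snd z) * F z) (y, s) = 0" if "s \<notin> {0<..<t}" for y s
      using that F(2)[of s y] by (auto simp: kernel_def)
  qed simp
  then show ?thesis by (simp add: Phi_def)
qed

lemma Phi_borel_measurable:
  assumes rep: "representative f F"
  shows "(\<lambda>x. Phi M f x t) \<in> borel_measurable borel"
proof -
  note F = representativeD[OF rep]
  note [measurable] = F(6)
  have "(\<lambda>(x, s). LINT y|lborel. kernel (x - y) (t - s) * F (y, s)) \<in> borel_measurable (borel \<Otimes>\<^sub>M borel)"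
    by measurable
  then show ?thesis
    unfolding Phi_representative[OF rep] by measurable
qed

text \<open>Where the absolute integral \<open>U x\<close> is finite, adding back the integrable
  \<open>M x t * F z\<close> shows that the integral in \<open>Phi\<close> converges as a space-time
  integral. Only then is the difference a single integral bounded by \<open>U x\<close>, and the
  test functions turn this pointwise bound into a norm bound.\<close>

lemma difference_Lp:
  assumes rep: "representative f F" and th: "0 \<le> \<theta>" "\<theta> \<le> 1" and t: "0 < t" and A: "0 \<le> A"
    and dual: "\<forall>g\<in>dual_ball \<theta>.
     (\<integral>\<^sup>+x. (\<integral>\<^sup>+z. ennreal (\<bar>kernel (x - fst z) (t - snd z) - M x t\<bar> * \<bar>F z\<bar>) \<partial>lborel) * ennreal (g x) \<partial>lborel) \<le> ennreal A"
  shows "AE x in lborel. integrable lborel (\<lambda>z. kernel (x - fst z) (t - snd z) * F z)"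
    and "Lp_le \<theta> (\<lambda>x. Phi M f x t - mass f * M x t) A"
proof -
  note F = representativeD[OF rep]
  note [measurable] = F(5) borel_at_time[OF t] Phi_borel_measurable[OF rep]
  define U where "U x = (\<integral>\<^sup>+z. ennreal (\<bar>kernel (x - fst z) (t - snd z) - M x t\<bar> * \<bar>F z\<bar>) \<partial>lborel)" for x
  have [measurable]: "U \<in> borel_measurable borel" unfolding U_def by measurable
  have fin: "AE x in lborel. U x < \<infinity>"
    using dual by (intro finite_AE_of_dual[OF _ th, of _ A]) (auto simp: U_def)
  have int: "integrable lborel (\<lambda>z. kernel (x - fst z) (t - snd z) * F z)"
    and le: "ennreal \<bar>Phi M f x t - mass f * M x t\<bar> \<le> U x" if x: "U x < \<infinity>" for x
  proof -
    have 1: "integrable lborel (\<lambda>z. (kernel (x - fst z) (t - snd z) - M x t) * F z)"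
      using x by (intro integrableI_bounded) (auto simp: U_def abs_mult)
    have 2: "integrable lborel (\<lambda>z. M x t * F z)" using F(1) by simp
    have eq: "kernel (x - fst z) (t - snd z) * F z = (kernel (x - fst z) (t - snd z) - M x t) * F z + M x t * F z" for z
      by (simp add: algebra_simps)
    show int: "integrable lborel (\<lambda>z. kernel (x - fst z) (t - snd z) * F z)"
      unfolding eq using 1 2 by (rule Bochner_Integration.integrable_add)
    have "Phi M f x t = integral\<^sup>L (lborel \<Otimes>\<^sub>M lborel) (case_prod (\<lambda>y s. kernel (x - y) (t - s) * F (y, s)))"
      unfolding Phi_representative[OF rep] using int
      by (intro lborel_pair.integral_snd) (simp add: lborel_prod case_prod_unfold)
    then have "Phi M f x t = (LINT z|lborel. kernel (x - fst z) (t - snd z) * F z)"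
      by (simp add: lborel_prod case_prod_unfold)
    also have "\<dots> = (LINT z|lborel. (kernel (x - fst z) (t - snd z) - M x t) * F z) + (LINT z|lborel. M x t * F z)"
      unfolding eq using 1 2 by (rule Bochner_Integration.integral_add)
    also have "(LINT z|lborel. M x t * F z) = mass f * M x t"
      using mass_representative[OF rep] by simp
    finally have "Phi M f x t - mass f * M x t = (LINT z|lborel. (kernel (x - fst z) (t - snd z) - M x t) * F z)"
      by simp
    then have "ennreal \<bar>Phi M f x t - mass f * M x t\<bar> \<le> (\<integral>\<^sup>+z. ennreal \<bar>(kernel (x - fst z) (t - snd z) - M x t) * F z\<bar> \<partial>lborel)"
      using integral_norm_bound_ennreal[OF 1] by simp
    then show "ennreal \<bar>Phi M f x t - mass f * M x t\<bar> \<le> U x" by (simp add: U_def abs_mult)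
  qed
  show "AE x in lborel. integrable lborel (\<lambda>z. kernel (x - fst z) (t - snd z) * F z)"
    using fin by eventually_elim (rule int)
  show "Lp_le \<theta> (\<lambda>x. Phi M f x t - mass f * M x t) A"
  proof (rule Lp_le_dualI[OF _ A th])
    fix g :: "real^'n \<Rightarrow> real" assume g: "g \<in> dual_ball \<theta>"
    have "(\<integral>\<^sup>+x. ennreal (\<bar>Phi M f x t - mass f * M x t\<bar> * g x) \<partial>lborel) \<le> (\<integral>\<^sup>+x. U x * ennreal (g x) \<partial>lborel)"
      using fin by (intro nn_integral_mono_AE)
        (auto elim!: eventually_mono simp: ennreal_mult' dual_ballD(2)[OF g] intro!: mult_right_mono le)
    also have "\<dots> \<le> ennreal A" using dual g by (simp add: U_def)
    finally show "(\<integral>\<^sup>+x. ennreal (\<bar>Phi M f x t - mass f * M x t\<bar> * g x) \<partial>lborel) \<le> ennreal A" .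
  qed simp
qed

text \<open>What \<open>profile_estimate\<close> asks of the source: exponents for which the kernel
  singularity is integrable in time and \<open>F\<close> decays at the matching rate. The cases of
  the theorem differ mainly in how these are found.\<close>

definition admissible :: "real \<Rightarrow> ((real^'n) \<times> real \<Rightarrow> real) \<Rightarrow> bool" where
  "admissible \<theta> F \<longleftrightarrow> (\<exists>\<mu> \<beta> m C T. Young_exponents \<mu> \<beta> \<theta> \<and> Lp_le \<mu> (\<lambda>x. M x 1) m \<and> 0 < m \<and> decay_rate \<mu> < 1 \<and>
     0 < C \<and> (AE s in lborel. T \<le> s \<longrightarrow> Lp_le \<beta> (\<lambda>y. F (y, s)) (C * s powr (- (1 + decay_rate \<beta>)))))"

lemma difference_eventually:
  assumes rep: "representative f F" and m: "Lp_le \<theta> (\<lambda>x. M x 1) m" "0 < m"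
    and adm: "admissible \<theta> F" and \<epsilon>: "0 < \<epsilon>"
  shows "\<forall>\<^sub>F t in at_top. 0 < t \<and> (AE x in lborel. integrable lborel (\<lambda>z. kernel (x - fst z) (t - snd z) * F z)) \<and>
      Lp_le \<theta> (\<lambda>x. Phi M f x t - mass f * M x t) (\<epsilon> * t powr (- decay_rate \<theta>))"
proof -
  note F = representativeD[OF rep]
  obtain \<mu> \<beta> m' C T where Y: "Young_exponents \<mu> \<beta> \<theta>" and m': "Lp_le \<mu> (\<lambda>x. M x 1) m'" "0 < m'" "decay_rate \<mu> < 1"
    and C: "0 < C" "AE s in lborel. T \<le> s \<longrightarrow> Lp_le \<beta> (\<lambda>y. F (y, s)) (C * s powr (- (1 + decay_rate \<beta>)))"
    using adm by (auto simp: admissible_def)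
  have th: "0 \<le> \<theta>" "\<theta> \<le> 1" using Y by (auto simp: Young_exponents_def)
  have "\<forall>\<^sub>F t in at_top. \<forall>g\<in>dual_ball \<theta>.
     (\<integral>\<^sup>+x. (\<integral>\<^sup>+z. ennreal (\<bar>kernel (x - fst z) (t - snd z) - M x t\<bar> * \<bar>F z\<bar>) \<partial>lborel) * ennreal (g x) \<partial>lborel)
      \<le> ennreal (\<epsilon> * t powr (- decay_rate \<theta>))"
    by (rule profile_estimate[OF Y m m' F(1) _ C \<epsilon>]) (rule F(2))
  with eventually_gt_at_top[of "0::real"] show ?thesis
  proof eventually_elim
    case (elim t)
    then show ?case using difference_Lp[OF rep th elim(1) _ elim(2)] \<epsilon> by auto
  qed
qed

text \<open>The constants come from \<open>M\<close> alone: \<open>c\<close> from the lower bound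
  for \<open>M(t)\<close>, \<open>m\<close> from the norm at time one. The set \<open>Fs\<close> is
  left open so that one argument serves all hypotheses on the source.\<close>

lemma profile_and_boundsI:
  assumes nz: "M x0 t0 \<noteq> 0" "t0 > 0" and q: "1 \<le> q" and m: "Lp_le (enn2real (1 / q)) (\<lambda>x. M x 1) m" "0 < m"
    and int: "\<And>f. f \<in> Fs \<Longrightarrow> set_integrable lebesgue (UNIV \<times> {0<..}) (\<lambda>(y, s). f y s)"
    and adm: "\<And>f F. f \<in> Fs \<Longrightarrow> representative f F \<Longrightarrow> admissible (enn2real (1 / q)) F"
  shows "profile_and_bounds M q Fs"
proof -
  define \<theta> where "\<theta> = enn2real (1 / q)"
  have th: "0 \<le> \<theta>" "\<theta> \<le> 1" using enn2real_reciprocal(2)[OF q] by (auto simp: \<theta>_def)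
  have "\<forall>f\<in>Fs. \<exists>F. representative f F" using borel_representative[OF int] by blast
  from bchoice[OF this] obtain R where R: "\<And>f. f \<in> Fs \<Longrightarrow> representative f (R f)" by blast
  obtain c where c: "c > 0" and low: "\<And>t. t > 0 \<Longrightarrow> \<not> Lp_le \<theta> (\<lambda>x. M x t) (c * t powr (- decay_rate \<theta>))"
    using profile_norm_lower_bound[OF nz th] by blast
  have norm_iff: "Lp_norm q u \<le> ennreal A \<longleftrightarrow> Lp_le \<theta> u A" if "u \<in> borel_measurable borel" "0 \<le> A" for u :: "real^'n \<Rightarrow> real" and A
    using that q by (simp add: Lp_norm_le_iff \<theta>_def measurable_completion)
  have diff: "\<forall>\<^sub>F t in at_top. 0 < t \<and> (AE x in lborel. integrable lborel (\<lambda>z. kernel (x - fst z) (t - snd z) * R f z)) \<and>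
      Lp_le \<theta> (\<lambda>x. Phi M f x t - mass f * M x t) (\<epsilon> * t powr (- decay_rate \<theta>))" if "f \<in> Fs" "0 < \<epsilon>" for f \<epsilon>
    using difference_eventually[OF R[OF that(1)] m[folded \<theta>_def] adm[OF that(1) R[OF that(1)], folded \<theta>_def] that(2)] .
  have "asymptotic_profile M f q" if f: "f \<in> Fs" for f
    unfolding asymptotic_profile_def norm_smallo_def decay_exp_eq \<theta>_def[symmetric]
  proof (intro conjI allI impI)
    note F = representativeD[OF R[OF f]]
    note [measurable] = F(5)
    show "\<forall>\<^sub>F t in at_top. AE x in lebesgue. set_integrable lebesgue (UNIV \<times> {0<..<t}) (\<lambda>(y, s). M (x - y) (t - s) * f y s)"
      using diff[OF f zero_less_one]
    proof eventually_elim
      case (elim t)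
      then have "AE x in lborel. integrable lborel (\<lambda>z. kernel (x - fst z) (t - snd z) * R f z)" by blast
      then have "AE x in lborel. set_integrable lebesgue (UNIV \<times> {0<..<t}) (\<lambda>(y, s). M (x - y) (t - s) * f y s)"
      proof eventually_elim
        case (elim x)
        show ?case
          unfolding set_integrable_def
        proof (subst lebesgue_borel_version(3))
          show "(\<lambda>z. kernel (x - fst z) (t - snd z) * R f z) \<in> borel_measurable borel" by measurable
          show "AE z in lborel. indicator (UNIV \<times> {0<..<t}) z *\<^sub>R (case z of (y, s) \<Rightarrow> M (x - y) (t - s) * f y s)
              = kernel (x - fst z) (t - snd z) * R f z"
            using F(3)
          proof eventually_elim
            case (elim z)
            then show ?case using F(2)[of "snd z" "fst z"]
              by (cases "0 < snd z") (auto simp: kernel_def indicator_def case_prod_beta mem_Times_iff)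
          qed
        qed (fact elim)
      qed
      then show ?case by (simp add: AE_completion_iff)
    qed
    fix \<epsilon> :: real assume "0 < \<epsilon>"
    from diff[OF f this]
    show "\<forall>\<^sub>F t in at_top. Lp_norm q (\<lambda>x. Phi M f x t - mass f * M x t) \<le> ennreal (\<epsilon> * t powr - decay_rate \<theta>)"
      by eventually_elim
        (use \<open>0 < \<epsilon>\<close> Phi_borel_measurable[OF R[OF f]] borel_at_time in \<open>auto simp: norm_iff\<close>)
  qed
  \<comment> \<open>The profile is used with
    \<open>\<epsilon> = \<bar>mass f\<bar> * (c / 3)\<close>. If the norm of \<open>Phi\<close> were
    below the same multiple of the power of \<open>t\<close>, that of \<open>\<lambda> M(t)\<close>
    would be at most two thirds of its lower bound.\<close>
  moreover have "two_sided_bound M f q (c / 3) (c / 3 + m)" if f: "f \<in> Fs" and l0: "mass f \<noteq> 0" for f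
    unfolding two_sided_bound_def decay_exp_eq \<theta>_def[symmetric]
  proof -
    let ?l = "\<bar>mass f\<bar>"
    have l: "?l > 0" using l0 by simp
    have "0 < ?l * (c / 3)" using l c by simp
    from diff[OF f this]
    show "\<forall>\<^sub>F t in at_top.
        ennreal (?l * (c / 3) * t powr - decay_rate \<theta>) \<le> Lp_norm q (\<lambda>x. Phi M f x t) \<and>
        Lp_norm q (\<lambda>x. Phi M f x t) \<le> ennreal (?l * (c / 3 + m) * t powr - decay_rate \<theta>)"
    proof eventually_elim
      case (elim t)
      define r where "r = t powr (- decay_rate \<theta>)"
      have t: "0 < t" and D: "Lp_le \<theta> (\<lambda>x. Phi M f x t - mass f * M x t) (?l * (c / 3) * r)"
        using elim by (auto simp: r_def)
      have r: "r > 0" using t by (simp add: r_def)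
      note meas [measurable] = Phi_borel_measurable[OF R[OF f], of t] borel_at_time[OF t]
      have "Lp_le \<theta> (\<lambda>x. M x t) (m * r)"
        unfolding r_def using m th t by (intro kernel_Lp) (auto simp: \<theta>_def)
      then have "Lp_le \<theta> (\<lambda>x. ?l * M x t) (?l * (m * r))" using l m r th by (subst Lp_le_cmult) auto
      then have lM: "Lp_le \<theta> (\<lambda>x. mass f * M x t) (?l * (m * r))"
        by (rule Lp_le_mono) (use l m r th in \<open>auto simp: abs_mult\<close>)
      have "Lp_le \<theta> (\<lambda>x. (Phi M f x t - mass f * M x t) + mass f * M x t) (?l * (c / 3) * r + ?l * (m * r))"
        using D lM l m r c th by (intro Lp_le_triangle) auto
      then have upper: "Lp_norm q (\<lambda>x. Phi M f x t) \<le> ennreal (?l * (c / 3 + m) * r)"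
        using l m r c by (subst norm_iff) (auto simp: algebra_simps)
      have lower: "ennreal (?l * (c / 3) * r) \<le> Lp_norm q (\<lambda>x. Phi M f x t)"
      proof (rule ccontr)
        assume "\<not> ?thesis"
        then have "Lp_norm q (\<lambda>x. Phi M f x t) \<le> ennreal (?l * (c / 3) * r)" by simp
        then have P: "Lp_le \<theta> (\<lambda>x. Phi M f x t) (?l * (c / 3) * r)"
          using l r c by (subst (asm) norm_iff) auto
        have D': "Lp_le \<theta> (\<lambda>x. - (Phi M f x t - mass f * M x t)) (?l * (c / 3) * r)"
          by (rule Lp_le_mono[OF D]) (use l r c th in auto)
        have "Lp_le \<theta> (\<lambda>x. Phi M f x t + - (Phi M f x t - mass f * M x t)) (?l * (c / 3) * r + ?l * (c / 3) * r)"
          using P D' l r c th by (intro Lp_le_triangle) auto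
        then have "Lp_le \<theta> (\<lambda>x. ?l * M x t) (?l * (c * r))"
          by (rule Lp_le_mono) (use l r c th in \<open>auto simp: abs_mult\<close>)
        then have "Lp_le \<theta> (\<lambda>x. M x t) (c * r)" using l r c th by (subst (asm) Lp_le_cmult) auto
        then show False using low[OF t] by (simp add: r_def)
      qed
      show ?case using upper lower by (simp add: r_def)
    qed
  qed
  moreover have "c / 3 > 0" "c / 3 + m > 0" using c m by auto
  ultimately show ?thesis unfolding profile_and_bounds_def by blast
qed

text \<open>Here \<open>\<beta> = 1\<close> and \<open>\<mu> = \<theta>\<close>: since
  \<open>decay_rate 1\<close> is zero, the required decay is the assumed
  \<open>1 / t\<close>.\<close>

lemma admissible_source:
  assumes rep: "representative f F" and src: "source f" and th: "0 \<le> \<theta>" "\<theta> \<le> 1"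
    and m: "Lp_le \<theta> (\<lambda>x. M x 1) m" "0 < m" and a: "decay_rate \<theta> < 1"
  shows "admissible \<theta> F"
proof -
  have "norm_bigo_ae (\<lambda>t. Lp_norm 1 (\<lambda>x. f x t)) (\<lambda>t. 1 / t)" using src by (simp add: source_def)
  then obtain C T where "C > 0" "AE s in lborel. T \<le> s \<longrightarrow> 0 < s \<and> Lp_le 1 (\<lambda>y. F (y, s)) (C * s powr - 1)"
    using Lp_norm_representative[OF rep, of 1 "\<lambda>t. 1 / t" "- 1"] by (auto simp: powr_minus field_simps)
  then have "\<exists>C>0. \<exists>T. AE s in lborel. T \<le> s \<longrightarrow> Lp_le 1 (\<lambda>y. F (y, s)) (C * s powr (- (1 + decay_rate 1)))"
    by (intro exI[of _ C] conjI exI[of _ T]) (auto simp: decay_rate_def elim!: eventually_mono)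
  moreover have "Young_exponents \<theta> 1 \<theta>" using th by (simp add: Young_exponents_def)
  ultimately show ?thesis using m a unfolding admissible_def by blast
qed

lemma admissible_extra_decay:
  assumes rep: "representative f F" and src: "source f" and th: "0 \<le> \<theta>" "\<theta> < 1"
    and \<beta>: "1 \<le> \<beta>" and b: "b = enn2real (1 / \<beta>)" "\<theta> \<le> b" "b < \<theta> + 2 / real CARD('n)"
    and n2: "CARD('n) \<ge> 2"
    and bigo: "norm_bigo_ae (\<lambda>t. Lp_norm \<beta> (\<lambda>x. f x t)) (\<lambda>t. t powr (- (1 + decay_exp CARD('n) \<beta>)))"
  shows "admissible \<theta> F"
proof (cases "b < 1")
  case False
  obtain m where "m > 0" "Lp_le \<theta> (\<lambda>x. M x 1) m" using profile_Lp[OF th] by blast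
  \<comment> \<open>In this case \<open>b \<ge> 1\<close>, which forces
    \<open>\<theta> > 1 - 2/n\<close>; then the \<open>L^1\<close> decay already suffices.\<close>
  moreover have "decay_rate \<theta> < 1"
  proof -
    have "1 - \<theta> < 2 / real CARD('n)" using False b by linarith
    then show ?thesis by (simp add: decay_rate_def field_simps)
  qed
  ultimately show ?thesis using admissible_source[OF rep src] th by auto
next
  case True
  note F = representativeD[OF rep]
  \<comment> \<open>A midpoint, to make all inequalities strict: above
    \<open>b \<ge> \<theta>\<close> so that \<open>\<mu> < 1\<close>, below 1 for the interpolation
    with \<open>L^1\<close>, and below \<open>\<theta> + 2/n\<close> so that
    \<open>decay_rate \<mu> < 1\<close>.\<close>
  define b' where "b' = (b + min 1 (\<theta> + 2 / real CARD('n))) / 2"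
  have b': "b < b'" "b' < 1" "b' < \<theta> + 2 / real CARD('n)" using True b by (auto simp: b'_def min_def)
  have b0: "0 \<le> b" using b by simp
  define \<mu> where "\<mu> = 1 + \<theta> - b'"
  have "2 / real CARD('n) \<le> 1" using n2 by simp
  then have \<mu>: "0 < \<mu>" "\<mu> < 1" using b(2) b' unfolding \<mu>_def by linarith+
  have Y: "Young_exponents \<mu> b' \<theta>" using b b' b0 th \<mu> by (auto simp: Young_exponents_def \<mu>_def)
  obtain m where m: "m > 0" "Lp_le \<mu> (\<lambda>x. M x 1) m" using profile_Lp[of \<mu>] \<mu> by auto
  have a: "decay_rate \<mu> < 1"
  proof -
    have "1 - \<mu> < 2 / real CARD('n)" using b' by (simp add: \<mu>_def)
    then show ?thesis by (simp add: decay_rate_def field_simps)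
  qed
  have "norm_bigo_ae (\<lambda>t. Lp_norm 1 (\<lambda>x. f x t)) (\<lambda>t. 1 / t)" using src by (simp add: source_def)
  then obtain C1 T1 where C1: "C1 > 0" and 1: "AE s in lborel. T1 \<le> s \<longrightarrow> 0 < s \<and> Lp_le 1 (\<lambda>y. F (y, s)) (C1 * s powr - 1)"
    using Lp_norm_representative[OF rep, of 1 "\<lambda>t. 1 / t" "- 1"] by (auto simp: powr_minus field_simps)
  obtain C2 T2 where C2: "C2 > 0" and 2: "AE s in lborel. T2 \<le> s \<longrightarrow> 0 < s \<and> Lp_le b (\<lambda>y. F (y, s)) (C2 * s powr (- (1 + decay_rate b)))"
    using Lp_norm_representative[OF rep \<beta> bigo refl] unfolding decay_exp_eq b(1)[symmetric] by blast
  define C where "C = max C1 C2"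
  define C' where "C' = (C + C powr (if b = 0 then 1 / b' else 1 / b)) powr b'"
  have C: "C > 0" "C1 \<le> C" "C2 \<le> C" using C1 by (auto simp: C_def)
  have "C + C powr p > 0" for p using C by (intro add_pos_nonneg) auto
  from this[of "if b = 0 then 1 / b' else 1 / b"] have C': "C' > 0"
    unfolding C'_def powr_gt_zero by linarith
  have "AE s in lborel. max T1 T2 \<le> s \<longrightarrow> Lp_le b' (\<lambda>y. F (y, s)) (C' * s powr (- (1 + decay_rate b')))"
    using 1 2
  proof eventually_elim
    case (elim s)
    show ?case
    proof
      assume s: "max T1 T2 \<le> s"
      then have s0: "0 < s" using elim by auto
      have fm: "(\<lambda>y. F (y, s)) \<in> borel_measurable borel" using F(6) by measurable
      have "Lp_le 1 (\<lambda>y. F (y, s)) (C1 * s powr (- 1))" using elim s by simp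
      then have f1: "Lp_le 1 (\<lambda>y. F (y, s)) (C * s powr (- 1))"
        by (rule Lp_le_mult_mono) (use C C1 in auto)
      have "Lp_le b (\<lambda>y. F (y, s)) (C2 * s powr (- (1 + decay_rate b)))" using elim s by simp
      then have "Lp_le b (\<lambda>y. F (y, s)) (C * s powr (- (1 + decay_rate b)))"
        by (rule Lp_le_mult_mono) (use C C2 b0 in auto)
      then have f2: "Lp_le b (\<lambda>y. F (y, s)) (C * s powr (- (1 + real CARD('n) / 2 * (1 - b))))"
        by (simp add: decay_rate_def)
      show "Lp_le b' (\<lambda>y. F (y, s)) (C' * s powr (- (1 + decay_rate b')))"
        using Lp_interpolation[OF fm b0 b'(1,2) s0 C(1) f1 f2] by (simp add: C'_def decay_rate_def)
    qed
  qed
  then show ?thesis using Y m a C' unfolding admissible_def by blast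
qed

end

theorem theorem2p1:
  fixes M :: "real^'n \<Rightarrow> real \<Rightarrow> real" and C0 C1 :: real
  assumes M_C1: "C1_on (UNIV \<times> {0<..}) (\<lambda>(x, t). M x t)"
    and M_nonzero: "\<exists>x. \<exists>t>0. M x t \<noteq> 0"
    and M_self_similar: "\<And>x t. t > 0 \<Longrightarrow>
          M x t = t powr (- (real CARD('n) / 2)) * M ((1 / sqrt t) *\<^sub>R x) 1"
    and M_decay: "\<And>x t. x \<noteq> 0 \<Longrightarrow> t > 0 \<Longrightarrow>
          \<bar>M x t\<bar> \<le> C0 * norm x powr (- real CARD('n))"
    and M_grad_decay: "\<And>x t i. x \<noteq> 0 \<Longrightarrow> t > 0 \<Longrightarrow>
          \<bar>partial_x i M x t\<bar> \<le> C1 * norm x powr (- real CARD('n) - 1)"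
  shows
    "(\<forall>q. 1 < q \<and> (CARD('n) \<ge> 2 \<longrightarrow> q < crit_exp CARD('n)) \<longrightarrow>
        profile_and_bounds M q {f. source f}) \<and>
     (integrable lebesgue (\<lambda>x. M x 1) \<longrightarrow> profile_and_bounds M 1 {f. source f}) \<and>
     (CARD('n) \<ge> 2 \<longrightarrow>
        (\<forall>q. crit_exp CARD('n) \<le> q \<longrightarrow>
           profile_and_bounds M q
             {f. source f \<and>
                 (\<exists>\<beta>. 1 \<le> \<beta> \<and> 1 / q \<le> 1 / \<beta> \<and> 1 / \<beta> < 1 / q + 2 / of_nat CARD('n) \<and>
                      norm_bigo_ae (\<lambda>t. Lp_norm \<beta> (\<lambda>x. f x t))
                        (\<lambda>t. t powr (- (1 + decay_exp CARD('n) \<beta>))))}))"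
proof -
  have cont: "continuous_on (UNIV \<times> {0<..}) (\<lambda>(x, t). M x t)"
  proof -
    obtain g' where g': "\<forall>z\<in>UNIV \<times> {0<..}. ((\<lambda>(x, t). M x t) has_derivative blinfun_apply (g' z)) (at z)"
      using M_C1 by (auto simp: C1_on_def)
    show ?thesis
    proof (intro continuous_at_imp_continuous_on ballI)
      fix z :: "(real^'n) \<times> real" assume "z \<in> UNIV \<times> {0<..}"
      with g' have "((\<lambda>(x, t). M x t) has_derivative blinfun_apply (g' z)) (at z)" by blast
      then show "isCont (\<lambda>(x, t). M x t) z" by (rule has_derivative_continuous)
    qed
  qed
  have "self_similar_kernel M C0"
  proof (rule self_similar_kernel.intro[OF cont])
    show "M x t = t powr (- (real DIM(real^'n) / 2)) * M ((1 / sqrt t) *\<^sub>R x) 1" if "t > 0" for x t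
      using M_self_similar[OF that, of x] by (simp only: DIM_cart DIM_real mult_1_right)
    show "\<bar>M x t\<bar> \<le> C0 * norm x powr (- real DIM(real^'n))" if "x \<noteq> 0" "t > 0" for x t
      using M_decay[OF that] by (simp only: DIM_cart DIM_real mult_1_right)
  qed
  then interpret vector_kernel M C0 by (rule vector_kernel.intro)
  obtain x0 t0 where nz: "M x0 t0 \<noteq> 0" "t0 > 0" using M_nonzero by blast
  define n where "n = real CARD('n)"
  have n1: "n \<ge> 1" by (simp add: n_def Suc_leI)
  have src: "source f \<Longrightarrow> set_integrable lebesgue (UNIV \<times> {0<..}) (\<lambda>(y, s). f y s)" for f :: "real^'n \<Rightarrow> real \<Rightarrow> real"
    by (simp add: source_def)
  note inv = enn2real_reciprocal(1)
  have th: "0 \<le> enn2real (1 / q)" "enn2real (1 / q) < 1" if "1 < q" for q :: ennreal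
    using that by (cases q; simp add: inv)+
  have crit: "crit_exp CARD('n) = (if CARD('n) = 2 then top else ennreal (n / (n - 2)))" if "CARD('n) \<ge> 2"
    using that divide_ennreal[of n "n - 2"]
    by (auto simp: crit_exp_def n_def ennreal_of_nat_eq_real_of_nat ennreal_divide_zero of_nat_diff)
  show ?thesis
  proof (intro conjI allI impI)
    fix q assume q: "1 < q \<and> (CARD('n) \<ge> 2 \<longrightarrow> q < crit_exp CARD('n))"
    then have q1: "1 < q" by blast
    note th = th[OF q1]
    obtain m where m: "m > 0" "Lp_le (enn2real (1 / q)) (\<lambda>x. M x 1) m" using profile_Lp[OF th] by blast
    \<comment> \<open>The claim reads \<open>n (1 - 1/q) < 2\<close>. This is
      \<open>q < n/(n-2)\<close> for \<open>n > 2\<close> and \<open>q < \<infinity>\<close> for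
      \<open>n = 2\<close>, and it always holds for \<open>n = 1\<close>.\<close>
    have a: "decay_rate (enn2real (1 / q)) < 1"
    proof (cases "CARD('n) \<ge> 2")
      case False
      then have "CARD('n) = 1" using zero_less_card_finite[where 'a='n] by linarith
      then have "decay_rate (enn2real (1 / q)) = (1 - enn2real (1 / q)) / 2" by (simp add: decay_rate_def)
      moreover have "(1 - y) / 2 < 1" if "0 \<le> y" for y :: real using that by simp
      ultimately show ?thesis using th(1) by presburger
    next
      case True
      then have "q < crit_exp CARD('n)" using q by blast
      then have qt: "q \<noteq> top" by auto
      then obtain r where r: "q = ennreal r" "r > 1" using q1 by (cases q) auto
      have "n * (1 - 1 / r) < 2"
      proof (cases "CARD('n) = 2")
        case True
        then show ?thesis using r by (simp add: n_def)
      next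
        case n2: False
        then have "n > 2" using True by (simp add: n_def)
        then have "r < n / (n - 2)" using \<open>q < crit_exp CARD('n)\<close> crit[OF True] n2 r by (simp add: ennreal_less_iff)
        then show ?thesis using \<open>n > 2\<close> r by (simp add: field_simps)
      qed
      then show ?thesis using r by (simp add: decay_rate_def inv n_def)
    qed
    show "profile_and_bounds M q {f. source f}"
      using q1 m a th by (intro profile_and_boundsI[OF nz _ m(2,1)] admissible_source[OF _ _ _ _ m(2,1)])
        (auto simp: src)
  next
    assume int: "integrable lebesgue (\<lambda>x. M x 1)"
    have e1: "enn2real (1 / 1) = 1" by simp
    have "integrable lborel (\<lambda>x. M x 1)" using int by (simp add: integrable_completion)
    then have "(\<integral>\<^sup>+x. ennreal \<bar>M x 1\<bar> \<partial>lborel) = ennreal (LINT x|lborel. \<bar>M x 1\<bar>)"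
      by (intro nn_integral_eq_integral) auto
    \<comment> \<open>The added one makes the norm bound strictly positive, as
      \<open>profile_and_boundsI\<close> requires.\<close>
    then have "(\<integral>\<^sup>+x. ennreal \<bar>M x 1\<bar> \<partial>lborel) \<le> ennreal ((LINT x|lborel. \<bar>M x 1\<bar>) + 1)"
      by (simp add: ennreal_leI)
    then have m: "Lp_le 1 (\<lambda>x. M x 1) ((LINT x|lborel. \<bar>M x 1\<bar>) + 1)" "0 < (LINT x|lborel. \<bar>M x 1\<bar>) + 1"
      by (simp_all add: Lp_le_1_iff add_nonneg_pos)
    show "profile_and_bounds M 1 {f. source f}"
    proof (rule profile_and_boundsI[OF nz order_refl])
      show "Lp_le (enn2real (1 / 1)) (\<lambda>x. M x 1) ((LINT x|lborel. \<bar>M x 1\<bar>) + 1)" using m e1 by simp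
      show "admissible (enn2real (1 / 1)) F" if "f \<in> {f. source f}" "representative f F" for f F
        using admissible_source[OF that(2) _ _ _ m] that(1) by (simp add: decay_rate_def)
    qed (use m src in auto)
  next
    fix q assume n2: "CARD('n) \<ge> 2" and q: "crit_exp CARD('n) \<le> q"
    have "1 < crit_exp CARD('n)"
      using n2 by (auto simp: crit n_def one_less_ennreal)
    then have q1: "1 < q" using q by simp
    note th = th[OF q1]
    obtain m where m: "m > 0" "Lp_le (enn2real (1 / q)) (\<lambda>x. M x 1) m" using profile_Lp[OF th] by blast
    show "profile_and_bounds M q {f. source f \<and>
                 (\<exists>\<beta>. 1 \<le> \<beta> \<and> 1 / q \<le> 1 / \<beta> \<and> 1 / \<beta> < 1 / q + 2 / of_nat CARD('n) \<and>
                      norm_bigo_ae (\<lambda>t. Lp_norm \<beta> (\<lambda>x. f x t))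
                        (\<lambda>t. t powr (- (1 + decay_exp CARD('n) \<beta>))))}"
    proof (rule profile_and_boundsI[OF nz _ m(2,1)])
      fix f :: "real^'n \<Rightarrow> real \<Rightarrow> real" and F
      assume f: "f \<in> {f. source f \<and>
                 (\<exists>\<beta>. 1 \<le> \<beta> \<and> 1 / q \<le> 1 / \<beta> \<and> 1 / \<beta> < 1 / q + 2 / of_nat CARD('n) \<and>
                      norm_bigo_ae (\<lambda>t. Lp_norm \<beta> (\<lambda>x. f x t))
                        (\<lambda>t. t powr (- (1 + decay_exp CARD('n) \<beta>))))}" and rep: "representative f F"
      then obtain \<beta> where \<beta>: "1 \<le> \<beta>" "1 / q \<le> 1 / \<beta>" "1 / \<beta> < 1 / q + 2 / of_nat CARD('n)"
        and bigo: "norm_bigo_ae (\<lambda>t. Lp_norm \<beta> (\<lambda>x. f x t)) (\<lambda>t. t powr (- (1 + decay_exp CARD('n) \<beta>)))"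
        by blast
      \<comment> \<open>Reciprocals of exponents at least one are finite, with
        \<open>1 / \<infinity> = 0\<close>, so the conditions on \<open>\<beta>\<close> can be read
        as real inequalities.\<close>
      have f1: "1 / p = ennreal (enn2real (1 / p))" if "1 \<le> p" for p :: ennreal
        using that divide_ennreal[of 1] by (cases p) (auto simp: inv ennreal_ge_1)
      have f2: "2 / of_nat CARD('n) = ennreal (2 / n)"
        using n1 divide_ennreal[of 2 n] by (simp add: n_def ennreal_of_nat_eq_real_of_nat)
      have "ennreal (enn2real (1 / q)) \<le> ennreal (enn2real (1 / \<beta>))"
        using \<beta>(2) f1[of q] f1[OF \<beta>(1)] q1 by simp
      then have b1: "enn2real (1 / q) \<le> enn2real (1 / \<beta>)" by simp
      have "ennreal (enn2real (1 / \<beta>)) < ennreal (enn2real (1 / q) + 2 / n)"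
        using \<beta>(3) f1[of q] f1[OF \<beta>(1)] q1 n1 unfolding f2 by simp
      then have b2: "enn2real (1 / \<beta>) < enn2real (1 / q) + 2 / real CARD('n)"
        unfolding n_def by (subst (asm) ennreal_less_iff) simp_all
      show "admissible (enn2real (1 / q)) F"
        using admissible_extra_decay[OF rep _ th \<beta>(1) refl b1 b2 n2 bigo] f by blast
    qed (use q1 src in auto)
  qed
qed

end
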